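(* Let $r\ge3$. (a) For every full $r$-SAT formula $H$ there is a sequence of polynomials $p_1^{(H)},p_2^{(H)},\ldots$ with rational coefficients such that, for any $\alpha=\alpha(n)=\Theta(1)$ with $\sup_n\alpha(n)<\alpha^*_r$ and any positive integer $s_{\max}$, if $p=\alpha n^{-(r-1)}$ and $F\in\mathcal F^r_{n,p}$ is a random formula, then $$\Pr(F\text{ contains a copy of }H)=\sum_{s=1}^{s_{\max}}p_s^{(H)}(\alpha)\,n^{-s}+O(n^{-s_{\max}-1}).$$ (b) There is a sequence of polynomials $p_1,p_2,\ldots$ with rational coefficients, and similarly a sequence of polynomials $p'_1,p'_2,\ldots$ with rational coefficients, such that, for any $\alpha$, $s_{\max}$, $p$, $F$ as in (a), $$\Pr(F\text{ is unsatisfiable})=\sum_{s=1}^{s_{\max}}p_s(\alpha)\,n^{-s}+O(n^{-s_{\max}-1}),$$ $$\Pr(\text{the pure literal rule fails on }F)=\sum_{s=1}^{s_{\max}}p'_s(\alpha)\,n^{-s}+O(n^{-s_{\max}-1}).$$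
   Context: An $r$-SAT formula consists of a finite set of variables and a set of clauses, each clause consisting of $r$ literals (variables or negated variables) on $r$ distinct variables of the formula. It is satisfiable if some True/False assignment of the variables makes at least one literal in each clause True. The random formula $\mathcal F^r_{n,p}$ has $n$ variables, each of the $2^r\binom nr$ possible clauses being present independently with probability $p$. Two formulae are isomorphic if one is obtained from the other by a bijection of variables together with flipping the signs of some variables. $H'$ is a subformula of $F$ if its variable and clause sets are subsets of those of $F$; a copy of $H$ in $F$ is a subformula of $F$ isomorphic to $H$. A formula is full if it has at least one clause and, for each of its variables $v$, both literals $v$ and $\neg v$ appear in clauses of it. A literal is pure in $F$ if its complement appears in no clause of $F$. The pure literal rule repeatedly chooses a pure literal, and deletes its variable and all clauses containing that literal; it fails on $F$ if it does not eventually reduce $F$ to a formula with no clauses (this does not depend on the choices made, and is equivalent to $F$ having a full subformula). The pure literal threshold is $\displaystyle\alpha^*_r=\min_{y>0}\frac{(r-1)!\,y}{2^{r-1}(1-e^{-y})^{r-1}}$. *)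

theory Defs
  imports
    "HOL-Probability.Probability"
    "HOL-Library.Landau_Symbols"
    "HOL-Computational_Algebra.Polynomial"
begin

text \<open>The literal \<open>(v, True)\<close> stands for \<open>v\<close>, and \<open>(v, False)\<close> for its negation.\<close>

type_synonym 'v literal = "'v \<times> bool"
type_synonym 'v clause = "'v literal set"

datatype 'v formula = Formula (vars: "'v set") (clauses: "'v clause set")

definition all_clauses :: "nat \<Rightarrow> 'v set \<Rightarrow> 'v clause set" where
  "all_clauses r V = {C. C \<subseteq> V \<times> UNIV \<and> inj_on fst C \<and> card C = r}"

definition sat_formula :: "nat \<Rightarrow> 'v formula \<Rightarrow> bool" where
  "sat_formula r F \<longleftrightarrow> finite (vars F) \<and> clauses F \<subseteq> all_clauses r (vars F)"

definition satisfiable :: "'v formula \<Rightarrow> bool" where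
  "satisfiable F \<longleftrightarrow> (\<exists>\<tau>::'v \<Rightarrow> bool. \<forall>C\<in>clauses F. \<exists>(v, b)\<in>C. \<tau> v = b)"

text \<open>The function \<open>\<sigma>\<close> marks the variables whose sign is flipped.\<close>

definition isomorphic :: "'v formula \<Rightarrow> 'w formula \<Rightarrow> bool" where
  "isomorphic F G \<longleftrightarrow>
     (\<exists>(f::'v \<Rightarrow> 'w) (\<sigma>::'v \<Rightarrow> bool). bij_betw f (vars F) (vars G) \<and>
        clauses G = (\<lambda>C. (\<lambda>(v, b). (f v, b \<noteq> \<sigma> v)) ` C) ` clauses F)"

definition subformula :: "nat \<Rightarrow> 'v formula \<Rightarrow> 'v formula \<Rightarrow> bool" where
  "subformula r G F \<longleftrightarrow> sat_formula r G \<and> vars G \<subseteq> vars F \<and> clauses G \<subseteq> clauses F"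

definition contains_copy :: "nat \<Rightarrow> 'v formula \<Rightarrow> 'w formula \<Rightarrow> bool" where
  "contains_copy r H F \<longleftrightarrow> (\<exists>G. subformula r G F \<and> isomorphic H G)"

definition full :: "'v formula \<Rightarrow> bool" where
  "full F \<longleftrightarrow> clauses F \<noteq> {} \<and> (\<forall>v\<in>vars F. \<forall>b. \<exists>C\<in>clauses F. (v, b) \<in> C)"

definition pure :: "'v formula \<Rightarrow> 'v literal \<Rightarrow> bool" where
  "pure F l \<longleftrightarrow> fst l \<in> vars F \<and> (\<forall>C\<in>clauses F. (fst l, \<not> snd l) \<notin> C)"

definition pure_step :: "'v formula \<Rightarrow> 'v formula \<Rightarrow> bool" where
  "pure_step F G \<longleftrightarrow>
     (\<exists>l. pure F l \<and> G = Formula (vars F - {fst l}) {C \<in> clauses F. l \<notin> C})"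

text \<open>Whether a formula without clauses is reached does not depend on the pure literals chosen,
  so failure may be expressed by saying that no sequence of choices reaches one.\<close>

definition pure_literal_rule_fails :: "'v formula \<Rightarrow> bool" where
  "pure_literal_rule_fails F \<longleftrightarrow> \<not> (\<exists>G. pure_step\<^sup>*\<^sup>* F G \<and> clauses G = {})"

text \<open>The function \<open>bernoulli_pmf\<close> truncates its parameter to the interval from 0 to 1; this
  is relevant only for those small \<open>n\<close> where the intended clause probability is not in it.\<close>

definition random_sat_formula :: "nat \<Rightarrow> nat \<Rightarrow> real \<Rightarrow> nat formula pmf" where
  "random_sat_formula r n p =
     map_pmf (\<lambda>present. Formula {..<n} {C \<in> all_clauses r {..<n}. present C})
       (Pi_pmf (all_clauses r {..<n}) False (\<lambda>_. bernoulli_pmf p))"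

text \<open>For \<open>r \<ge> 3\<close> the function below is continuous and tends to infinity both as \<open>y\<close> tends
  to 0 and as \<open>y\<close> tends to infinity, so the infimum is a minimum.\<close>

definition pure_literal_threshold :: "nat \<Rightarrow> real" where
  "pure_literal_threshold r =
     (INF y\<in>{0<..}. fact (r - 1) * y / (2 ^ (r - 1) * (1 - exp (- y)) ^ (r - 1)))"

text \<open>The symbol \<open>\<Theta>\<close> only constrains absolute values, so positivity is stated separately.
  It also makes \<open>\<alpha>\<close> bounded, so that the supremum is well-behaved.\<close>

definition subcritical :: "nat \<Rightarrow> (nat \<Rightarrow> real) \<Rightarrow> bool" where
  "subcritical r \<alpha> \<longleftrightarrow> (\<forall>\<^sub>F n in sequentially. 0 < \<alpha> n) \<and> \<alpha> \<in> \<Theta>(\<lambda>_. 1) \<and>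
     (SUP n\<in>{1..}. \<alpha> n) < pure_literal_threshold r"

abbreviation rat_poly_eval :: "rat poly \<Rightarrow> real \<Rightarrow> real" where
  "rat_poly_eval q x \<equiv> poly (map_poly of_rat q) x"

end

theory Submission
  imports Defs "HOL-Real_Asymp.Real_Asymp"
begin

text \<open>
  A full subformula is a clause set \<open>G\<close> whose literals are closed under negation (\<open>balanced\<close>). Each of
  the three events only depends on the largest such subset of \<open>F\<close>, so in the Moebius inversion of its
  indicator over the subsets of \<open>F\<close> all unbalanced sets cancel. If \<open>F\<close> has no balanced subset with \<open>M\<close> or
  more variables, the indicator is a sum of weights over the balanced \<open>G \<subseteq> F\<close> with fewer than \<open>M\<close>
  variables, and the expectation of this sum is a finite combination of the terms
  \<open>(n choose v) * p ^ c\<close>, where \<open>2 * v \<le> r * c\<close>: this gives the polynomials.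

  It remains to see that for every \<open>s\<close> a balanced subset with at least \<open>3 * s\<close> variables has probability
  \<open>O(1 / n ^ s)\<close>. Up to \<open>\<epsilon> * n\<close> variables this is a first moment computation. For larger sets, let layer
  \<open>0\<close> consist of all literals, and let layer \<open>t + 1\<close> consist of the literals \<open>l\<close> of clauses \<open>C\<close> such that the
  negations of all other literals of \<open>C\<close> are in layer \<open>t\<close>. Every layer contains all literals of all
  balanced subsets. Removing the variable of \<open>l\<close> makes the clauses at \<open>l\<close> independent of the layer,
  which is harmless unless there is a short cycle near \<open>l\<close>; so the density of the layers follows the
  branching recursion \<open>y \<mapsto> 1 - exp (- \<lambda> * y ^ (r - 1))\<close>, whose iterates tend to \<open>0\<close> exactly
  below the threshold, and a bounded-differences inequality makes deviations superpolynomially rare.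
\<close>

section \<open>Random subsets\<close>

text \<open>The threshold comes from the fixpoint equation
  \<open>x = 1 - exp (- \<lambda> * x ^ (r - 1))\<close>: with
  \<open>y = \<lambda> * x ^ (r - 1)\<close> it becomes
  \<open>y = \<lambda> * (1 - exp (- y)) ^ (r - 1)\<close>, and the threshold is the least density
  with a positive solution. The ratio of \<open>3 * s\<close> variables to the bound
  \<open>1 / n ^ s\<close> comes from \<open>r \<ge> 3\<close>: balanced sets with \<open>v\<close>
  variables and \<open>c\<close> clauses number about \<open>n\<close> to the power
  \<open>v - (r - 1) * c\<close> on average, and \<open>2 * v \<le> r * c\<close> makes this
  exponent at most \<open>- v / 3\<close>. For \<open>v\<close> linear in \<open>n\<close> factors
  exponential in \<open>v\<close> spoil this count, hence the layers. Two obstacles shape the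
  details. One clause can change a layer drastically when degrees are high, so concentration is
  proved for a version with capped degrees. And when a balanced subset with \<open>M\<close> or more
  variables exists, the truncated Moebius sum may be as large as a power of \<open>n\<close>, not
  merely wrong by a constant; a second, larger cut-off whose failure probability beats this power
  repairs that. Since \<alpha> may vary with \<open>n\<close>, all estimates use only an upper bound
  \<open>a\<close> of it.\<close>

text \<open>As a finite sum this can be handled by induction on \<open>I\<close>; identities hold
  for every real \<open>p\<close>, and only inequalities require a probability. The law of the
  random formula enters through \<open>expect_Pi_pmf\<close>.\<close>

definition expect :: "'a set \<Rightarrow> real \<Rightarrow> ('a set \<Rightarrow> real) \<Rightarrow> real" where
  "expect I p f = (\<Sum>S\<in>Pow I. p ^ card S * (1 - p) ^ (card I - card S) * f S)"

lemma expect_empty [simp]: "expect {} p f = f {}"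
  by (simp add: expect_def)

lemma expect_insert:
  assumes "finite I" "i \<notin> I"
  shows "expect (insert i I) p f = p * expect I p (\<lambda>S. f (insert i S)) + (1 - p) * expect I p f"
proof -
  have inj: "inj_on (insert i) (Pow I)"
    using assms(2) by (auto simp: inj_on_def)
  have disj: "Pow I \<inter> insert i ` Pow I = {}"
    using assms(2) by auto
  have 1: "p ^ card (insert i S) * (1 - p) ^ (Suc (card I) - card (insert i S)) * f (insert i S)
      = p * (p ^ card S * (1 - p) ^ (card I - card S) * f (insert i S))" if "S \<in> Pow I" for S
  proof -
    have "finite S" "i \<notin> S" using that assms finite_subset by auto
    then show ?thesis by simp
  qed
  have 2: "p ^ card S * (1 - p) ^ (Suc (card I) - card S) * f S
      = (1 - p) * (p ^ card S * (1 - p) ^ (card I - card S) * f S)" if "S \<in> Pow I" for S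
  proof -
    have "card S \<le> card I" using that assms card_mono by auto
    then show ?thesis by (simp add: Suc_diff_le)
  qed
  have "expect (insert i I) p f
      = (\<Sum>S\<in>Pow I. p ^ card S * (1 - p) ^ (Suc (card I) - card S) * f S)
      + (\<Sum>S\<in>Pow I. p ^ card (insert i S) * (1 - p) ^ (Suc (card I) - card (insert i S)) * f (insert i S))"
    unfolding expect_def Pow_insert using assms disj inj
    by (subst sum.union_disjoint) (auto simp: sum.reindex)
  also have "\<dots> = (1 - p) * expect I p f + p * expect I p (\<lambda>S. f (insert i S))"
    unfolding expect_def sum_distrib_left using 1 2 by (auto intro!: arg_cong2[where f="(+)"] sum.cong)
  finally show ?thesis by simp
qed

lemma expect_add: "expect I p (\<lambda>S. f S + g S) = expect I p f + expect I p g"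
  by (simp add: expect_def algebra_simps sum.distrib)

lemma expect_diff: "expect I p (\<lambda>S. f S - g S) = expect I p f - expect I p g"
  by (simp add: expect_def algebra_simps sum_subtractf)

lemma expect_cmult: "expect I p (\<lambda>S. c * f S) = c * expect I p f"
  by (simp add: expect_def sum_distrib_left mult_ac)

lemma expect_sum: "expect I p (\<lambda>S. \<Sum>x\<in>X. f x S) = (\<Sum>x\<in>X. expect I p (f x))"
  unfolding expect_def by (simp add: sum_distrib_left) (rule sum.swap)

lemma expect_cong: "(\<And>S. S \<subseteq> I \<Longrightarrow> f S = g S) \<Longrightarrow> expect I p f = expect I p g"
  unfolding expect_def by (auto intro: sum.cong)

lemma expect_mono:
  "0 \<le> p \<Longrightarrow> p \<le> 1 \<Longrightarrow> (\<And>S. S \<subseteq> I \<Longrightarrow> f S \<le> g S) \<Longrightarrow> expect I p f \<le> expect I p g"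
  unfolding expect_def by (auto intro!: sum_mono mult_left_mono)

lemma expect_const [simp]:
  assumes "finite I" shows "expect I p (\<lambda>_. c) = c"
  using assms by (induction I) (auto simp: expect_insert algebra_simps)

lemma expect_nonneg:
  "0 \<le> p \<Longrightarrow> p \<le> 1 \<Longrightarrow> (\<And>S. S \<subseteq> I \<Longrightarrow> 0 \<le> f S) \<Longrightarrow> 0 \<le> expect I p f"
  unfolding expect_def by (auto intro!: sum_nonneg)

lemma expect_abs: "0 \<le> p \<Longrightarrow> p \<le> 1 \<Longrightarrow> \<bar>expect I p f\<bar> \<le> expect I p (\<lambda>S. \<bar>f S\<bar>)"
  unfolding expect_def
  by (rule order.trans[OF sum_abs]) (auto intro!: sum_mono simp: abs_mult power_abs)

lemma expect_Un:
  assumes "finite I" "finite J" "I \<inter> J = {}"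
  shows "expect (I \<union> J) p f = expect I p (\<lambda>S. expect J p (\<lambda>T. f (S \<union> T)))"
  using assms
proof (induction I arbitrary: f)
  case (insert i I)
  then show ?case by (simp add: expect_insert)
qed simp

lemma expect_restrict:
  assumes "finite I" "J \<subseteq> I"
  shows "expect I p (\<lambda>S. f (S \<inter> J)) = expect J p f"
proof -
  have I: "I = J \<union> (I - J)" and fin: "finite J" "finite (I - J)"
    using assms finite_subset by auto
  have "expect I p (\<lambda>S. f (S \<inter> J)) = expect J p (\<lambda>S. expect (I - J) p (\<lambda>T. f ((S \<union> T) \<inter> J)))"
    by (subst I, subst expect_Un) (use fin in auto)
  also have "\<dots> = expect J p (\<lambda>S. expect (I - J) p (\<lambda>T. f S))"
    by (intro expect_cong arg_cong[where f=f]) auto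
  finally show ?thesis using fin by simp
qed

lemma expect_superset:
  assumes "finite I" "G \<subseteq> I"
  shows "expect I p (\<lambda>S. of_bool (G \<subseteq> S)) = p ^ card G"
proof -
  have fin: "finite G" using assms finite_subset by auto
  have *: "expect G p (\<lambda>S. of_bool (G \<subseteq> S)) = p ^ card G"
    using fin
  proof (induction G)
    case (insert i G)
    have "expect G p (\<lambda>S. of_bool (insert i G \<subseteq> insert i S)) = expect G p (\<lambda>S. of_bool (G \<subseteq> S))"
      "expect G p (\<lambda>S. of_bool (insert i G \<subseteq> S)) = expect G p (\<lambda>S. 0)"
      using insert.hyps by (intro expect_cong; auto)+
    then show ?case using insert by (simp add: expect_insert)
  qed simp
  have "expect I p (\<lambda>S. of_bool (G \<subseteq> S)) = expect I p (\<lambda>S. of_bool (G \<subseteq> S \<inter> G))"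
    by simp
  also have "\<dots> = p ^ card G"
    using expect_restrict[OF assms, of p "\<lambda>S. of_bool (G \<subseteq> S)"] * by simp
  finally show ?thesis .
qed

lemma expect_hit:
  assumes "finite I" "J \<subseteq> I"
  shows "expect I p (\<lambda>S. of_bool (S \<inter> J \<noteq> {})) = 1 - (1 - p) ^ card J"
proof -
  have fin: "finite J" using assms finite_subset by auto
  have "expect J p (\<lambda>S. of_bool (S \<noteq> {})) = 1 - (1 - p) ^ card J"
    using fin proof (induction J)
    case (insert i J)
    then have "expect J p (\<lambda>S. of_bool (S \<noteq> {})) = 1 - (1 - p) ^ card J" by simp
    then have "expect (insert i J) p (\<lambda>S. of_bool (S \<noteq> {})) = p + (1 - p) * (1 - (1 - p) ^ card J)"
      using insert.hyps by (simp add: expect_insert)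
    with insert.hyps show ?case by (simp add: algebra_simps)
  qed simp
  then show ?thesis
    using expect_restrict[OF assms, of p "\<lambda>S. of_bool (S \<noteq> {})"] by simp
qed

lemma expect_union_bound:
  assumes "0 \<le> p" "p \<le> 1" "finite X"
    and "\<And>S. S \<subseteq> I \<Longrightarrow> P S \<Longrightarrow> \<exists>x\<in>X. R x S"
  shows "expect I p (\<lambda>S. of_bool (P S)) \<le> (\<Sum>x\<in>X. expect I p (\<lambda>S. of_bool (R x S)))"
  unfolding expect_sum[symmetric]
proof (intro expect_mono assms)
  fix S assume "S \<subseteq> I"
  show "of_bool (P S) \<le> (\<Sum>x\<in>X. of_bool (R x S) :: real)"
  proof (cases "P S")
    case True
    then obtain x where "x \<in> X" "R x S" using assms(4) \<open>S \<subseteq> I\<close> by blast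
    then show ?thesis using assms(3) member_le_sum[of x X "\<lambda>x. of_bool (R x S)::real"] by simp
  qed (auto intro: sum_nonneg)
qed

text \<open>First-moment method. The index \<open>x\<close> is a certificate that may carry more
  data than the set \<open>G x\<close> it forces to be present, so certificates can be counted in
  stages over a \<open>Sigma\<close> set.\<close>

lemma expect_exists_superset:
  assumes "0 \<le> p" "p \<le> 1" "finite X" "finite I" "\<And>x. x \<in> X \<Longrightarrow> G x \<subseteq> I"
    and "\<And>S. S \<subseteq> I \<Longrightarrow> P S \<Longrightarrow> \<exists>x\<in>X. G x \<subseteq> S"
  shows "expect I p (\<lambda>S. of_bool (P S)) \<le> (\<Sum>x\<in>X. p ^ card (G x))"
  using expect_union_bound[OF assms(1-3), of I P "\<lambda>x S. G x \<subseteq> S"] assms(4-6)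
  by (simp add: expect_superset)

lemma expect_Markov:
  assumes "0 \<le> p" "p \<le> 1" "\<And>S. S \<subseteq> I \<Longrightarrow> 0 \<le> f S" "0 < a" "\<And>S. S \<subseteq> I \<Longrightarrow> P S \<Longrightarrow> a \<le> f S"
  shows "expect I p (\<lambda>S. of_bool (P S)) \<le> expect I p f / a"
proof -
  have "expect I p (\<lambda>S. of_bool (P S)) \<le> expect I p (\<lambda>S. (1 / a) * f S)"
    using assms by (intro expect_mono) (auto simp: field_simps)
  then show ?thesis unfolding expect_cmult by simp
qed

section \<open>Exponential moments of functions of a sparse random set\<close>

lemma exp_minus_affine_le:
  fixes x :: real
  assumes "0 \<le> x" "x \<le> 1"
  shows "exp x - 1 - x \<le> x\<^sup>2"
  using exp_bound[of x] assms by simp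

text \<open>A bounded-differences estimate for sparse sets: as an element is present only with probability
  \<open>p\<close>, its contribution to the exponent carries a factor \<open>p\<close>.\<close>

lemma expect_exp_le:
  fixes f :: "'a set \<Rightarrow> real" and p c \<theta> :: real
  assumes "finite I" "0 \<le> p" "p \<le> 1" "0 \<le> \<theta>" "0 \<le> c" "\<theta> * c \<le> 1"
    and "\<And>S i. S \<subseteq> I \<Longrightarrow> i \<in> I \<Longrightarrow> i \<notin> S \<Longrightarrow> f S \<le> f (insert i S) \<and> f (insert i S) \<le> f S + c"
  shows "expect I p (\<lambda>S. exp (\<theta> * f S)) \<le> exp (\<theta> * expect I p f + card I * p * (\<theta> * c)\<^sup>2)"
  using assms(1) assms(7)
proof (induction I arbitrary: f)
  case (insert i I)
  define a b where "a = expect I p f" and "b = expect I p (\<lambda>S. f (insert i S))"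
  define d where "d = b - a"
  let ?E = "exp (real (card I) * p * (\<theta> * c)\<^sup>2)"
  have d: "0 \<le> d" "d \<le> c"
  proof -
    have "d = expect I p (\<lambda>S. f (insert i S) - f S)" by (simp add: d_def a_def b_def expect_diff)
    moreover have "0 \<le> f (insert i S) - f S \<and> f (insert i S) - f S \<le> c" if "S \<subseteq> I" for S
      using insert.prems[of S i] insert.hyps that by (auto simp: algebra_simps)
    ultimately show "0 \<le> d" "d \<le> c"
      using assms(2,3) expect_mono[of p I "\<lambda>S. f (insert i S) - f S" "\<lambda>_. c"] insert.hyps
      by (auto intro!: expect_nonneg)
  qed
  have IH0: "expect I p (\<lambda>S. exp (\<theta> * f S)) \<le> exp (\<theta> * a) * ?E"
    unfolding a_def exp_add[symmetric] by (rule insert.IH) (use insert.prems insert.hyps in auto)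
  have IH1: "expect I p (\<lambda>S. exp (\<theta> * f (insert i S))) \<le> exp (\<theta> * b) * ?E"
    unfolding b_def exp_add[symmetric]
    by (rule insert.IH) (use insert.prems[of "insert i _"] insert.hyps in \<open>auto simp: insert_commute\<close>)
  \<comment> \<open>Here \<open>a\<close> and \<open>b = a + d\<close> are the means without and
    with \<open>i\<close>. The inequality \<open>1 + x \<le> exp x\<close> moves the average into
    the exponent, where the linear part \<open>p * \<theta> * d\<close> turns \<open>a\<close> into
    the full mean and the quadratic part is the cost of \<open>i\<close>. The bound on the quadratic
    part uses \<open>\<theta> * c \<le> 1\<close>.\<close>
  have "p * exp (\<theta> * b) + (1 - p) * exp (\<theta> * a) = exp (\<theta> * a) * (1 + p * (exp (\<theta> * d) - 1))"
    unfolding d_def by (simp add: algebra_simps exp_diff)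
  also have "1 + p * (exp (\<theta> * d) - 1) \<le> exp (p * (exp (\<theta> * d) - 1))"
    by (rule exp_ge_add_one_self)
  also have "p * (exp (\<theta> * d) - 1) \<le> p * (\<theta> * d + (\<theta> * c)\<^sup>2)"
  proof (rule mult_left_mono)
    have "\<theta> * d \<le> \<theta> * c" "0 \<le> \<theta> * d" using d assms by (auto intro: mult_left_mono)
    then have "exp (\<theta> * d) - 1 - \<theta> * d \<le> (\<theta> * d)\<^sup>2" "(\<theta> * d)\<^sup>2 \<le> (\<theta> * c)\<^sup>2"
      using exp_minus_affine_le[of "\<theta> * d"] assms(6) by (auto intro: power_mono)
    then show "exp (\<theta> * d) - 1 \<le> \<theta> * d + (\<theta> * c)\<^sup>2" by linarith
  qed (use assms in auto)
  finally have key: "p * exp (\<theta> * b) + (1 - p) * exp (\<theta> * a)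
      \<le> exp (\<theta> * a) * exp (p * (\<theta> * d + (\<theta> * c)\<^sup>2))" by simp
  have "expect (insert i I) p (\<lambda>S. exp (\<theta> * f S))
      = p * expect I p (\<lambda>S. exp (\<theta> * f (insert i S))) + (1 - p) * expect I p (\<lambda>S. exp (\<theta> * f S))"
    using insert.hyps by (simp add: expect_insert)
  also have "\<dots> \<le> p * (exp (\<theta> * b) * ?E) + (1 - p) * (exp (\<theta> * a) * ?E)"
    using IH0 IH1 assms by (intro add_mono mult_left_mono) auto
  also have "\<dots> = (p * exp (\<theta> * b) + (1 - p) * exp (\<theta> * a)) * ?E" by (simp add: algebra_simps)
  also have "\<dots> \<le> exp (\<theta> * a) * exp (p * (\<theta> * d + (\<theta> * c)\<^sup>2)) * ?E"
    using key by (intro mult_right_mono) auto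
  also have "\<dots> = exp (\<theta> * (p * b + (1 - p) * a) + card (insert i I) * p * (\<theta> * c)\<^sup>2)"
    using insert.hyps unfolding exp_add[symmetric] d_def by (simp add: algebra_simps)
  also have "p * b + (1 - p) * a = expect (insert i I) p f"
    using insert.hyps by (simp add: expect_insert a_def b_def)
  finally show ?case .
qed simp

section \<open>Transfer to the distribution of the random formula\<close>

lemma expect_Pi_pmf:
  assumes "finite I" "0 \<le> p" "p \<le> 1"
  shows "measure_pmf.prob (Pi_pmf I False (\<lambda>_. bernoulli_pmf p)) {f. P {i\<in>I. f i}}
    = expect I p (\<lambda>S. of_bool (P S))"
  using assms(1)
proof (induction I arbitrary: P)
  case empty
  then show ?case by (simp add: indicator_def)
next
  case (insert i I)
  let ?M = "Pi_pmf I False (\<lambda>_. bernoulli_pmf p)"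
  have *: "{j. (j = i \<or> j \<in> I) \<and> (f(i := b)) j} = (if b then insert i {j\<in>I. f j} else {j\<in>I. f j})" for f b
    using insert.hyps by auto
  have "measure_pmf.prob (Pi_pmf (insert i I) False (\<lambda>_. bernoulli_pmf p)) {f. P {j\<in>insert i I. f j}}
      = measure_pmf.prob (bernoulli_pmf p \<bind> (\<lambda>b. map_pmf (\<lambda>f. f(i := b)) ?M)) {f. P {j\<in>insert i I. f j}}"
    using insert.hyps by (subst Pi_pmf_insert') (auto simp: map_pmf_def)
  also have "\<dots> = measure_pmf.expectation (bernoulli_pmf p)
      (\<lambda>b. measure_pmf.prob (map_pmf (\<lambda>f. f(i := b)) ?M) {f. P {j\<in>insert i I. f j}})"
    unfolding measure_pmf_bind
    by (subst measure_pmf.measure_bind[where N="count_space UNIV"])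
       (auto simp: measure_pmf_in_subprob_space)
  also have "\<dots> = measure_pmf.expectation (bernoulli_pmf p)
      (\<lambda>b. expect I p (\<lambda>S. of_bool (P (if b then insert i S else S))))"
  proof (intro arg_cong[where f="measure_pmf.expectation _"] ext)
    fix b
    show "measure_pmf.prob (map_pmf (\<lambda>f. f(i := b)) ?M) {f. P {j\<in>insert i I. f j}}
        = expect I p (\<lambda>S. of_bool (P (if b then insert i S else S)))"
      using insert.IH[of "\<lambda>S. P (insert i S)"] insert.IH[of P]
      by (cases b) (simp_all add: vimage_def * del: fun_upd_apply)
  qed
  also have "\<dots> = expect (insert i I) p (\<lambda>S. of_bool (P S))"
    using assms insert.hyps by (simp add: expect_insert)
  finally show ?case .
qed

lemma finite_all_clauses: "finite V \<Longrightarrow> finite (all_clauses r V)"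
  by (rule finite_subset[of _ "Pow (V \<times> UNIV)"]) (auto simp: all_clauses_def)

lemma prob_random_sat_formula:
  assumes "0 \<le> p" "p \<le> 1"
  shows "measure_pmf.prob (random_sat_formula r n p) {F. P F}
    = expect (all_clauses r {..<n}) p (\<lambda>S. of_bool (P (Formula {..<n} S)))"
  using expect_Pi_pmf[of "all_clauses r {..<n}" p "\<lambda>S. P (Formula {..<n} S)"] assms
  by (simp add: random_sat_formula_def finite_all_clauses vimage_def)

section \<open>Balanced clause sets and layers of supported literals\<close>

definition neg :: "'v literal \<Rightarrow> 'v literal" where
  "neg l = (fst l, \<not> snd l)"

definition clause_vars :: "'v clause set \<Rightarrow> 'v set" where
  "clause_vars S = fst ` \<Union>S"

definition clause_degree :: "'v clause set \<Rightarrow> 'v \<Rightarrow> nat" where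
  "clause_degree S v = card {C \<in> S. v \<in> fst ` C}"

lemma neg_neg [simp]: "neg (neg l) = l"
  by (simp add: neg_def)

lemma fst_neg [simp]: "fst (neg l) = fst l"
  by (simp add: neg_def)

lemma neg_neq [simp]: "neg l \<noteq> l" "l \<noteq> neg l"
  by (auto simp: neg_def prod_eq_iff)

lemma inj_neg: "inj_on neg A"
  by (metis inj_onI neg_neg)

lemma fst_eq_iff_literal: "fst l = fst m \<longleftrightarrow> l = m \<or> l = neg m"
  by (cases l; cases m) (auto simp: neg_def)

lemma all_clauses_literal_eq:
  "C \<in> all_clauses r V \<Longrightarrow> l \<in> C \<Longrightarrow> m \<in> C \<Longrightarrow> fst l = fst m \<Longrightarrow> l = m"
  by (auto simp: all_clauses_def inj_on_def)

lemma neg_notin_clause: "C \<in> all_clauses r V \<Longrightarrow> l \<in> C \<Longrightarrow> neg l \<notin> C"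
  using all_clauses_literal_eq[of C r V l "neg l"] by auto

lemma finite_clause: "C \<in> all_clauses r V \<Longrightarrow> finite V \<Longrightarrow> finite C"
  by (rule finite_subset[of _ "V \<times> UNIV"]) (auto simp: all_clauses_def)

lemma card_clause: "C \<in> all_clauses r V \<Longrightarrow> card C = r"
  by (simp add: all_clauses_def)

lemma clause_vars_subset: "S \<subseteq> all_clauses r V \<Longrightarrow> clause_vars S \<subseteq> V"
  by (force simp: clause_vars_def all_clauses_def)

lemma clause_vars_insert [simp]: "clause_vars (insert C S) = fst ` C \<union> clause_vars S"
  by (auto simp: clause_vars_def)

lemma clause_vars_empty [simp]: "clause_vars {} = {}"
  by (auto simp: clause_vars_def)

lemma finite_clause_vars: "finite S \<Longrightarrow> (\<And>C. C \<in> S \<Longrightarrow> finite C) \<Longrightarrow> finite (clause_vars S)"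
  by (auto simp: clause_vars_def)

lemma card_clause_vars_le:
  assumes "finite S" "\<And>C. C \<in> S \<Longrightarrow> finite C \<and> card C = r"
  shows "card (clause_vars S) \<le> r * card S"
proof -
  have "card (clause_vars S) \<le> card (\<Union>S)"
    unfolding clause_vars_def using assms by (intro card_image_le) auto
  also have "\<dots> \<le> (\<Sum>C\<in>S. card C)"
    using card_UN_le[OF assms(1), of id] by simp
  also have "\<dots> = r * card S" using assms by simp
  finally show ?thesis .
qed

section \<open>Counting clauses\<close>

text \<open>A clause containing \<open>L\<close> is determined by its remaining
  \<open>r - card L\<close> literals.\<close>

lemma card_clauses_between:
  assumes "finite Y" "finite L"
  shows "card {C \<in> all_clauses r V. L \<subseteq> C \<and> C - L \<subseteq> Y} \<le> card Y choose (r - card L)"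
proof -
  let ?A = "{C \<in> all_clauses r V. L \<subseteq> C \<and> C - L \<subseteq> Y}"
  have "card ?A = card ((\<lambda>C. C - L) ` ?A)"
    by (rule card_image[symmetric]) (auto simp: inj_on_def)
  also have "\<dots> \<le> card {B. B \<subseteq> Y \<and> card B = r - card L}"
  proof (rule card_mono)
    show "(\<lambda>C. C - L) ` ?A \<subseteq> {B. B \<subseteq> Y \<and> card B = r - card L}"
      using assms(2) by (auto simp: all_clauses_def card_Diff_subset)
  qed (use assms in auto)
  also have "\<dots> = card Y choose (r - card L)"
    using assms by (simp add: n_subsets)
  finally show ?thesis .
qed

lemma card_clauses_superset:
  assumes "finite V" "finite L"
  shows "card {C \<in> all_clauses r V. L \<subseteq> C} \<le> (2 * card V) ^ (r - card L)"
proof -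
  have Y: "card (V \<times> (UNIV :: bool set)) = 2 * card V"
    by (simp add: card_cartesian_product)
  have "{C \<in> all_clauses r V. L \<subseteq> C} = {C \<in> all_clauses r V. L \<subseteq> C \<and> C - L \<subseteq> V \<times> UNIV}"
    by (auto simp: all_clauses_def)
  also have "card \<dots> \<le> (2 * card V) choose (r - card L)"
    using card_clauses_between[of "V \<times> UNIV" L r V] assms unfolding Y by simp
  also have "\<dots> \<le> (2 * card V) ^ (r - card L)"
  proof -
    let ?k = "r - card L"
    have "(2 * card V choose ?k) * 1 \<le> (2 * card V choose ?k) * fact ?k"
      by (rule mult_left_mono) (auto simp: fact_ge_1)
    then show ?thesis using binomial_fact_pow[of "2 * card V" ?k] by linarith
  qed
  finally show ?thesis .
qed

lemma card_all_clauses: "finite V \<Longrightarrow> card (all_clauses r V) \<le> (2 * card V) ^ r"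
  using card_clauses_superset[of V "{}" r] by simp

lemma card_clauses_var:
  assumes "finite V"
  shows "card {C \<in> all_clauses r V. u \<in> fst ` C} \<le> 2 * (2 * card V) ^ (r - 1)"
proof -
  let ?A = "\<lambda>b. {C \<in> all_clauses r V. {(u, b)} \<subseteq> C}"
  have "{C \<in> all_clauses r V. u \<in> fst ` C} \<subseteq> ?A True \<union> ?A False"
  proof
    fix C assume C: "C \<in> {C \<in> all_clauses r V. u \<in> fst ` C}"
    then obtain b where "(u, b) \<in> C" by auto
    with C show "C \<in> ?A True \<union> ?A False" by (cases b) auto
  qed
  then have "card {C \<in> all_clauses r V. u \<in> fst ` C} \<le> card (?A True \<union> ?A False)"
    using assms by (intro card_mono) (auto simp: finite_all_clauses)
  also have "\<dots> \<le> card (?A True) + card (?A False)" by (rule card_Un_le)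
  also have "\<dots> \<le> 2 * (2 * card V) ^ (r - 1)"
    using card_clauses_superset[OF assms, of "{(u, True)}" r]
      card_clauses_superset[OF assms, of "{(u, False)}" r] by simp
  finally show ?thesis .
qed

lemma card_clauses_two_vars:
  assumes "finite V" "u \<noteq> w"
  shows "card {C \<in> all_clauses r V. u \<in> fst ` C \<and> w \<in> fst ` C} \<le> 4 * (2 * card V) ^ (r - 2)"
proof -
  let ?A = "\<lambda>(b, c). {C \<in> all_clauses r V. {(u, b), (w, c)} \<subseteq> C}"
  have "{C \<in> all_clauses r V. u \<in> fst ` C \<and> w \<in> fst ` C} \<subseteq> (\<Union>x\<in>UNIV. ?A x)"
  proof
    fix C assume C: "C \<in> {C \<in> all_clauses r V. u \<in> fst ` C \<and> w \<in> fst ` C}"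
    then obtain b c where "(u, b) \<in> C" "(w, c) \<in> C" by auto
    with C have "C \<in> ?A (b, c)" by simp
    then show "C \<in> (\<Union>x\<in>UNIV. ?A x)" by blast
  qed
  then have "card {C \<in> all_clauses r V. u \<in> fst ` C \<and> w \<in> fst ` C} \<le> card (\<Union>x\<in>UNIV. ?A x)"
    using assms by (intro card_mono) (auto simp: finite_all_clauses split: prod.splits)
  also have "\<dots> \<le> (\<Sum>x\<in>UNIV. card (?A x))" by (rule card_UN_le) simp
  also have "\<dots> \<le> (\<Sum>x\<in>(UNIV :: (bool \<times> bool) set). (2 * card V) ^ (r - 2))"
  proof (rule sum_mono)
    fix x :: "bool \<times> bool"
    show "card (?A x) \<le> (2 * card V) ^ (r - 2)"
      using assms card_clauses_superset[OF assms(1), of "{(u, fst x), (w, snd x)}" r]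
      by (cases x) (simp add: numeral_2_eq_2)
  qed
  also have "\<dots> = 4 * (2 * card V) ^ (r - 2)"
    by (simp add: card_UNIV_bool card_prod)
  finally show ?thesis .
qed

section \<open>Layers and balanced sets\<close>

text \<open>One parallel round of a survival test: \<open>X\<close> holds the literals that may
  still occur in a balanced subset. Only the other literals of the clause are tested, not
  \<open>l\<close>, so that the test leads away from \<open>l\<close> and iterates like a branching
  process.\<close>

definition supported :: "'v clause set \<Rightarrow> 'v literal set \<Rightarrow> 'v literal set" where
  "supported S X = {l. \<exists>C\<in>S. l \<in> C \<and> neg ` (C - {l}) \<subseteq> X}"

primrec layer :: "'v set \<Rightarrow> 'v clause set \<Rightarrow> nat \<Rightarrow> 'v literal set" where
  "layer V S 0 = V \<times> UNIV"
| "layer V S (Suc t) = supported S (layer V S t)"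

lemma supported_mono: "S \<subseteq> T \<Longrightarrow> X \<subseteq> Y \<Longrightarrow> supported S X \<subseteq> supported T Y"
  unfolding supported_def by blast

lemma layer_mono: "S \<subseteq> T \<Longrightarrow> layer V S t \<subseteq> layer V T t"
proof (induction t)
  case (Suc t)
  then show ?case using supported_mono[of S T "layer V S t" "layer V T t"] by simp
qed simp

lemma layer_subset: "S \<subseteq> all_clauses r V \<Longrightarrow> layer V S t \<subseteq> V \<times> UNIV"
  by (cases t) (auto simp: supported_def all_clauses_def)

lemma finite_layer: "S \<subseteq> all_clauses r V \<Longrightarrow> finite V \<Longrightarrow> finite (layer V S t)"
  by (rule finite_subset[OF layer_subset]) auto

lemma card_layer_mono:
  "S \<subseteq> T \<Longrightarrow> T \<subseteq> all_clauses r V \<Longrightarrow> finite V \<Longrightarrow> card (layer V S t) \<le> card (layer V T t)"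
  by (intro card_mono finite_layer layer_mono)

text \<open>A nonempty balanced set of clauses is the clause set of a full formula whose variables
  are those that occur. The empty set counts as balanced, and unions stay balanced, so every clause
  set has a largest balanced subset.\<close>

definition balanced :: "'v clause set \<Rightarrow> bool" where
  "balanced S \<longleftrightarrow> neg ` \<Union>S \<subseteq> \<Union>S"

lemma balanced_Union: "(\<And>S. S \<in> A \<Longrightarrow> balanced S) \<Longrightarrow> balanced (\<Union>A)"
  unfolding balanced_def by blast

text \<open>\<open>G\<close> supports itself: the complement of each literal of a clause in
  \<open>G\<close> again occurs in \<open>G\<close>, so no literal of \<open>G\<close> is lost in
  any round.\<close>

lemma balanced_subset_layer:
  assumes "balanced G" "G \<subseteq> S" "S \<subseteq> all_clauses r V"
  shows "\<Union>G \<subseteq> layer V S t"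
proof (induction t)
  case 0
  then show ?case using assms by (auto simp: all_clauses_def)
next
  case (Suc t)
  show ?case
  proof
    fix l assume "l \<in> \<Union>G"
    then obtain C where "C \<in> G" "l \<in> C" by auto
    moreover have "neg ` (C - {l}) \<subseteq> layer V S t"
      using assms(1) \<open>C \<in> G\<close> Suc unfolding balanced_def by blast
    ultimately show "l \<in> layer V S (Suc t)"
      using assms(2) by (auto simp: supported_def)
  qed
qed

text \<open>Closure under negation makes the set of literals the whole product
  \<open>clause_vars G \<times> UNIV\<close>.\<close>

lemma card_Union_balanced:
  assumes "balanced G" "finite (\<Union>G)"
  shows "card (\<Union>G) = 2 * card (clause_vars G)"
proof -
  have "\<Union>G = clause_vars G \<times> UNIV"
  proof
    show "clause_vars G \<times> UNIV \<subseteq> \<Union>G"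
    proof
      fix l assume "l \<in> clause_vars G \<times> (UNIV :: bool set)"
      then have "fst l \<in> fst ` \<Union>G" by (simp add: clause_vars_def mem_Times_iff)
      then obtain m where "m \<in> \<Union>G" "fst l = fst m" by (rule imageE) blast
      then show "l \<in> \<Union>G"
        using assms(1) unfolding fst_eq_iff_literal balanced_def by blast
    qed
  qed (force simp: clause_vars_def)
  then have "card (\<Union>G) = card (clause_vars G \<times> (UNIV :: bool set))" by metis
  then show ?thesis by (simp add: card_cartesian_product)
qed

section \<open>The effect of a single clause on a layer\<close>

text \<open>The ball of radius \<open>t\<close> around the literals \<open>D\<close>, where one step
  goes from a literal to all literals of a clause that contains its complement. It bounds how far
  the removal of a clause with literals \<open>D\<close> can be felt after \<open>t\<close>
  rounds.\<close>

primrec influence :: "'v clause set \<Rightarrow> 'v literal set \<Rightarrow> nat \<Rightarrow> 'v literal set" where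
  "influence S D 0 = D"
| "influence S D (Suc t) = influence S D t
     \<union> {l. \<exists>C\<in>S. l \<in> C \<and> (\<exists>m\<in>C. neg m \<in> influence S D t)}"

lemma subset_influence: "D \<subseteq> influence S D t"
  by (induction t) auto

text \<open>A literal that loses its support either was supported by \<open>C\<close>, and so lies
  in \<open>C\<close>, or its supporting clause lost the complement of another literal one round
  earlier. Losses travel one clause per round.\<close>

lemma layer_remove_clause:
  "layer V S t - layer V (S - {C}) t \<subseteq> influence S C t"
proof (induction t)
  case (Suc t)
  show ?case
  proof
    fix l assume l: "l \<in> layer V S (Suc t) - layer V (S - {C}) (Suc t)"
    then obtain D where D: "D \<in> S" "l \<in> D" "neg ` (D - {l}) \<subseteq> layer V S t"
      by (auto simp: supported_def)
    show "l \<in> influence S C (Suc t)"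
    proof (cases "D = C")
      case True
      then show ?thesis using D(2) subset_influence by blast
    next
      case False
      then obtain m where "m \<in> D" "neg m \<in> layer V S t - layer V (S - {C}) t"
      proof -
        have "D \<in> S - {C}" using D(1) False by simp
        then have "\<not> neg ` (D - {l}) \<subseteq> layer V (S - {C}) t"
          using l D(2) unfolding layer.simps supported_def by blast
        then obtain m where "m \<in> D - {l}" "neg m \<notin> layer V (S - {C}) t" by (auto simp: image_subset_iff)
        then show thesis using that D(3) by blast
      qed
      then have "m \<in> D" "neg m \<in> influence S C t" using Suc by blast+
      then show ?thesis using D(1,2) by auto
    qed
  qed
qed simp

text \<open>The variable of a literal in the ball lies in at most \<Delta> clauses with
  \<open>r\<close> literals each, so a round multiplies the size by at most
  \<open>1 + r * \<Delta>\<close>.\<close>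

lemma card_influence_le:
  assumes "finite S" "finite D" "\<And>C. C \<in> S \<Longrightarrow> finite C \<and> card C = r" "\<And>v. clause_degree S v \<le> \<Delta>"
  shows "finite (influence S D t) \<and> card (influence S D t) \<le> card D * (1 + r * \<Delta>) ^ t"
proof (induction t)
  case 0
  then show ?case using assms by simp
next
  case (Suc t)
  let ?I = "influence S D t"
  let ?N = "\<lambda>m. \<Union>{C \<in> S. fst m \<in> fst ` C}"
  have sub: "influence S D (Suc t) \<subseteq> ?I \<union> (\<Union>m\<in>?I. ?N m)"
  proof
    fix l assume "l \<in> influence S D (Suc t)"
    then consider "l \<in> ?I" | C m where "C \<in> S" "l \<in> C" "m \<in> C" "neg m \<in> ?I" by auto
    then show "l \<in> ?I \<union> (\<Union>m\<in>?I. ?N m)"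
    proof cases
      case 2
      then have "l \<in> ?N (neg m)" by auto
      then show ?thesis using 2(4) by blast
    qed simp
  qed
  have N: "finite (?N m)" "card (?N m) \<le> r * \<Delta>" for m
  proof -
    show "finite (?N m)" using assms by auto
    have "card (?N m) \<le> (\<Sum>C\<in>{C \<in> S. fst m \<in> fst ` C}. card C)"
      using card_UN_le[of "{C \<in> S. fst m \<in> fst ` C}" id] assms(1) by simp
    also have "\<dots> = r * clause_degree S (fst m)" using assms(3) by (simp add: clause_degree_def)
    also have "\<dots> \<le> r * \<Delta>" using assms(4) by simp
    finally show "card (?N m) \<le> r * \<Delta>" .
  qed
  have fin: "finite (?I \<union> (\<Union>m\<in>?I. ?N m))" using Suc N by blast
  have "card (influence S D (Suc t)) \<le> card (?I \<union> (\<Union>m\<in>?I. ?N m))"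
    by (rule card_mono[OF fin sub])
  also have "\<dots> \<le> card ?I + card (\<Union>m\<in>?I. ?N m)" by (rule card_Un_le)
  also have "card (\<Union>m\<in>?I. ?N m) \<le> (\<Sum>m\<in>?I. card (?N m))" using Suc by (intro card_UN_le) auto
  also have "\<dots> \<le> (\<Sum>m\<in>?I. r * \<Delta>)" by (intro sum_mono N)
  finally have "card (influence S D (Suc t)) \<le> card ?I * (1 + r * \<Delta>)" by simp
  also have "\<dots> \<le> card D * (1 + r * \<Delta>) ^ t * (1 + r * \<Delta>)" using Suc by (intro mult_right_mono) auto
  finally have "card (influence S D (Suc t)) \<le> card D * (1 + r * \<Delta>) ^ Suc t" by (simp only: power_Suc mult_ac)
  then show ?case using finite_subset[OF sub fin] by simp
qed

text \<open>Maximising over the subsets of bounded degree gives a monotone quantity which changes little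
  when a clause is added, and which is the size of the layer if all degrees are small.\<close>

definition capped_layer :: "'v set \<Rightarrow> nat \<Rightarrow> nat \<Rightarrow> 'v clause set \<Rightarrow> nat" where
  "capped_layer V \<Delta> t S = Max ((\<lambda>G. card (layer V G t)) ` {G \<in> Pow S. \<forall>v. clause_degree G v \<le> \<Delta>})"

lemma clause_degree_empty [simp]: "clause_degree {} v = 0"
  by (simp add: clause_degree_def)

lemma clause_degree_mono: "S \<subseteq> T \<Longrightarrow> finite T \<Longrightarrow> clause_degree S v \<le> clause_degree T v"
  unfolding clause_degree_def by (intro card_mono) auto

context
  fixes V :: "'v set" and r :: nat
  assumes V: "finite V"
begin

lemma finite_clauses: "S \<subseteq> all_clauses r V \<Longrightarrow> finite S"
  using V finite_all_clauses finite_subset by blast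

lemma capped_layer_ge:
  assumes "S \<subseteq> all_clauses r V" "G \<subseteq> S" "\<And>v. clause_degree G v \<le> \<Delta>"
  shows "card (layer V G t) \<le> capped_layer V \<Delta> t S"
  unfolding capped_layer_def using assms finite_clauses[of S] by (intro Max_ge) auto

lemma capped_layer_obtain:
  assumes "S \<subseteq> all_clauses r V"
  obtains G where "G \<subseteq> S" "\<And>v. clause_degree G v \<le> \<Delta>" "capped_layer V \<Delta> t S = card (layer V G t)"
proof -
  let ?A = "(\<lambda>G. card (layer V G t)) ` {G \<in> Pow S. \<forall>v. clause_degree G v \<le> \<Delta>}"
  have "{} \<in> {G \<in> Pow S. \<forall>v. clause_degree G v \<le> \<Delta>}" by simp
  then have "Max ?A \<in> ?A" using finite_clauses[OF assms] by (intro Max_in) (simp, blast)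
  then show ?thesis using that unfolding capped_layer_def by auto
qed

lemma capped_layer_le:
  assumes "S \<subseteq> all_clauses r V"
  shows "capped_layer V \<Delta> t S \<le> card (layer V S t)"
proof -
  obtain G where "G \<subseteq> S" "capped_layer V \<Delta> t S = card (layer V G t)"
    using capped_layer_obtain[OF assms] by metis
  then show ?thesis using card_layer_mono[OF _ assms V] by simp
qed

lemma capped_layer_eq:
  assumes "S \<subseteq> all_clauses r V" "\<And>v. clause_degree S v \<le> \<Delta>"
  shows "capped_layer V \<Delta> t S = card (layer V S t)"
  using capped_layer_le[OF assms(1)] capped_layer_ge[OF assms(1) order_refl assms(2)]
  by (rule antisym)

text \<open>For the upper bound, take a subset of \<open>insert C S\<close> that attains the maximum
  and delete \<open>C\<close>: the rest is admissible for \<open>S\<close>, and because its degrees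
  are capped it loses no more than the influence of \<open>C\<close>.\<close>

lemma capped_layer_insert:
  assumes "insert C S \<subseteq> all_clauses r V"
  shows "capped_layer V \<Delta> t S \<le> capped_layer V \<Delta> t (insert C S)"
    and "capped_layer V \<Delta> t (insert C S) \<le> capped_layer V \<Delta> t S + r * (1 + r * \<Delta>) ^ t"
proof -
  have S: "S \<subseteq> all_clauses r V" and C: "C \<in> all_clauses r V" using assms by auto
  obtain G where G: "G \<subseteq> S" "\<And>v. clause_degree G v \<le> \<Delta>" "capped_layer V \<Delta> t S = card (layer V G t)"
    using capped_layer_obtain[OF S] by metis
  show "capped_layer V \<Delta> t S \<le> capped_layer V \<Delta> t (insert C S)"
    unfolding G(3) using G by (intro capped_layer_ge assms) auto
  obtain H where H: "H \<subseteq> insert C S" "\<And>v. clause_degree H v \<le> \<Delta>"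
      "capped_layer V \<Delta> t (insert C S) = card (layer V H t)"
    using capped_layer_obtain[OF assms] by metis
  have HI: "H \<subseteq> all_clauses r V" and fH: "finite H" using H(1) assms finite_clauses by blast+
  have "clause_degree (H - {C}) v \<le> \<Delta>" for v
    using clause_degree_mono[of "H - {C}" H v] H(2)[of v] fH by auto
  then have 1: "card (layer V (H - {C}) t) \<le> capped_layer V \<Delta> t S"
    using H(1) by (intro capped_layer_ge S) auto
  have inf: "finite (influence H C t)" "card (influence H C t) \<le> r * (1 + r * \<Delta>) ^ t"
  proof -
    have "D \<in> H \<Longrightarrow> finite D \<and> card D = r" for D
      using HI V by (meson card_clause finite_clause subsetD)
    then show "finite (influence H C t)" "card (influence H C t) \<le> r * (1 + r * \<Delta>) ^ t"
      using card_influence_le[of H C r \<Delta> t] fH H(2) finite_clause[OF C V] card_clause[OF C] by auto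
  qed
  have "card (layer V H t) \<le> card (layer V (H - {C}) t \<union> influence H C t)"
    using inf(1) finite_layer[of "H - {C}" r V t] HI V layer_remove_clause[of V H t C]
    by (intro card_mono) auto
  also have "\<dots> \<le> card (layer V (H - {C}) t) + card (influence H C t)" by (rule card_Un_le)
  finally show "capped_layer V \<Delta> t (insert C S) \<le> capped_layer V \<Delta> t S + r * (1 + r * \<Delta>) ^ t"
    using 1 inf H(3) by linarith
qed

end

section \<open>Explorations and short cycles\<close>

definition explored :: "'v \<Rightarrow> 'v clause list \<Rightarrow> 'v set" where
  "explored v Cs = insert v (clause_vars (set Cs))"

text \<open>The most recently explored clause comes first.\<close>

primrec exploration :: "'v \<Rightarrow> 'v clause list \<Rightarrow> bool" where
  "exploration v [] \<longleftrightarrow> True"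
| "exploration v (C # Cs) \<longleftrightarrow> exploration v Cs \<and> C \<notin> set Cs \<and> fst ` C \<inter> explored v Cs \<noteq> {}"

text \<open>A connected list of fewer than \<open>t\<close> clauses grown from \<open>v\<close>,
  closed up by a clause that meets the explored variables twice. The list form suits a first-moment
  count: an explored clause has order \<open>n ^ (r - 1)\<close> choices, the closing clause only
  order \<open>n ^ (r - 2)\<close>.\<close>

definition cycle_near :: "'v clause set \<Rightarrow> 'v \<Rightarrow> nat \<Rightarrow> bool" where
  "cycle_near S v t \<longleftrightarrow> (\<exists>C Cs. exploration v Cs \<and> length Cs < t \<and> insert C (set Cs) \<subseteq> S \<and> C \<notin> set Cs \<and>
     (\<exists>u\<in>fst ` C \<inter> explored v Cs. \<exists>w\<in>fst ` C \<inter> explored v Cs. u \<noteq> w))"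

text \<open>Without a cycle nearby, the clauses that successively support the negation \<open>m\<close> of a literal of \<open>C\<close> lead away from
  \<open>v\<close>, so \<open>m\<close> stays in its layer when the clauses containing \<open>v\<close> are removed.\<close>

lemma layer_remove_var_aux:
  assumes S: "S \<subseteq> all_clauses r V" and no: "\<not> cycle_near S v t"
    and "exploration v (C # Cs)" "set (C # Cs) \<subseteq> S" "neg m \<in> C" "fst m \<notin> explored v Cs"
    and "length (C # Cs) + s \<le> t" "m \<in> layer V S s"
  shows "m \<in> layer V {C \<in> S. v \<notin> fst ` C} s"
  using assms(3-8)
proof (induction s arbitrary: C Cs m)
  case (Suc s)
  then obtain D where D: "D \<in> S" "m \<in> D" "neg ` (D - {m}) \<subseteq> layer V S s"
    by (auto simp: supported_def)
  \<comment> \<open>\<open>C\<close> contains \<open>neg m\<close>, so it cannot be the clause that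
    supports \<open>m\<close>: the support never steps back.\<close>
  have "D \<noteq> C" using Suc.prems(2,3) S D(1,2) neg_notin_clause[of D r V m] by auto
  moreover have "D \<notin> set Cs" using Suc.prems(4) D(2) by (auto simp: explored_def clause_vars_def)
  ultimately have new: "D \<notin> set (C # Cs)" by simp
  have m: "fst m \<in> fst ` D \<inter> explored v (C # Cs)"
    using imageI[OF D(2), of fst] imageI[OF Suc.prems(3), of fst] by (simp add: explored_def)
  \<comment> \<open>A second explored variable in \<open>D\<close> would close a cycle. The list
    \<open>C # Cs\<close> is shorter than \<open>t\<close> because at least one round
    remains.\<close>
  have only: "u = fst m" if "u \<in> fst ` D" "u \<in> explored v (C # Cs)" for u
  proof (rule ccontr)
    assume "u \<noteq> fst m"
    then have "cycle_near S v t"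
      unfolding cycle_near_def using Suc.prems(1,2,5) D(1) new m that
      by (intro exI[of _ D] exI[of _ "C # Cs"]) auto
    with no show False ..
  qed
  have "v \<noteq> fst m" using Suc.prems(4) by (auto simp: explored_def)
  then have v: "v \<notin> fst ` D" using only by (auto simp: explored_def)
  have "neg m' \<in> layer V {C \<in> S. v \<notin> fst ` C} s" if "m' \<in> D - {m}" for m'
  proof (rule Suc.IH[of D "C # Cs"])
    show "exploration v (D # C # Cs)" using Suc.prems(1) new m by auto
    show "set (D # C # Cs) \<subseteq> S" using Suc.prems(2) D(1) by auto
    show "neg (neg m') \<in> D" using that by simp
    have "fst m' \<noteq> fst m" using that D S all_clauses_literal_eq[of D r V m' m] by auto
    then show "fst (neg m') \<notin> explored v (C # Cs)" using only that by auto
    show "length (D # C # Cs) + s \<le> t" using Suc.prems(5) by simp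
    show "neg m' \<in> layer V S s" using D(3) that by auto
  qed
  then have "neg ` (D - {m}) \<subseteq> layer V {C \<in> S. v \<notin> fst ` C} s" by (rule image_subsetI)
  then show ?case using D(1,2) v unfolding layer.simps supported_def by blast
qed simp

text \<open>The point is independence: the outer operator sees only clauses containing the variable
  of \<open>l\<close>, the layer only the others. The clause supporting \<open>l\<close> starts the
  exploration and \<open>t\<close> further rounds follow it, hence the radius
  \<open>Suc t\<close>.\<close>

lemma layer_remove_var:
  assumes "S \<subseteq> all_clauses r V" "\<not> cycle_near S (fst l) (Suc t)" "l \<in> layer V S (Suc t)"
  shows "l \<in> supported {C \<in> S. fst l \<in> fst ` C} (layer V {C \<in> S. fst l \<notin> fst ` C} t)"
proof -
  obtain C where C: "C \<in> S" "l \<in> C" "neg ` (C - {l}) \<subseteq> layer V S t"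
    using assms(3) by (auto simp: supported_def)
  have "neg m \<in> layer V {C \<in> S. fst l \<notin> fst ` C} t" if "m \<in> C - {l}" for m
  proof (rule layer_remove_var_aux[OF assms(1,2), of C "[]"])
    show "fst (neg m) \<notin> explored (fst l) []"
      using that C assms(1) all_clauses_literal_eq[of C r V m l] by (auto simp: explored_def)
    show "exploration (fst l) [C]" using C(2) by (auto simp: explored_def)
  qed (use that C in auto)
  then have "neg ` (C - {l}) \<subseteq> layer V {C \<in> S. fst l \<notin> fst ` C} t" by (rule image_subsetI)
  then show ?thesis using C(1) C(2) imageI[OF C(2), of fst] unfolding supported_def by blast
qed

lemma exploration_distinct: "exploration v Cs \<Longrightarrow> distinct Cs"
  by (induction Cs) auto

lemma explored_bound:
  assumes "set Cs \<subseteq> all_clauses r V" "finite V" "length Cs \<le> t"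
  shows "finite (explored v Cs) \<and> card (explored v Cs) \<le> 1 + r * t"
proof -
  have fin: "finite (clause_vars (set Cs))"
    using assms by (intro finite_clause_vars) (auto intro: finite_clause)
  have "card (clause_vars (set Cs)) \<le> r * card (set Cs)"
    using assms by (intro card_clause_vars_le) (auto intro: finite_clause card_clause)
  also have "\<dots> \<le> r * t" using card_length[of Cs] assms(3) by (intro mult_left_mono) auto
  finally show ?thesis using fin unfolding explored_def by (simp add: card_insert_if)
qed

definition explorations :: "nat \<Rightarrow> 'v set \<Rightarrow> 'v \<Rightarrow> nat \<Rightarrow> 'v clause list set" where
  "explorations r V v k = {Cs. exploration v Cs \<and> length Cs = k \<and> set Cs \<subseteq> all_clauses r V}"

text \<open>Each new clause contains one of at most \<open>1 + r * t\<close> explored variables, and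
  a given variable lies in at most \<open>2 * (2 * card V) ^ (r - 1)\<close> clauses.\<close>

lemma card_explorations:
  assumes V: "finite V" and "k \<le> t"
  shows "finite (explorations r V v k) \<and>
    card (explorations r V v k) \<le> ((1 + r * t) * (2 * (2 * card V) ^ (r - 1))) ^ k"
  using assms(2)
proof (induction k)
  case 0
  have "explorations r V v 0 = {[]}" by (auto simp: explorations_def)
  then show ?case by simp
next
  case (Suc k)
  let ?N = "\<lambda>Cs. \<Union>u\<in>explored v Cs. {C \<in> all_clauses r V. u \<in> fst ` C}"
  let ?b = "(1 + r * t) * (2 * (2 * card V) ^ (r - 1))"
  have fin: "finite (explorations r V v k)" using Suc by auto
  have sub: "explorations r V v (Suc k) \<subseteq> (\<Union>Cs\<in>explorations r V v k. (\<lambda>C. C # Cs) ` ?N Cs)"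
  proof
    fix Ds assume "Ds \<in> explorations r V v (Suc k)"
    then obtain C Cs where "Ds = C # Cs" "Cs \<in> explorations r V v k" "C \<in> ?N Cs"
      by (cases Ds) (auto simp: explorations_def)
    then show "Ds \<in> (\<Union>Cs\<in>explorations r V v k. (\<lambda>C. C # Cs) ` ?N Cs)" by blast
  qed
  have N: "finite (?N Cs)" "card (?N Cs) \<le> ?b" if "Cs \<in> explorations r V v k" for Cs
  proof -
    have ex: "finite (explored v Cs)" "card (explored v Cs) \<le> 1 + r * t"
      using explored_bound[of Cs r V t v] that V Suc.prems by (auto simp: explorations_def)
    show "finite (?N Cs)" using ex V by (auto intro: finite_subset[OF _ finite_all_clauses])
    have "card (?N Cs) \<le> (\<Sum>u\<in>explored v Cs. card {C \<in> all_clauses r V. u \<in> fst ` C})"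
      by (rule card_UN_le[OF ex(1)])
    also have "\<dots> \<le> card (explored v Cs) * (2 * (2 * card V) ^ (r - 1))"
      using sum_bounded_above[of "explored v Cs", OF card_clauses_var[OF V]] by simp
    also have "\<dots> \<le> ?b" using ex(2) by (rule mult_right_mono) simp
    finally show "card (?N Cs) \<le> ?b" .
  qed
  have fin2: "finite (\<Union>Cs\<in>explorations r V v k. (\<lambda>C. C # Cs) ` ?N Cs)" using fin N(1) by blast
  have "card (explorations r V v (Suc k)) \<le> card (\<Union>Cs\<in>explorations r V v k. (\<lambda>C. C # Cs) ` ?N Cs)"
    by (rule card_mono[OF fin2 sub])
  also have "\<dots> \<le> (\<Sum>Cs\<in>explorations r V v k. card ((\<lambda>C. C # Cs) ` ?N Cs))" by (rule card_UN_le[OF fin])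
  also have "\<dots> \<le> card (explorations r V v k) * ?b"
  proof -
    have "card ((\<lambda>C. C # Cs) ` ?N Cs) \<le> ?b" if "Cs \<in> explorations r V v k" for Cs
      using card_image_le[OF N(1)[OF that]] N(2)[OF that] by (rule order_trans)
    from sum_bounded_above[of "explorations r V v k", OF this] show ?thesis by simp
  qed
  also have "\<dots> \<le> ?b ^ k * ?b" using Suc by (intro mult_right_mono) auto
  finally show ?case using finite_subset[OF sub fin2] by (simp add: mult_ac)
qed

text \<open>First moment over pairs of an exploration with \<open>k\<close> clauses and a closing
  clause. When \<open>p\<close> has order \<open>1 / n ^ (r - 1)\<close>, the explored clauses
  contribute a constant and the closing clause contributes order \<open>1 / n\<close>.\<close>

lemma expect_cycle_near:
  assumes V: "finite V" and p: "0 \<le> p" "p \<le> 1"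
  shows "expect (all_clauses r V) p (\<lambda>S. of_bool (cycle_near S v t))
    \<le> (\<Sum>k<t. real (((1 + r * t) * (2 * (2 * card V) ^ (r - 1))) ^ k
           * ((1 + r * t)\<^sup>2 * (4 * (2 * card V) ^ (r - 2)))) * p ^ Suc k)"
proof -
  let ?b = "(1 + r * t) * (2 * (2 * card V) ^ (r - 1))"
  let ?c = "(1 + r * t)\<^sup>2 * (4 * (2 * card V) ^ (r - 2))"
  define N where "N Cs = (\<Union>(u, w)\<in>{(u, w) \<in> explored v Cs \<times> explored v Cs. u \<noteq> w}.
      {C \<in> all_clauses r V - set Cs. u \<in> fst ` C \<and> w \<in> fst ` C})" for Cs
  define X where "X k = (SIGMA Cs:explorations r V v k. N Cs)" for k
  have Nc: "finite (N Cs)" "card (N Cs) \<le> ?c" if "Cs \<in> explorations r V v k" "k < t" for Cs k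
  proof -
    have ex: "finite (explored v Cs)" "card (explored v Cs) \<le> 1 + r * t"
      using explored_bound[of Cs r V t v] that V by (auto simp: explorations_def)
    let ?E = "{(u, w) \<in> explored v Cs \<times> explored v Cs. u \<noteq> w}"
    have fE: "finite ?E" using ex by (auto intro: finite_subset[of _ "explored v Cs \<times> explored v Cs"])
    have "card ?E \<le> card (explored v Cs \<times> explored v Cs)" using ex by (intro card_mono) auto
    also have "\<dots> \<le> (1 + r * t)\<^sup>2"
      using ex by (simp add: card_cartesian_product power2_eq_square mult_mono del: add_Suc mult_Suc)
    finally have cE: "card ?E \<le> (1 + r * t)\<^sup>2" .
    show "finite (N Cs)" unfolding N_def using fE V finite_all_clauses
      by (auto intro: finite_subset[of _ "all_clauses r V"])
    have "card (N Cs) \<le> (\<Sum>x\<in>?E. card (case x of (u, w) \<Rightarrow>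
        {C \<in> all_clauses r V - set Cs. u \<in> fst ` C \<and> w \<in> fst ` C}))"
      unfolding N_def by (rule card_UN_le[OF fE])
    also have "\<dots> \<le> (\<Sum>x\<in>?E. 4 * (2 * card V) ^ (r - 2))"
    proof (rule sum_mono)
      fix x assume "x \<in> ?E"
      then obtain u w where x: "x = (u, w)" "u \<noteq> w" by auto
      have "card {C \<in> all_clauses r V - set Cs. u \<in> fst ` C \<and> w \<in> fst ` C}
          \<le> card {C \<in> all_clauses r V. u \<in> fst ` C \<and> w \<in> fst ` C}"
        using V finite_all_clauses by (intro card_mono) (auto intro: finite_subset[of _ "all_clauses r V"])
      also have "\<dots> \<le> 4 * (2 * card V) ^ (r - 2)" by (rule card_clauses_two_vars[OF V x(2)])
      finally show "card (case x of (u, w) \<Rightarrow> {C \<in> all_clauses r V - set Cs. u \<in> fst ` C \<and> w \<in> fst ` C})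
          \<le> 4 * (2 * card V) ^ (r - 2)" using x by simp
    qed
    also have "\<dots> \<le> ?c" using cE by (simp del: power2_eq_square)
    finally show "card (N Cs) \<le> ?c" .
  qed
  have finX: "finite (X k)" if "k < t" for k
    unfolding X_def using card_explorations[OF V, of k t r v] Nc that by auto
  have cX: "card (X k) \<le> ?b ^ k * ?c" if "k < t" for k
  proof -
    have "card (X k) = (\<Sum>Cs\<in>explorations r V v k. card (N Cs))"
      unfolding X_def using card_explorations[OF V, of k t r v] Nc that by (subst card_SigmaI) auto
    also have "\<dots> \<le> card (explorations r V v k) * ?c"
      using sum_bounded_above[of "explorations r V v k" "\<lambda>Cs. card (N Cs)" ?c] Nc(2) that by simp
    also have "\<dots> \<le> ?b ^ k * ?c"
      using card_explorations[OF V, of k t r v] that by (intro mult_right_mono) auto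
    finally show ?thesis .
  qed
  let ?Y = "SIGMA k:{..<t}. X k"
  \<comment> \<open>The exponent of \<open>p\<close> is exact since explorations repeat no clause
    and the closing clause is new.\<close>
  have sz: "card (insert C (set Cs)) = Suc k" if "k < t" "(Cs, C) \<in> X k" for k C Cs
    using that exploration_distinct[of v Cs]
    by (auto simp: X_def explorations_def N_def distinct_card)
  have "expect (all_clauses r V) p (\<lambda>S. of_bool (cycle_near S v t))
      \<le> (\<Sum>x\<in>?Y. p ^ card ((\<lambda>(k, Cs, C). insert C (set Cs)) x))"
  proof (rule expect_exists_superset)
    fix S assume S: "S \<subseteq> all_clauses r V" "cycle_near S v t"
    then obtain C Cs u w where *: "exploration v Cs" "length Cs < t" "insert C (set Cs) \<subseteq> S" "C \<notin> set Cs"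
       "u \<in> fst ` C" "u \<in> explored v Cs" "w \<in> fst ` C" "w \<in> explored v Cs" "u \<noteq> w"
      unfolding cycle_near_def by blast
    have "C \<in> N Cs" unfolding N_def using * S(1) by blast
    moreover have "Cs \<in> explorations r V v (length Cs)"
      using * S(1) by (auto simp: explorations_def)
    ultimately have "(length Cs, Cs, C) \<in> ?Y" using * by (auto simp: X_def)
    then show "\<exists>x\<in>?Y. (\<lambda>(k, Cs, C). insert C (set Cs)) x \<subseteq> S" using *(3) by force
  qed (use p V finX finite_all_clauses in \<open>auto simp: X_def explorations_def N_def\<close>)
  also have "\<dots> = (\<Sum>x\<in>?Y. p ^ Suc (fst x))"
    using sz by (intro sum.cong) auto
  also have "\<dots> = (\<Sum>k<t. \<Sum>y\<in>X k. p ^ Suc k)"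
    using finX by (subst sum.Sigma) (auto simp: case_prod_beta)
  also have "\<dots> = (\<Sum>k<t. real (card (X k)) * p ^ Suc k)" by simp
  also have "\<dots> \<le> (\<Sum>k<t. real (?b ^ k * ?c) * p ^ Suc k)"
    using cX p by (intro sum_mono mult_right_mono) (auto simp del: of_nat_mult of_nat_power)
  finally show ?thesis .
qed

section \<open>Concentration of the layers\<close>

lemma real_binomial_le: "real (m choose k) \<le> real m ^ k / fact k"
proof -
  have "real ((m choose k) * fact k) \<le> real (m ^ k)"
    using binomial_fact_pow[of m k] by (simp only: of_nat_le_iff)
  then show ?thesis by (simp add: field_simps)
qed

text \<open>The familiar \<open>1 - p \<le> exp (- p)\<close> points the wrong way here; raising the
  rate to \<open>p / (1 - p)\<close> reverses it at an asymptotically negligible cost.\<close>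

lemma exp_le_one_minus:
  fixes p :: real
  assumes "p < 1"
  shows "exp (- (p / (1 - p))) \<le> 1 - p"
proof -
  have "1 / (1 - p) = 1 + p / (1 - p)" using assms by (simp add: field_simps)
  also have "\<dots> \<le> exp (p / (1 - p))" by (rule exp_ge_add_one_self)
  finally have "1 \<le> (1 - p) * exp (p / (1 - p))" using assms by (simp add: field_simps)
  then show ?thesis by (simp add: exp_minus field_simps)
qed

lemma one_minus_power_le:
  fixes p h :: real
  assumes "0 \<le> p" "p < 1" "real N \<le> h"
  shows "1 - (1 - p) ^ N \<le> 1 - exp (- (p / (1 - p) * h))"
proof -
  have "exp (- (p / (1 - p) * h)) \<le> exp (- (p / (1 - p) * N))"
    using assms by (simp add: divide_right_mono mult_left_mono)
  also have "\<dots> = exp (- (p / (1 - p))) ^ N"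
    by (simp add: exp_of_nat_mult[symmetric] mult_ac)
  also have "\<dots> \<le> (1 - p) ^ N" using assms exp_le_one_minus by (intro power_mono) auto
  finally show ?thesis by simp
qed

section \<open>One step of the branching recursion\<close>

text \<open>Fix the clauses avoiding the variable of \<open>l\<close>; they determine the layer. A
  clause supporting \<open>l\<close> then consists of \<open>l\<close> and \<open>r - 1\<close>
  complements of layer literals, and \<open>l\<close> is supported exactly when one of these clauses
  is present, which is independent of the layer. Restoring the removed clauses can only enlarge the
  layer, so the bound may be stated for all of \<open>S\<close>.\<close>

lemma expect_supported_star:
  fixes p :: real
  assumes V: "finite V" and p: "0 \<le> p" "p < 1"
  shows "expect (all_clauses r V) p (\<lambda>S. of_bool (l \<in> supported {C \<in> S. fst l \<in> fst ` C}
             (layer V {C \<in> S. fst l \<notin> fst ` C} t)))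
    \<le> expect (all_clauses r V) p (\<lambda>S. 1 - exp (- (p / (1 - p) * (real (card (layer V S t)) ^ (r - 1) / fact (r - 1)))))"
proof -
  define I where "I = all_clauses r V"
  define A where "A = {C \<in> I. fst l \<in> fst ` C}"
  define R where "R = {C \<in> I. fst l \<notin> fst ` C}"
  define \<phi> where "\<phi> T = 1 - exp (- (p / (1 - p) * (real (card (layer V T t)) ^ (r - 1) / fact (r - 1))))" for T
  have I: "I = R \<union> A" and fin: "finite I" "finite R" "finite A" and disj: "R \<inter> A = {}"
    using finite_all_clauses[OF V, of r] unfolding I_def A_def R_def by auto
  have "expect I p (\<lambda>S. of_bool (l \<in> supported {C \<in> S. fst l \<in> fst ` C} (layer V {C \<in> S. fst l \<notin> fst ` C} t)))
      = expect R p (\<lambda>T. expect A p (\<lambda>S. of_bool (l \<in> supported {C \<in> T \<union> S. fst l \<in> fst ` C}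
            (layer V {C \<in> T \<union> S. fst l \<notin> fst ` C} t))))"
    unfolding I by (rule expect_Un[OF fin(2,3) disj])
  also have "\<dots> \<le> expect R p \<phi>"
  proof (intro expect_mono)
    fix T assume T: "T \<subseteq> R"
    let ?X = "layer V T t"
    define J where "J = {C \<in> A. l \<in> C \<and> neg ` (C - {l}) \<subseteq> ?X}"
    have TI: "T \<subseteq> all_clauses r V" using T by (auto simp: R_def I_def)
    have finX: "finite ?X" by (rule finite_layer[OF TI V])
    have "expect A p (\<lambda>S. of_bool (l \<in> supported {C \<in> T \<union> S. fst l \<in> fst ` C}
            (layer V {C \<in> T \<union> S. fst l \<notin> fst ` C} t))) = expect A p (\<lambda>S. of_bool (S \<inter> J \<noteq> {}))"
    proof (rule expect_cong)
      fix S assume S: "S \<subseteq> A"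
      have eq: "{C \<in> T \<union> S. fst l \<in> fst ` C} = S" "{C \<in> T \<union> S. fst l \<notin> fst ` C} = T"
        using S T by (auto simp: A_def R_def)
      have "l \<in> supported {C \<in> T \<union> S. fst l \<in> fst ` C} (layer V {C \<in> T \<union> S. fst l \<notin> fst ` C} t)
          \<longleftrightarrow> S \<inter> J \<noteq> {}"
        unfolding eq supported_def J_def using S by blast
      then show "of_bool (l \<in> supported {C \<in> T \<union> S. fst l \<in> fst ` C} (layer V {C \<in> T \<union> S. fst l \<notin> fst ` C} t))
          = (of_bool (S \<inter> J \<noteq> {}) :: real)" by simp
    qed
    also have "\<dots> = 1 - (1 - p) ^ card J"
      using fin by (intro expect_hit) (auto simp: J_def)
    also have "\<dots> \<le> \<phi> T"
      unfolding \<phi>_def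
    proof (rule one_minus_power_le[OF p])
      have "J \<subseteq> {C \<in> all_clauses r V. {l} \<subseteq> C \<and> C - {l} \<subseteq> neg ` ?X}"
      proof
        fix C assume C: "C \<in> J"
        have "C - {l} \<subseteq> neg ` ?X"
        proof
          fix m assume "m \<in> C - {l}"
          then have "neg m \<in> ?X" using C by (auto simp: J_def)
          then have "neg (neg m) \<in> neg ` ?X" by (rule imageI)
          then show "m \<in> neg ` ?X" by simp
        qed
        then show "C \<in> {C \<in> all_clauses r V. {l} \<subseteq> C \<and> C - {l} \<subseteq> neg ` ?X}"
          using C by (auto simp: J_def A_def I_def)
      qed
      then have "card J \<le> card {C \<in> all_clauses r V. {l} \<subseteq> C \<and> C - {l} \<subseteq> neg ` ?X}"
        using finite_all_clauses[OF V, of r] by (intro card_mono) auto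
      also have "\<dots> \<le> card (neg ` ?X) choose (r - 1)"
        using card_clauses_between[of "neg ` ?X" "{l}" r V] finX by simp
      also have "card (neg ` ?X) = card ?X" by (rule card_image[OF inj_neg])
      finally have "real (card J) \<le> real (card ?X choose (r - 1))" by simp
      also have "\<dots> \<le> real (card ?X) ^ (r - 1) / fact (r - 1)" by (rule real_binomial_le)
      finally show "real (card J) \<le> real (card ?X) ^ (r - 1) / fact (r - 1)" .
    qed
    finally show "expect A p (\<lambda>S. of_bool (l \<in> supported {C \<in> T \<union> S. fst l \<in> fst ` C}
            (layer V {C \<in> T \<union> S. fst l \<notin> fst ` C} t))) \<le> \<phi> T" .
  qed (use p in auto)
  also have "\<dots> = expect I p (\<lambda>S. \<phi> (S \<inter> R))"
    by (rule expect_restrict[symmetric]) (use fin in \<open>auto simp: R_def\<close>)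
  also have "\<dots> \<le> expect I p \<phi>"
  proof (rule expect_mono)
    fix S assume "S \<subseteq> I"
    then have "real (card (layer V (S \<inter> R) t)) ^ (r - 1) \<le> real (card (layer V S t)) ^ (r - 1)"
      using V by (intro power_mono of_nat_mono card_layer_mono[where r=r]) (auto simp: I_def)
    then show "\<phi> (S \<inter> R) \<le> \<phi> S"
      unfolding \<phi>_def using p by (simp add: divide_right_mono mult_left_mono)
  qed (use p in auto)
  finally show ?thesis unfolding I_def \<phi>_def .
qed

text \<open>The term \<epsilon> pays for the literals with a short cycle nearby; for all others
  \<open>layer_remove_var\<close> makes the independent estimate applicable.\<close>

lemma expect_layer_Suc:
  fixes p :: real
  assumes V: "finite V" and p: "0 \<le> p" "p < 1" and c: "\<And>v. expect (all_clauses r V) p (\<lambda>S. of_bool (cycle_near S v (Suc t))) \<le> \<epsilon>"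
  shows "expect (all_clauses r V) p (\<lambda>S. real (card (layer V S (Suc t))))
    \<le> 2 * card V * (\<epsilon> + expect (all_clauses r V) p
          (\<lambda>S. 1 - exp (- (p / (1 - p) * (real (card (layer V S t)) ^ (r - 1) / fact (r - 1))))))"
    (is "_ \<le> 2 * card V * (\<epsilon> + ?E)")
proof -
  let ?I = "all_clauses r V"
  let ?L = "V \<times> (UNIV :: bool set)"
  have *: "expect ?I p (\<lambda>S. of_bool (l \<in> layer V S (Suc t))) \<le> \<epsilon> + ?E" for l
  proof -
    have "expect ?I p (\<lambda>S. of_bool (l \<in> layer V S (Suc t)))
      \<le> expect ?I p (\<lambda>S. of_bool (cycle_near S (fst l) (Suc t)) + of_bool (l \<in> supported {C \<in> S. fst l \<in> fst ` C}
             (layer V {C \<in> S. fst l \<notin> fst ` C} t)))"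
    proof (intro expect_mono)
      fix S assume "S \<subseteq> ?I"
      from layer_remove_var[OF this, of l t] show "of_bool (l \<in> layer V S (Suc t))
          \<le> (of_bool (cycle_near S (fst l) (Suc t)) + of_bool (l \<in> supported {C \<in> S. fst l \<in> fst ` C}
             (layer V {C \<in> S. fst l \<notin> fst ` C} t)) :: real)"
        by (auto simp del: layer.simps)
    qed (use p in auto)
    also have "\<dots> \<le> \<epsilon> + ?E"
      unfolding expect_add by (intro add_mono c expect_supported_star V p)
    finally show ?thesis .
  qed
  have "expect ?I p (\<lambda>S. real (card (layer V S (Suc t))))
      = expect ?I p (\<lambda>S. \<Sum>l\<in>?L. of_bool (l \<in> layer V S (Suc t)))"
  proof (rule expect_cong)
    fix S assume "S \<subseteq> ?I"
    from layer_subset[OF this, of "Suc t"] have "?L \<inter> {l. l \<in> layer V S (Suc t)} = layer V S (Suc t)" by blast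
    then show "real (card (layer V S (Suc t))) = (\<Sum>l\<in>?L. of_bool (l \<in> layer V S (Suc t)))"
      using V by (simp add: sum_of_bool_eq del: layer.simps)
  qed
  also have "\<dots> \<le> (\<Sum>l\<in>?L. \<epsilon> + ?E)"
    unfolding expect_sum by (intro sum_mono *)
  also have "\<dots> = 2 * card V * (\<epsilon> + ?E)"
    by (simp add: card_cartesian_product)
  finally show ?thesis .
qed

section \<open>Deviations of the layers\<close>

text \<open>A union bound over \<open>Suc \<Delta>\<close> clauses at one variable. The factorial
  makes this smaller than every power of \<open>1 / n\<close> once \<Delta> grows like a power of
  \<open>n\<close>.\<close>

lemma expect_high_degree:
  fixes p :: real
  assumes V: "finite V" and p: "0 \<le> p" "p \<le> 1"
  shows "expect (all_clauses r V) p (\<lambda>S. of_bool (\<exists>v. clause_degree S v > \<Delta>))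
    \<le> card V * (real (2 * (2 * card V) ^ (r - 1)) * p) ^ Suc \<Delta> / fact (Suc \<Delta>)"
proof -
  let ?I = "all_clauses r V"
  let ?b = "2 * (2 * card V) ^ (r - 1)"
  define A where "A v = {C \<in> ?I. v \<in> fst ` C}" for v
  define X where "X v = {T. T \<subseteq> A v \<and> card T = Suc \<Delta>}" for v
  have finI: "finite ?I" using V by (rule finite_all_clauses)
  then have finA: "finite (A v)" for v by (simp add: A_def)
  have finX: "finite (X v)" for v unfolding X_def using finA[of v] by simp
  have cX: "real (card (X v)) \<le> real ?b ^ Suc \<Delta> / fact (Suc \<Delta>)" for v
  proof -
    have "real (card (X v)) = real (card (A v) choose Suc \<Delta>)"
      unfolding X_def using n_subsets[OF finA, of v "Suc \<Delta>"] by simp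
    also have "\<dots> \<le> real (card (A v)) ^ Suc \<Delta> / fact (Suc \<Delta>)" by (rule real_binomial_le)
    also have "\<dots> \<le> real ?b ^ Suc \<Delta> / fact (Suc \<Delta>)"
      using card_clauses_var[OF V, of r v] unfolding A_def
      by (intro divide_right_mono power_mono of_nat_mono) auto
    finally show ?thesis .
  qed
  have "expect ?I p (\<lambda>S. of_bool (\<exists>v. clause_degree S v > \<Delta>)) \<le> (\<Sum>x\<in>Sigma V X. p ^ card (snd x))"
  proof (rule expect_exists_superset)
    fix S assume S: "S \<subseteq> ?I" "\<exists>v. clause_degree S v > \<Delta>"
    then obtain v where v: "Suc \<Delta> \<le> clause_degree S v" by (auto simp: Suc_le_eq)
    then obtain T where T: "T \<subseteq> {C \<in> S. v \<in> fst ` C}" "card T = Suc \<Delta>"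
      unfolding clause_degree_def by (rule obtain_subset_with_card_n) auto
    from T obtain C where "C \<in> T" by fastforce
    then have "v \<in> V" using T S(1) by (force simp: all_clauses_def)
    moreover have "T \<in> X v" using T S(1) by (auto simp: X_def A_def)
    ultimately show "\<exists>x\<in>Sigma V X. snd x \<subseteq> S" using T by (intro bexI[of _ "(v, T)"]) auto
  qed (use p V finX finI in \<open>auto simp: X_def A_def\<close>)
  also have "\<dots> = (\<Sum>v\<in>V. \<Sum>T\<in>X v. p ^ card T)"
    using finX V by (subst sum.Sigma) (auto simp: case_prod_beta)
  also have "\<dots> = (\<Sum>v\<in>V. real (card (X v)) * p ^ Suc \<Delta>)"
    by (intro sum.cong refl) (simp add: X_def)
  also have "\<dots> \<le> (\<Sum>v\<in>V. real ?b ^ Suc \<Delta> / fact (Suc \<Delta>) * p ^ Suc \<Delta>)"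
    using cX p by (intro sum_mono mult_right_mono) auto
  also have "\<dots> = card V * (real ?b * p) ^ Suc \<Delta> / fact (Suc \<Delta>)"
    by (simp add: power_mult_distrib)
  finally show ?thesis .
qed

text \<open>Exponential Markov inequality for the capped layer, whose mean is at most that of the
  layer and which equals the layer unless some degree exceeds \<Delta>. The parameter \<kappa> is
  \<theta> times the largest effect of a clause and is left free for optimisation.\<close>

lemma expect_layer_deviation:
  fixes p m u \<kappa> :: real
  assumes V: "finite V" and p: "0 \<le> p" "p \<le> 1" and r: "r \<ge> 1"
    and m: "expect (all_clauses r V) p (\<lambda>S. real (card (layer V S t))) \<le> m"
    and \<kappa>: "0 < \<kappa>" "\<kappa> \<le> 1"
  shows "expect (all_clauses r V) p (\<lambda>S. of_bool (real (card (layer V S t)) \<ge> m + u))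
    \<le> card V * (real (2 * (2 * card V) ^ (r - 1)) * p) ^ Suc \<Delta> / fact (Suc \<Delta>)
     + exp (- (\<kappa> * u / (r * (1 + r * \<Delta>) ^ t)) + (2 * card V) ^ r * p * \<kappa>\<^sup>2)"
proof -
  let ?I = "all_clauses r V"
  define c where "c = real (r * (1 + r * \<Delta>) ^ t)"
  define \<theta> where "\<theta> = \<kappa> / c"
  define f where "f S = real (capped_layer V \<Delta> t S)" for S
  have c: "c > 0" using r unfolding c_def by simp (intro mult_pos_pos zero_less_power add_pos_nonneg; simp)
  then have \<theta>: "\<theta> > 0" "\<theta> * c = \<kappa>" using \<kappa> by (auto simp: \<theta>_def)
  have finI: "finite ?I" using V by (rule finite_all_clauses)
  have "expect ?I p (\<lambda>S. exp (\<theta> * f S)) \<le> exp (\<theta> * expect ?I p f + card ?I * p * (\<theta> * c)\<^sup>2)"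
  proof (rule expect_exp_le)
    fix S C assume "S \<subseteq> ?I" "C \<in> ?I" "C \<notin> S"
    then have "insert C S \<subseteq> ?I" by simp
    from capped_layer_insert[OF V this, of \<Delta> t] show "f S \<le> f (insert C S) \<and> f (insert C S) \<le> f S + c"
      unfolding f_def c_def by (simp only: of_nat_le_iff of_nat_add[symmetric])
  qed (use finI p \<theta> \<kappa> c in auto)
  also have "\<dots> \<le> exp (\<theta> * m + real ((2 * card V) ^ r) * p * \<kappa>\<^sup>2)"
  proof -
    have "expect ?I p f \<le> expect ?I p (\<lambda>S. real (card (layer V S t)))"
      unfolding f_def using p V by (intro expect_mono of_nat_mono capped_layer_le) auto
    then have "\<theta> * expect ?I p f \<le> \<theta> * m" using m \<theta> by (intro mult_left_mono) auto
    moreover have "real (card ?I) * p * \<kappa>\<^sup>2 \<le> real ((2 * card V) ^ r) * p * \<kappa>\<^sup>2"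
      using card_all_clauses[OF V, of r] p by (intro mult_right_mono of_nat_mono) auto
    ultimately show ?thesis unfolding \<theta>(2) by (intro iffD2[OF exp_le_cancel_iff]) linarith
  qed
  finally have mgf: "expect ?I p (\<lambda>S. exp (\<theta> * f S)) \<le> exp (\<theta> * m + real ((2 * card V) ^ r) * p * \<kappa>\<^sup>2)" .
  have tail: "expect ?I p (\<lambda>S. of_bool (f S \<ge> m + u)) \<le> expect ?I p (\<lambda>S. exp (\<theta> * f S)) / exp (\<theta> * (m + u))"
    using p \<theta> by (intro expect_Markov) auto
  also have "\<dots> \<le> exp (\<theta> * m + real ((2 * card V) ^ r) * p * \<kappa>\<^sup>2) / exp (\<theta> * (m + u))"
    by (intro divide_right_mono mgf) auto
  also have "\<dots> = exp (- (\<kappa> * u / c) + (2 * card V) ^ r * p * \<kappa>\<^sup>2)"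
    unfolding exp_diff[symmetric] by (simp add: \<theta>_def algebra_simps add_divide_distrib)
  finally have tail: "expect ?I p (\<lambda>S. of_bool (f S \<ge> m + u)) \<le> exp (- (\<kappa> * u / c) + (2 * card V) ^ r * p * \<kappa>\<^sup>2)" .
  have "expect ?I p (\<lambda>S. of_bool (real (card (layer V S t)) \<ge> m + u))
      \<le> expect ?I p (\<lambda>S. of_bool (\<exists>v. clause_degree S v > \<Delta>) + of_bool (f S \<ge> m + u))"
  proof (rule expect_mono[OF p])
    fix S assume S: "S \<subseteq> ?I"
    show "of_bool (real (card (layer V S t)) \<ge> m + u)
        \<le> (of_bool (\<exists>v. clause_degree S v > \<Delta>) + of_bool (f S \<ge> m + u) :: real)"
    proof (cases "\<exists>v. clause_degree S v > \<Delta>")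
      case False
      then have "f S = card (layer V S t)"
        unfolding f_def using capped_layer_eq[OF V S, of \<Delta> t] by (auto simp: not_less)
      then show ?thesis by simp
    qed auto
  qed
  also have "\<dots> \<le> card V * (real (2 * (2 * card V) ^ (r - 1)) * p) ^ Suc \<Delta> / fact (Suc \<Delta>)
     + exp (- (\<kappa> * u / c) + (2 * card V) ^ r * p * \<kappa>\<^sup>2)"
    unfolding expect_add using tail expect_high_degree[OF V p, of r \<Delta>] by (intro add_mono) auto
  finally show ?thesis unfolding c_def by simp
qed

section \<open>Auxiliary asymptotic estimates\<close>

lemma real_power_pred: "n > 0 \<Longrightarrow> k \<ge> 1 \<Longrightarrow> real n ^ (k - 1) = real n ^ k / real n"
  by (cases k) auto

lemma bigo_powr_eq_power:
  "O(\<lambda>n. real n powr (- real s)) = O(\<lambda>n. 1 / real n ^ s)"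
proof (rule landau_o.big.cong)
  show "eventually (\<lambda>n. real n powr (- real s) = 1 / real n ^ s) at_top"
    using eventually_gt_at_top[of 0] by eventually_elim (simp add: powr_minus powr_realpow divide_inverse)
qed

lemma stretched_exponential_bigo:
  fixes \<eta> :: real
  assumes "\<eta> > 0"
  shows "(\<lambda>n. real n * 2 powr (- (real n powr \<eta>))) \<in> O(\<lambda>n. 1 / real n ^ s)"
proof -
  have "(\<lambda>x::real. x * 2 powr (- (x powr \<eta>))) \<in> O(\<lambda>x. x powr (- real s))"
    using assms by real_asymp
  from landau_o.big.compose[OF this filterlim_real_sequentially]
  show ?thesis unfolding bigo_powr_eq_power .
qed

lemma exp_sqrt_bigo:
  fixes k :: real
  assumes "k > 0"
  shows "(\<lambda>n. exp (- (k * sqrt (real n)))) \<in> O(\<lambda>n. 1 / real n ^ s)"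
proof -
  have "(\<lambda>x::real. exp (- (k * sqrt x))) \<in> O(\<lambda>x. x powr (- real s))"
    using assms by real_asymp
  from landau_o.big.compose[OF this filterlim_real_sequentially]
  show ?thesis unfolding bigo_powr_eq_power .
qed

lemma bigo_mono:
  fixes f g :: "nat \<Rightarrow> real"
  assumes "g \<in> O(h)" "eventually (\<lambda>n. 0 \<le> f n \<and> f n \<le> g n) sequentially"
  shows "f \<in> O(h)"
proof -
  have "f \<in> O(g)" using assms(2) by (intro landau_o.big_mono) (auto elim: eventually_mono)
  then show ?thesis using assms(1) by (rule landau_o.big_trans)
qed

lemma bigo_inverse_tendsto:
  fixes f :: "nat \<Rightarrow> real"
  assumes "f \<in> O(\<lambda>n. 1 / real n ^ 1)"
  shows "f \<longlonglongrightarrow> 0"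
proof -
  have "(\<lambda>n. 1 / real n ^ 1) \<in> o(\<lambda>_. 1)" by simp real_asymp
  with assms have "f \<in> o(\<lambda>_. 1)" by (rule landau_o.big_small_trans)
  from smalloD_tendsto[OF this] show ?thesis by simp
qed

lemma power_div_fact_le_exp:
  fixes y :: real
  assumes "y \<ge> 0"
  shows "y ^ k / fact k \<le> exp y"
proof -
  have "(\<Sum>n\<in>{k}. y ^ n /\<^sub>R fact n) \<le> (\<Sum>n. y ^ n /\<^sub>R fact n)"
    using assms by (intro sum_le_suminf summable_exp_generic) auto
  then show ?thesis by (simp add: exp_def divide_inverse mult.commute)
qed

text \<open>Doubling the base costs a factor \<open>2 ^ m\<close>, while
  \<open>(2 * K) ^ m / fact m\<close> stays bounded by a term of the exponential series.\<close>

lemma power_div_fact_le_powr: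
  fixes y z K :: real
  assumes "0 \<le> y" "y \<le> K" "z \<le> real m"
  shows "y ^ m / fact m \<le> exp (2 * K) * 2 powr (- z)"
proof -
  have "y ^ m / fact m \<le> K ^ m / fact m"
    using assms by (intro divide_right_mono power_mono) auto
  also have "\<dots> = (2 * K) ^ m / fact m * (1 / 2 ^ m)"
    by (simp add: power_mult_distrib)
  also have "\<dots> \<le> exp (2 * K) * (1 / 2 ^ m)"
    using assms by (intro mult_right_mono power_div_fact_le_exp) auto
  also have "1 / 2 ^ m = 2 powr (- real m)"
    unfolding powr_minus powr_realpow[OF zero_less_numeral] by (simp add: divide_inverse)
  also have "exp (2 * K) * 2 powr (- real m) \<le> exp (2 * K) * 2 powr (- z)"
    using assms(3) by (intro mult_left_mono powr_mono) auto
  finally show ?thesis .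
qed

section \<open>The layers below the threshold\<close>

text \<open>Only the eventual bound \<open>a\<close> on \<alpha> enters the estimates.
  \<open>below_threshold\<close> says pointwise in \<open>y\<close> that \<open>a\<close> is smaller
  than the function minimised in the definition of the threshold.\<close>

locale subcritical_regime =
  fixes r :: nat and \<alpha> :: "nat \<Rightarrow> real" and a :: real
  assumes r: "r \<ge> 3" and a: "a > 0"
    and \<alpha>: "eventually (\<lambda>n. 0 < \<alpha> n \<and> \<alpha> n \<le> a) sequentially"
    and below_threshold: "\<And>y. y > 0 \<Longrightarrow> 2 ^ (r - 1) * a / fact (r - 1) * (1 - exp (- y)) ^ (r - 1) < y"
begin

definition p :: "nat \<Rightarrow> real" where
  "p n = \<alpha> n / real n ^ (r - 1)"

definition E :: "nat \<Rightarrow> (nat clause set \<Rightarrow> real) \<Rightarrow> real" where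
  "E n f = expect (all_clauses r {..<n}) (p n) f"

definition Pr :: "nat \<Rightarrow> (nat clause set \<Rightarrow> bool) \<Rightarrow> real" where
  "Pr n P = E n (\<lambda>S. of_bool (P S))"

text \<open>At density \<open>a\<close>, the limit of the expected number of clauses that contain a
  given literal.\<close>

definition lam :: real where
  "lam = 2 ^ (r - 1) * a / fact (r - 1)"

text \<open>The probability that a branching process reaches depth \<open>t\<close> when the root
  has a Poisson number of clauses with mean \<open>lam\<close> and survives one more level if all
  \<open>r - 1\<close> children in one of its clauses survive.\<close>

primrec survival :: "nat \<Rightarrow> real" where
  "survival 0 = 1"
| "survival (Suc t) = 1 - exp (- (lam * survival t ^ (r - 1)))"

lemma lam_pos: "lam > 0"
  using a by (simp add: lam_def)

lemma survival_nonneg: "0 \<le> survival t"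
proof (induction t)
  case (Suc t)
  then have "0 \<le> lam * survival t ^ (r - 1)" using lam_pos by simp
  then show ?case by simp
qed simp

lemma survival_decreasing: "survival (Suc t) \<le> survival t"
proof (induction t)
  case (Suc t)
  then have "survival (Suc t) ^ (r - 1) \<le> survival t ^ (r - 1)" using survival_nonneg by (rule power_mono)
  then have "lam * survival (Suc t) ^ (r - 1) \<le> lam * survival t ^ (r - 1)" using lam_pos by (intro mult_left_mono) auto
  then show ?case unfolding survival.simps(2)[of t] survival.simps(2)[of "Suc t"] by (simp del: survival.simps)
next
  case 0
  show ?case using lam_pos by simp
qed

text \<open>The decreasing sequence converges to a fixpoint \<open>L\<close>. If \<open>L\<close>
  were positive, \<open>y = lam * L ^ (r - 1)\<close> would give equality where
  \<open>below_threshold\<close> asserts a strict inequality.\<close>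

lemma survival_tendsto: "survival \<longlonglongrightarrow> 0"
proof -
  obtain L where L: "survival \<longlonglongrightarrow> L"
    using decseq_convergent[of survival 0] decseq_SucI[of survival] survival_decreasing survival_nonneg by metis
  have "L \<ge> 0" using L survival_nonneg by (intro LIMSEQ_le_const) auto
  have "(\<lambda>t. survival (Suc t)) \<longlonglongrightarrow> 1 - exp (- (lam * L ^ (r - 1)))"
    unfolding survival.simps by (intro tendsto_intros L)
  moreover have "(\<lambda>t. survival (Suc t)) \<longlonglongrightarrow> L" using L by (rule LIMSEQ_Suc)
  ultimately have fixpoint: "1 - exp (- (lam * L ^ (r - 1))) = L" by (rule LIMSEQ_unique)
  have "L = 0"
  proof (rule ccontr)
    assume "L \<noteq> 0"
    then have "lam * L ^ (r - 1) > 0" using \<open>L \<ge> 0\<close> lam_pos by simp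
    from below_threshold[OF this] show False unfolding lam_def[symmetric] fixpoint by simp
  qed
  with L show ?thesis by simp
qed

lemma p_tendsto: "p \<longlonglongrightarrow> 0"
proof (rule tendsto_sandwich)
  show "\<forall>\<^sub>F n in sequentially. 0 \<le> p n"
    using \<alpha> by eventually_elim (simp add: p_def)
  show "\<forall>\<^sub>F n in sequentially. p n \<le> a / real n ^ (r - 1)"
    using \<alpha> by eventually_elim (simp add: p_def divide_right_mono)
  have "filterlim (\<lambda>n. real n ^ (r - 1)) at_top sequentially"
    using r by (intro filterlim_pow_at_top filterlim_real_sequentially) auto
  then show "(\<lambda>n. a / real n ^ (r - 1)) \<longlonglongrightarrow> 0"
    by (rule tendsto_divide_0[OF tendsto_const filterlim_at_top_imp_at_infinity])
qed simp

lemma p_eventually: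
  "eventually (\<lambda>n. n \<ge> 1 \<and> 0 < p n \<and> p n < 1 \<and> p n * real n ^ (r - 1) \<le> a) sequentially"
proof -
  have "eventually (\<lambda>n. p n < 1) sequentially"
    using order_tendstoD(2)[OF p_tendsto] by simp
  with \<alpha> eventually_ge_at_top[of 1] show ?thesis
    by eventually_elim (auto simp: p_def)
qed

lemma Pr_nonneg: "0 \<le> p n \<Longrightarrow> p n \<le> 1 \<Longrightarrow> 0 \<le> Pr n P"
  unfolding Pr_def E_def by (rule expect_nonneg) auto

lemma Pr_mono:
  "0 \<le> p n \<Longrightarrow> p n \<le> 1 \<Longrightarrow> (\<And>S. S \<subseteq> all_clauses r {..<n} \<Longrightarrow> P S \<Longrightarrow> Q S) \<Longrightarrow> Pr n P \<le> Pr n Q"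
  unfolding Pr_def E_def by (rule expect_mono) auto

lemma Pr_cycle_near:
  obtains K where "eventually (\<lambda>n. \<forall>v. Pr n (\<lambda>S. cycle_near S v t) \<le> K / real n) sequentially"
proof
  define B where "B = real (1 + r * t) * (2 * 2 ^ (r - 1))"
  define D where "D = real ((1 + r * t)\<^sup>2) * (4 * 2 ^ (r - 2))"
  show "eventually (\<lambda>n. \<forall>v. Pr n (\<lambda>S. cycle_near S v t) \<le> (\<Sum>k<t. (B * a) ^ k * (D * a)) / real n) sequentially"
    using p_eventually
  proof eventually_elim
    case (elim n)
    \<comment> \<open>This is the single factor \<open>1 / n\<close> gained by the closing
      clause.\<close>
    have n: "real n ^ (r - 2) = real n ^ (r - 1) / real n"
      using real_power_pred[of n "r - 1"] elim r by (simp add: numeral_2_eq_2)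
    have "Pr n (\<lambda>S. cycle_near S v t) \<le> (\<Sum>k<t. (B * a) ^ k * (D * a)) / real n" for v
    proof -
      have "Pr n (\<lambda>S. cycle_near S v t) \<le> (\<Sum>k<t. real (((1 + r * t) * (2 * (2 * n) ^ (r - 1))) ^ k
           * ((1 + r * t)\<^sup>2 * (4 * (2 * n) ^ (r - 2)))) * p n ^ Suc k)"
        unfolding Pr_def E_def using expect_cycle_near[of "{..<n}" "p n" r v t] elim by simp
      also have "\<dots> = (\<Sum>k<t. (B * (p n * real n ^ (r - 1))) ^ k * (D * (p n * real n ^ (r - 1)) / real n))"
      proof (rule sum.cong)
        fix k
        have "real (((1 + r * t) * (2 * (2 * n) ^ (r - 1))) ^ k
           * ((1 + r * t)\<^sup>2 * (4 * (2 * n) ^ (r - 2)))) * p n ^ Suc k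
          = (B * real n ^ (r - 1)) ^ k * (D * real n ^ (r - 2)) * p n ^ Suc k"
          by (simp only: B_def D_def of_nat_mult of_nat_power of_nat_numeral power_mult_distrib mult_ac)
        also have "\<dots> = (B * (p n * real n ^ (r - 1))) ^ k * (D * (p n * real n ^ (r - 1)) / real n)"
          unfolding n by (simp add: power_mult_distrib)
        finally show "real (((1 + r * t) * (2 * (2 * n) ^ (r - 1))) ^ k
           * ((1 + r * t)\<^sup>2 * (4 * (2 * n) ^ (r - 2)))) * p n ^ Suc k
          = (B * (p n * real n ^ (r - 1))) ^ k * (D * (p n * real n ^ (r - 1)) / real n)" .
      qed simp
      also have "\<dots> \<le> (\<Sum>k<t. (B * a) ^ k * (D * a / real n))"
        using elim by (intro sum_mono mult_mono power_mono divide_right_mono)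
          (use a in \<open>auto simp: B_def D_def intro!: mult_nonneg_nonneg\<close>)
      finally show ?thesis by (simp add: sum_divide_distrib)
    qed
    then show ?case ..
  qed
qed

text \<open>A mean bound cannot be iterated by itself, as the next mean involves a nonlinear
  function of the layer size. Hence the induction alternates: the mean at \<open>t\<close> gives the
  tail at \<open>t\<close>, and the tail gives the mean at \<open>Suc t\<close>.\<close>

definition layer_expectation :: "nat \<Rightarrow> bool" where
  "layer_expectation t \<longleftrightarrow> (\<forall>\<delta>>0. eventually (\<lambda>n.
     E n (\<lambda>S. real (card (layer {..<n} S t))) \<le> 2 * real n * (survival t + \<delta>)) sequentially)"

definition layer_tail :: "nat \<Rightarrow> bool" where
  "layer_tail t \<longleftrightarrow> (\<forall>\<delta>>0. \<forall>s. (\<lambda>n.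
     Pr n (\<lambda>S. real (card (layer {..<n} S t)) \<ge> 2 * real n * (survival t + \<delta>))) \<in> O(\<lambda>n. 1 / real n ^ s))"

lemma layer_expectation_0: "layer_expectation 0"
  unfolding layer_expectation_def E_def
  by (auto simp: finite_all_clauses card_cartesian_product algebra_simps intro!: always_eventually)

lemma layer_expectation_Suc:
  assumes "layer_tail t"
  shows "layer_expectation (Suc t)"
  unfolding layer_expectation_def
proof (intro allI impI)
  fix \<delta> :: real assume \<delta>: "\<delta> > 0"
  \<comment> \<open>The recursion with slack \<eta> both in the density, to absorb the factor
    \<open>1 / (1 - p n)\<close>, and in the layer size, to absorb its fluctuation. By continuity a
    small \<eta> costs less than \<open>\<delta> / 3\<close>; short cycles and layer deviations cost
    \<open>\<delta> / 3\<close> each.\<close>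
  define g where "g \<eta> = 1 - exp (- (2 ^ (r - 1) * (a + \<eta>) / fact (r - 1) * (survival t + \<eta>) ^ (r - 1)))" for \<eta>
  have "isCont g 0" unfolding g_def by (intro continuous_intros) auto
  then have "(g \<longlongrightarrow> g 0) (at_right 0)"
    by (meson continuous_within filterlim_at_split isContD)
  moreover have "g 0 = survival (Suc t)" by (simp add: g_def lam_def)
  ultimately have "eventually (\<lambda>\<eta>. g \<eta> < survival (Suc t) + \<delta> / 3) (at_right 0)"
    using \<delta> by (intro order_tendstoD(2)) auto
  with eventually_at_right_less[of "0::real"]
  have "eventually (\<lambda>\<eta>. 0 < \<eta> \<and> g \<eta> < survival (Suc t) + \<delta> / 3) (at_right 0)"
    by eventually_elim simp
  then obtain \<eta> where \<eta>: "\<eta> > 0" "g \<eta> < survival (Suc t) + \<delta> / 3"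
    using eventually_happens'[OF trivial_limit_at_right_real] by blast
  obtain K where K: "eventually (\<lambda>n. \<forall>v. Pr n (\<lambda>S. cycle_near S v (Suc t)) \<le> K / real n) sequentially"
    by (rule Pr_cycle_near)
  have "(\<lambda>n. K / real n) \<longlonglongrightarrow> 0" by real_asymp
  then have K': "eventually (\<lambda>n. K / real n < \<delta> / 3) sequentially"
    using \<delta> by (intro order_tendstoD(2)) auto
  have "(\<lambda>n. Pr n (\<lambda>S. real (card (layer {..<n} S t)) \<ge> 2 * real n * (survival t + \<eta>))) \<longlonglongrightarrow> 0"
    using assms \<eta>(1) unfolding layer_tail_def by (intro bigo_inverse_tendsto) blast
  then have T: "eventually (\<lambda>n. Pr n (\<lambda>S. real (card (layer {..<n} S t)) \<ge> 2 * real n * (survival t + \<eta>)) < \<delta> / 3) sequentially"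
    using \<delta> by (intro order_tendstoD(2)) auto
  have "(\<lambda>n. a / (1 - p n)) \<longlonglongrightarrow> a / (1 - 0)" by (intro tendsto_intros p_tendsto) auto
  then have A: "eventually (\<lambda>n. a / (1 - p n) < a + \<eta>) sequentially"
    using \<eta> by (intro order_tendstoD(2)) auto
  show "eventually (\<lambda>n. E n (\<lambda>S. real (card (layer {..<n} S (Suc t)))) \<le> 2 * real n * (survival (Suc t) + \<delta>)) sequentially"
    using p_eventually K K' T A
  proof eventually_elim
    case (elim n)
    then have p: "0 \<le> p n" "p n < 1" "p n \<le> 1" and n: "n \<ge> 1" by auto
    let ?\<psi> = "\<lambda>h. 1 - exp (- (p n / (1 - p n) * (h ^ (r - 1) / fact (r - 1))))"
    let ?h = "2 * real n * (survival t + \<eta>)"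
    have hn: "0 \<le> ?h" using survival_nonneg[of t] \<eta> by simp
    have \<psi>h: "?\<psi> ?h \<le> g \<eta>"
    proof -
      have "p n / (1 - p n) * (?h ^ (r - 1) / fact (r - 1))
          = 2 ^ (r - 1) * ((p n * real n ^ (r - 1)) / (1 - p n)) / fact (r - 1) * (survival t + \<eta>) ^ (r - 1)"
        by (simp add: power_mult_distrib)
      also have "\<dots> \<le> 2 ^ (r - 1) * (a + \<eta>) / fact (r - 1) * (survival t + \<eta>) ^ (r - 1)"
      proof (intro mult_right_mono divide_right_mono mult_left_mono)
        have "p n * real n ^ (r - 1) / (1 - p n) \<le> a / (1 - p n)" using elim p by (intro divide_right_mono) auto
        then show "p n * real n ^ (r - 1) / (1 - p n) \<le> a + \<eta>" using elim by linarith
      qed (use survival_nonneg[of t] \<eta> in auto)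
      finally show ?thesis by (simp add: g_def)
    qed
    have "E n (\<lambda>S. ?\<psi> (real (card (layer {..<n} S t))))
        \<le> E n (\<lambda>S. of_bool (real (card (layer {..<n} S t)) \<ge> ?h) + ?\<psi> ?h)"
      unfolding E_def
    proof (rule expect_mono)
      fix S
      let ?c = "real (card (layer {..<n} S t))"
      have *: "0 \<le> p n / (1 - p n) * (h ^ (r - 1) / fact (r - 1))" if "0 \<le> h" for h
        using that p by auto
      show "?\<psi> ?c \<le> of_bool (?c \<ge> ?h) + ?\<psi> ?h"
      proof (cases "?c \<ge> ?h")
        case True
        have "?\<psi> ?c \<le> 1" "0 \<le> ?\<psi> ?h" using *[OF hn] by simp_all
        moreover have "of_bool (?c \<ge> ?h) = (1 :: real)" using True by simp
        ultimately show ?thesis by linarith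
      next
        case False
        then have "?c ^ (r - 1) \<le> ?h ^ (r - 1)" by (intro power_mono) auto
        then have "p n / (1 - p n) * (?c ^ (r - 1) / fact (r - 1)) \<le> p n / (1 - p n) * (?h ^ (r - 1) / fact (r - 1))"
          using p by (intro mult_left_mono divide_right_mono) auto
        with False show ?thesis by simp
      qed
    qed (use p in auto)
    also have "\<dots> = Pr n (\<lambda>S. real (card (layer {..<n} S t)) \<ge> ?h) + ?\<psi> ?h"
      unfolding Pr_def E_def expect_add by (simp add: finite_all_clauses)
    finally have 1: "E n (\<lambda>S. ?\<psi> (real (card (layer {..<n} S t)))) \<le> \<delta> / 3 + (survival (Suc t) + \<delta> / 3)"
      using elim \<psi>h \<eta> by linarith
    have "E n (\<lambda>S. real (card (layer {..<n} S (Suc t))))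
        \<le> 2 * real n * (K / real n + E n (\<lambda>S. ?\<psi> (real (card (layer {..<n} S t)))))"
      unfolding E_def using expect_layer_Suc[of "{..<n}" "p n" r t "K / real n"] p elim
      by (simp add: Pr_def E_def)
    also have "\<dots> \<le> 2 * real n * (survival (Suc t) + \<delta>)"
    proof (rule mult_left_mono)
      show "K / real n + E n (\<lambda>S. ?\<psi> (real (card (layer {..<n} S t)))) \<le> survival (Suc t) + \<delta>"
        using 1 elim(2,3) by linarith
    qed simp
    finally show ?case .
  qed
qed

lemma layer_tail:
  assumes "layer_expectation t"
  shows "layer_tail t"
  unfolding layer_tail_def
proof (intro allI impI)
  fix \<delta> :: real and s :: nat
  assume \<delta>: "\<delta> > 0"
  \<comment> \<open>With degrees capped at \<open>n powr \<eta>\<close>, one clause changes the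
    layer by at most order \<open>n powr (1 / 4)\<close>. Its square is then of order
    \<open>sqrt n\<close>, which leaves \<open>sqrt n\<close> in the exponent of the tail, while the
    cap still grows like a power of \<open>n\<close>.\<close>
  define \<eta> where "\<eta> = 1 / (4 * real (Suc t))"
  define \<Delta> where "\<Delta> n = nat \<lfloor>real n powr \<eta>\<rfloor>" for n :: nat
  define c where "c n = real r * (1 + real r * real (\<Delta> n)) ^ t" for n
  define A where "A = 2 ^ r * a + \<delta>"
  define D where "D = (real r * (1 + real r) ^ t)\<^sup>2"
  define K where "K = 2 * 2 ^ (r - 1) * a"
  have \<eta>: "0 < \<eta>" "\<eta> * t \<le> 1 / 4" by (auto simp: \<eta>_def field_simps)
  have pos: "A > 0" "D > 0" "K > 0" using a \<delta> r by (auto simp: A_def D_def K_def intro!: add_pos_pos mult_pos_pos)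
  have ex: "eventually (\<lambda>n. E n (\<lambda>S. real (card (layer {..<n} S t))) \<le> 2 * real n * (survival t + \<delta> / 2)) sequentially"
    using assms \<delta> unfolding layer_expectation_def by simp
  let ?f = "\<lambda>n. Pr n (\<lambda>S. real (card (layer {..<n} S t)) \<ge> 2 * real n * (survival t + \<delta>))"
  let ?g = "\<lambda>n. exp (2 * K) * (real n * 2 powr (- (real n powr \<eta>))) + exp (- (\<delta>\<^sup>2 / (4 * A * D) * sqrt (real n)))"
  have "?g \<in> O(\<lambda>n. 1 / real n ^ s)"
  proof (rule sum_in_bigo)
    show "(\<lambda>n. exp (2 * K) * (real n * 2 powr (- (real n powr \<eta>)))) \<in> O(\<lambda>n. 1 / real n ^ s)"
      using stretched_exponential_bigo[OF \<eta>(1), of s] by simp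
    show "(\<lambda>n. exp (- (\<delta>\<^sup>2 / (4 * A * D) * sqrt (real n)))) \<in> O(\<lambda>n. 1 / real n ^ s)"
      using \<delta> pos by (intro exp_sqrt_bigo) simp
  qed
  moreover have "eventually (\<lambda>n. 0 \<le> ?f n \<and> ?f n \<le> ?g n) sequentially"
    using p_eventually ex
  proof eventually_elim
    case (elim n)
    then have p: "0 \<le> p n" "p n \<le> 1" and n: "n \<ge> 1" by auto
    have \<Delta>1: "\<Delta> n \<ge> 1"
    proof -
      have "1 \<le> real n powr \<eta>" using n \<eta> by (intro ge_one_powr_ge_zero) auto
      then show ?thesis unfolding \<Delta>_def by linarith
    qed
    have \<Delta>2: "real (\<Delta> n) \<le> real n powr \<eta>" unfolding \<Delta>_def by simp
    have \<Delta>3: "real n powr \<eta> \<le> real (Suc (\<Delta> n))" unfolding \<Delta>_def by linarith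
    have c1: "c n \<ge> 1"
    proof -
      have "1 * 1 \<le> real r * (1 + real r * real (\<Delta> n)) ^ t"
        using r by (intro mult_mono one_le_power) auto
      then show ?thesis by (simp add: c_def)
    qed
    have c2: "(c n)\<^sup>2 \<le> D * sqrt (real n)"
    proof -
      have "1 + real r * real (\<Delta> n) \<le> (1 + real r) * real (\<Delta> n)" using \<Delta>1 by (simp add: algebra_simps)
      also have "\<dots> \<le> (1 + real r) * real n powr \<eta>" using \<Delta>2 by (intro mult_left_mono) auto
      finally have "(1 + real r * real (\<Delta> n)) ^ t \<le> ((1 + real r) * real n powr \<eta>) ^ t"
        by (intro power_mono) auto
      also have "\<dots> = (1 + real r) ^ t * real n powr (\<eta> * t)"
      proof -
        have "(real n powr \<eta>) ^ t = (real n powr \<eta>) powr real t"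
          using n by (intro powr_realpow[symmetric]) simp
        then show ?thesis by (simp add: power_mult_distrib powr_powr)
      qed
      also have "\<dots> \<le> (1 + real r) ^ t * real n powr (1 / 4)"
        using n \<eta> by (intro mult_left_mono powr_mono) auto
      finally have "c n \<le> real r * (1 + real r) ^ t * real n powr (1 / 4)"
        unfolding c_def by (simp add: mult_left_mono mult.assoc)
      then have "(c n)\<^sup>2 \<le> (real r * (1 + real r) ^ t * real n powr (1 / 4))\<^sup>2"
        using c1 by (intro power_mono) auto
      also have "\<dots> = D * (real n powr (1 / 4))\<^sup>2" by (simp add: D_def power_mult_distrib)
      also have "(real n powr (1 / 4))\<^sup>2 = sqrt (real n)"
        using n by (simp add: power2_eq_square powr_add[symmetric] powr_half_sqrt)
      finally show ?thesis .
    qed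
    \<comment> \<open>The minimiser of
      \<open>- (\<kappa> * n * \<delta> / c n) + A * n * \<kappa> ^ 2\<close>. The summand \<delta>
      of \<open>A\<close> ensures \<open>\<kappa> \<le> 1\<close>.\<close>
    define \<kappa> where "\<kappa> = \<delta> / (2 * c n * A)"
    have \<kappa>: "0 < \<kappa>" "\<kappa> \<le> 1"
    proof -
      show "0 < \<kappa>" using \<delta> c1 pos by (simp add: \<kappa>_def)
      have "\<delta> \<le> 1 * A" using a by (simp add: A_def)
      also have "\<dots> \<le> (2 * c n) * A" using c1 pos by (intro mult_right_mono) auto
      finally show "\<kappa> \<le> 1" using c1 pos by (simp add: \<kappa>_def)
    qed
    have "?f n \<le> n * (real (2 * (2 * n) ^ (r - 1)) * p n) ^ Suc (\<Delta> n) / fact (Suc (\<Delta> n))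
     + exp (- (\<kappa> * (n * \<delta>) / (r * (1 + r * \<Delta> n) ^ t)) + (2 * n) ^ r * p n * \<kappa>\<^sup>2)"
      using expect_layer_deviation[of "{..<n}" "p n" r t "2 * real n * (survival t + \<delta> / 2)" \<kappa> "real n * \<delta>" "\<Delta> n"]
        p \<kappa> elim r unfolding Pr_def E_def by (simp add: algebra_simps)
    also have "\<dots> \<le> ?g n"
    proof (rule add_mono)
      have "real (2 * (2 * n) ^ (r - 1)) * p n = 2 * 2 ^ (r - 1) * (p n * real n ^ (r - 1))"
        by (simp add: power_mult_distrib)
      also have "\<dots> \<le> K" unfolding K_def using elim by (intro mult_left_mono) auto
      finally have "real n * ((real (2 * (2 * n) ^ (r - 1)) * p n) ^ Suc (\<Delta> n) / fact (Suc (\<Delta> n)))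
          \<le> real n * (exp (2 * K) * 2 powr (- (real n powr \<eta>)))"
        using p \<Delta>3 by (intro mult_left_mono power_div_fact_le_powr) auto
      then show "n * (real (2 * (2 * n) ^ (r - 1)) * p n) ^ Suc (\<Delta> n) / fact (Suc (\<Delta> n))
          \<le> exp (2 * K) * (real n * 2 powr (- (real n powr \<eta>)))"
        by (simp only: times_divide_eq_right mult.left_commute)
    next
      have "real n ^ r = real n ^ (r - 1) * real n" using r by (cases r) auto
      then have "(2 * real n) ^ r * p n = 2 ^ r * (p n * real n ^ (r - 1)) * real n"
        by (simp add: power_mult_distrib)
      also have "\<dots> \<le> A * real n" unfolding A_def using elim \<delta> by (intro mult_right_mono add_increasing2 mult_left_mono) auto
      finally have "(2 * real n) ^ r * p n * \<kappa>\<^sup>2 \<le> A * real n * \<kappa>\<^sup>2" by (intro mult_right_mono) auto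
      moreover have "- (\<kappa> * (n * \<delta>) / c n) + A * real n * \<kappa>\<^sup>2 = - (\<delta>\<^sup>2 * real n / (4 * A * (c n)\<^sup>2))"
      proof -
        define q where "q = \<delta>\<^sup>2 * real n / (A * (c n)\<^sup>2)"
        have "\<kappa> * (n * \<delta>) / c n = q / 2" "A * real n * \<kappa>\<^sup>2 = q / 4"
          "\<delta>\<^sup>2 * real n / (4 * A * (c n)\<^sup>2) = q / 4"
          using pos by (simp_all add: \<kappa>_def q_def power2_eq_square mult_ac)
        then show ?thesis by linarith
      qed
      moreover have "\<delta>\<^sup>2 / (4 * A * D) * sqrt (real n) \<le> \<delta>\<^sup>2 * real n / (4 * A * (c n)\<^sup>2)"
      proof -
        have "\<delta>\<^sup>2 / (4 * A * D) * sqrt (real n) = \<delta>\<^sup>2 * real n / (4 * A * (D * sqrt (real n)))"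
        proof -
          have "real n = sqrt (real n) * sqrt (real n)" by simp
          moreover have "sqrt (real n) > 0" using n by simp
          ultimately have "real n / sqrt (real n) = sqrt (real n)" by (metis nonzero_mult_div_cancel_left less_irrefl)
          moreover have "\<delta>\<^sup>2 * real n / (4 * A * (D * sqrt (real n))) = \<delta>\<^sup>2 / (4 * A * D) * (real n / sqrt (real n))" by simp
          ultimately show ?thesis by simp
        qed
        also have "\<dots> \<le> \<delta>\<^sup>2 * real n / (4 * A * (c n)\<^sup>2)"
          using n c2 c1 pos by (intro divide_left_mono mult_left_mono mult_pos_pos) auto
        finally show ?thesis .
      qed
      moreover have eqs: "real (r * (1 + r * \<Delta> n) ^ t) = c n" "real ((2 * n) ^ r) = (2 * real n) ^ r"
        by (simp_all add: c_def)
      ultimately show "exp (- (\<kappa> * (n * \<delta>) / (r * (1 + r * \<Delta> n) ^ t)) + (2 * n) ^ r * p n * \<kappa>\<^sup>2)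
          \<le> exp (- (\<delta>\<^sup>2 / (4 * A * D) * sqrt (real n)))"
        unfolding exp_le_cancel_iff eqs by linarith
    qed
    finally show ?case using Pr_nonneg[OF p] by auto
  qed
  ultimately show "?f \<in> O(\<lambda>n. 1 / real n ^ s)" by (rule bigo_mono)
qed

lemma layer_tail_all: "layer_tail t"
proof (induction t)
  case 0
  show ?case by (rule layer_tail[OF layer_expectation_0])
next
  case (Suc t)
  show ?case by (rule layer_tail[OF layer_expectation_Suc[OF Suc]])
qed

text \<open>A balanced subset with at least \<open>\<epsilon> * n\<close> variables puts
  \<open>2 * \<epsilon> * n\<close> literals into every layer, too many for a depth \<open>t\<close>
  with \<open>survival t < \<epsilon> / 2\<close>.\<close>

lemma Pr_large_balanced:
  assumes "\<epsilon> > 0"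
  shows "(\<lambda>n. Pr n (\<lambda>S. \<exists>G\<subseteq>S. balanced G \<and> real (card (clause_vars G)) \<ge> \<epsilon> * real n)) \<in> O(\<lambda>n. 1 / real n ^ s)"
proof -
  have "eventually (\<lambda>t. survival t < \<epsilon> / 2) sequentially"
    using assms survival_tendsto by (intro order_tendstoD(2)) auto
  then obtain t where t: "survival t < \<epsilon> / 2" by (auto simp: eventually_sequentially)
  have "(\<lambda>n. Pr n (\<lambda>S. real (card (layer {..<n} S t)) \<ge> 2 * real n * (survival t + \<epsilon> / 2))) \<in> O(\<lambda>n. 1 / real n ^ s)"
    using layer_tail_all[of t] assms unfolding layer_tail_def by simp
  moreover have "eventually (\<lambda>n. 0 \<le> Pr n (\<lambda>S. \<exists>G\<subseteq>S. balanced G \<and> real (card (clause_vars G)) \<ge> \<epsilon> * real n)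
      \<and> Pr n (\<lambda>S. \<exists>G\<subseteq>S. balanced G \<and> real (card (clause_vars G)) \<ge> \<epsilon> * real n)
       \<le> Pr n (\<lambda>S. real (card (layer {..<n} S t)) \<ge> 2 * real n * (survival t + \<epsilon> / 2))) sequentially"
    using p_eventually
  proof eventually_elim
    case (elim n)
    then have p: "0 \<le> p n" "p n \<le> 1" by auto
    have "2 * real n * (survival t + \<epsilon> / 2) \<le> real (card (layer {..<n} S t))"
      if S: "S \<subseteq> all_clauses r {..<n}" and ex: "\<exists>G\<subseteq>S. balanced G \<and> real (card (clause_vars G)) \<ge> \<epsilon> * real n" for S
    proof -
      obtain G where G: "G \<subseteq> S" "balanced G" "real (card (clause_vars G)) \<ge> \<epsilon> * real n" using ex by blast
      have sub: "\<Union>G \<subseteq> layer {..<n} S t" using G S by (intro balanced_subset_layer)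
      have fin: "finite (layer {..<n} S t)" by (rule finite_layer[OF S]) simp
      have "2 * card (clause_vars G) = card (\<Union>G)"
        using card_Union_balanced[OF G(2)] finite_subset[OF sub fin] by simp
      also have "\<dots> \<le> card (layer {..<n} S t)" by (rule card_mono[OF fin sub])
      finally have "2 * (\<epsilon> * real n) \<le> real (card (layer {..<n} S t))" using G(3) by linarith
      moreover have "2 * real n * (survival t + \<epsilon> / 2) \<le> 2 * real n * \<epsilon>" using t by (intro mult_left_mono) auto
      ultimately show ?thesis by (simp add: mult_ac)
    qed
    from Pr_nonneg[OF p] Pr_mono[OF p this] show ?case by (rule conjI)
  qed
  ultimately show ?thesis by (rule bigo_mono)
qed

end

section \<open>Balanced subformulae of intermediate size\<close>

text \<open>One clause is chosen for each literal of \<open>G\<close>. The chosen clauses still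
  cover all \<open>2 * v\<close> literals, but their number is linear in the number \<open>v\<close>
  of variables, whereas \<open>G\<close> may have order \<open>v ^ r\<close> clauses.\<close>

lemma balanced_thin_subset:
  assumes "balanced G" "\<And>C. C \<in> G \<Longrightarrow> finite C \<and> card C = r" "finite (clause_vars G)"
  obtains H where "H \<subseteq> G" "card H \<le> 2 * card (clause_vars G)" "2 * card (clause_vars G) \<le> r * card H"
    "finite H"
proof -
  let ?L = "\<Union>G"
  have "?L \<subseteq> clause_vars G \<times> UNIV" by (force simp: clause_vars_def)
  then have finL: "finite ?L" by (rule finite_subset) (use assms(3) in auto)
  have L: "card ?L = 2 * card (clause_vars G)" by (rule card_Union_balanced[OF assms(1) finL])
  have "\<forall>l\<in>?L. \<exists>C. C \<in> G \<and> l \<in> C" by blast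
  from bchoice[OF this] obtain f where f: "\<And>l. l \<in> ?L \<Longrightarrow> f l \<in> G \<and> l \<in> f l" by blast
  show thesis
  proof
    show "f ` ?L \<subseteq> G" using f by blast
    show "card (f ` ?L) \<le> 2 * card (clause_vars G)"
      using card_image_le[OF finL, of f] L by simp
    show fin: "finite (f ` ?L)" using finL by simp
    have "card ?L \<le> card (\<Union>(f ` ?L))"
    proof (rule card_mono)
      show "finite (\<Union>(f ` ?L))"
        using fin f assms(2) by (intro finite_Union) auto
      show "?L \<subseteq> \<Union>(f ` ?L)" using f by blast
    qed
    also have "\<dots> \<le> (\<Sum>C\<in>f ` ?L. card C)" using card_UN_le[OF fin, of id] by simp
    also have "\<dots> = (\<Sum>C\<in>f ` ?L. r)" using f assms(2) by (intro sum.cong) auto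
    also have "\<dots> = r * card (f ` ?L)" by simp
    finally show "2 * card (clause_vars G) \<le> r * card (f ` ?L)" using L by simp
  qed
qed

lemma all_clauses_mono: "V \<subseteq> W \<Longrightarrow> all_clauses r V \<subseteq> all_clauses r W"
  by (auto simp: all_clauses_def)

text \<open>For \<open>r \<ge> 3\<close> the ratio \<open>(r - 1) / r\<close> is at least
  \<open>2 / 3\<close>. The surplus of \<open>(r - 1) * c\<close> over \<open>v\<close>, at least
  \<open>v / 3\<close>, is the source of every factor \<open>3\<close> in the cut-offs.\<close>

lemma three_times_clauses:
  fixes r v c :: nat
  assumes "r \<ge> 3" "2 * v \<le> r * c"
  shows "4 * v \<le> 3 * ((r - 1) * c)"
proof -
  have "2 * r \<le> 3 * (r - 1)" using assms(1) by simp
  then have "2 * r * c \<le> 3 * (r - 1) * c" by (rule mult_right_mono) simp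
  then have "2 * (r * c) \<le> 3 * ((r - 1) * c)" by (simp only: mult.assoc)
  then show ?thesis using assms(2) by linarith
qed

lemma real_binomial_le_exp: "v \<ge> 1 \<Longrightarrow> real (n choose v) \<le> (exp 1 * (real n / real v)) ^ v"
proof -
  assume v: "v \<ge> 1"
  have "real (n choose v) \<le> real n ^ v / fact v" by (rule real_binomial_le)
  also have "\<dots> = (real n / real v) ^ v * (real v ^ v / fact v)"
    using v by (simp add: power_divide)
  also have "\<dots> \<le> (real n / real v) ^ v * exp (real v)"
    by (intro mult_left_mono power_div_fact_le_exp) auto
  also have "exp (real v) = exp 1 ^ v"
    by (simp add: exp_of_nat_mult[symmetric])
  finally show ?thesis by (simp only: power_mult_distrib mult.commute)
qed

text \<open>A term of the exponential series gives
  \<open>v ^ s \<le> fact s * 4 ^ s * exp (v / 4)\<close>, and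
  \<open>exp (1 / 4) \<le> 1 + 1 / 4 + 1 / 16 = 21 / 16\<close>. Multiplied by \<open>1 / 2\<close>
  this is the ratio \<open>21 / 32\<close>, whose geometric series sums to
  \<open>32 / 11\<close>.\<close>

lemma sum_power_geometric_le:
  fixes A :: "nat set"
  assumes "finite A"
  shows "(\<Sum>v\<in>A. real v ^ s * (1 / 2) ^ v) \<le> fact s * 4 ^ s * (32 / 11)"
proof -
  have "real v ^ s * (1 / 2) ^ v \<le> fact s * 4 ^ s * (21 / 32) ^ v" for v
  proof -
    have "(real v / 4) ^ s / fact s \<le> exp (real v / 4)" by (rule power_div_fact_le_exp) simp
    also have "\<dots> = exp (1 / 4) ^ v" by (simp add: exp_of_nat_mult[symmetric])
    also have "\<dots> \<le> (21 / 16) ^ v"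
      using exp_minus_affine_le[of "1 / 4"] by (intro power_mono) (auto simp: power2_eq_square)
    finally have "real v ^ s \<le> fact s * 4 ^ s * (21 / 16) ^ v"
      by (simp add: power_divide field_simps)
    then have "real v ^ s * (1 / 2) ^ v \<le> fact s * 4 ^ s * (21 / 16) ^ v * (1 / 2) ^ v"
      by (rule mult_right_mono) simp
    also have "\<dots> = fact s * 4 ^ s * (21 / 16 * (1 / 2)) ^ v" by (simp only: power_mult_distrib mult_ac)
    finally show ?thesis by simp
  qed
  then have "(\<Sum>v\<in>A. real v ^ s * (1 / 2) ^ v) \<le> (\<Sum>v\<in>A. fact s * 4 ^ s * (21 / 32) ^ v)"
    by (rule sum_mono)
  also have "\<dots> = fact s * 4 ^ s * (\<Sum>v\<in>A. (21 / 32) ^ v)" by (simp only: sum_distrib_left)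
  also have "(\<Sum>v\<in>A. (21 / 32 :: real) ^ v) \<le> (\<Sum>v. (21 / 32) ^ v)"
    using assms by (intro sum_le_suminf summable_geometric) auto
  also have "(\<Sum>v. (21 / 32 :: real) ^ v) = 32 / 11" by (subst suminf_geometric) auto
  finally show ?thesis by simp
qed

lemma of_bool_le_add: "(P \<Longrightarrow> Q \<or> R) \<Longrightarrow> of_bool P \<le> (of_bool Q + of_bool R :: real)"
  by auto

section \<open>First-moment bounds for balanced subsets\<close>

context subcritical_regime
begin

text \<open>The certificate is the variable set of \<open>G\<close> with a thin subset of its
  clauses, so that only \<open>c \<le> 2 * v\<close> has to be considered.\<close>

lemma Pr_balanced_size_le:
  assumes "0 \<le> p n" "p n \<le> 1"
  shows "Pr n (\<lambda>S. \<exists>G\<subseteq>S. balanced G \<and> card (clause_vars G) = v)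
    \<le> real (n choose v) * (\<Sum>c\<in>{c. c \<le> 2 * v \<and> 2 * v \<le> r * c}. real ((2 * v) ^ r choose c) * p n ^ c)"
proof -
  let ?I = "all_clauses r {..<n}"
  let ?Ws = "{W. W \<subseteq> {..<n} \<and> card W = v}"
  let ?Cs = "{c. c \<le> 2 * v \<and> 2 * v \<le> r * c}"
  let ?Gs = "\<lambda>W c. {G. G \<subseteq> all_clauses r W \<and> card G = c}"
  let ?X = "SIGMA W:?Ws. SIGMA c:?Cs. ?Gs W c"
  have finW: "finite W" if "W \<in> ?Ws" for W using that finite_subset[of W "{..<n}"] by auto
  have finC: "finite ?Cs" by (rule finite_subset[of _ "{..2 * v}"]) auto
  have finG: "finite (?Gs W c)" if "W \<in> ?Ws" for W c
    using finite_all_clauses[OF finW[OF that], of r] by simp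
  have cG: "real (card (?Gs W c)) \<le> real ((2 * v) ^ r choose c)" if "W \<in> ?Ws" for W c
  proof -
    have "card (?Gs W c) = card (all_clauses r W) choose c"
      using finite_all_clauses[OF finW[OF that], of r] by (rule n_subsets)
    also have "\<dots> \<le> (2 * v) ^ r choose c"
      using card_all_clauses[OF finW[OF that], of r] that by (intro binomial_right_mono) auto
    finally show ?thesis by simp
  qed
  have "Pr n (\<lambda>S. \<exists>G\<subseteq>S. balanced G \<and> card (clause_vars G) = v) \<le> (\<Sum>x\<in>?X. p n ^ card (snd (snd x)))"
    unfolding Pr_def E_def
  proof (rule expect_exists_superset[OF assms])
    show "finite ?X" using finC finG by (intro finite_SigmaI) auto
    show "snd (snd x) \<subseteq> ?I" if "x \<in> ?X" for x
    proof -
      obtain W c G where x: "x = (W, c, G)" by (cases x)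
      with that have "G \<subseteq> all_clauses r W" "W \<subseteq> {..<n}" by auto
      then have "G \<subseteq> ?I" using all_clauses_mono[of W "{..<n}" r] by blast
      then show ?thesis using x by simp
    qed
    fix S assume S: "S \<subseteq> ?I" "\<exists>G\<subseteq>S. balanced G \<and> card (clause_vars G) = v"
    then obtain G where G: "G \<subseteq> S" "balanced G" "card (clause_vars G) = v" by blast
    have GI: "G \<subseteq> ?I" using G S by blast
    have W: "clause_vars G \<in> ?Ws" using clause_vars_subset[OF GI] G by simp
    have clause: "finite C \<and> card C = r" if "C \<in> G" for C
      using GI that finite_clause[of C r "{..<n}"] card_clause[of C r "{..<n}"] by blast
    obtain H where H: "H \<subseteq> G" "card H \<le> 2 * card (clause_vars G)"
      "2 * card (clause_vars G) \<le> r * card H" "finite H"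
      by (rule balanced_thin_subset[OF G(2) clause finW[OF W]])
    note H = H(1) H(2,3)[unfolded G(3)]
    have "H \<subseteq> all_clauses r (clause_vars G)"
    proof
      fix C assume C: "C \<in> H"
      have "C \<subseteq> clause_vars G \<times> UNIV"
      proof
        fix l assume "l \<in> C"
        then have "fst l \<in> clause_vars G" unfolding clause_vars_def using C H(1) by blast
        then show "l \<in> clause_vars G \<times> UNIV" by (simp add: mem_Times_iff)
      qed
      moreover have "C \<in> all_clauses r {..<n}" using C H(1) GI by blast
      ultimately show "C \<in> all_clauses r (clause_vars G)" by (simp add: all_clauses_def)
    qed
    then have "(clause_vars G, card H, H) \<in> ?X" using W H by simp
    moreover have "snd (snd (clause_vars G, card H, H)) \<subseteq> S" using H G by simp
    ultimately show "\<exists>x\<in>?X. snd (snd x) \<subseteq> S" by (rule bexI[rotated])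
  qed (simp add: finite_all_clauses)
  also have "\<dots> = (\<Sum>W\<in>?Ws. \<Sum>y\<in>(SIGMA c:?Cs. ?Gs W c). p n ^ card (snd y))"
    using finC finG sum.Sigma[of ?Ws "\<lambda>W. SIGMA c:?Cs. ?Gs W c" "\<lambda>W y. p n ^ card (snd y)"]
    by (simp add: case_prod_beta)
  also have "\<dots> = (\<Sum>W\<in>?Ws. \<Sum>c\<in>?Cs. \<Sum>G\<in>?Gs W c. p n ^ card G)"
  proof (rule sum.cong[OF refl])
    fix W assume "W \<in> ?Ws"
    then show "(\<Sum>y\<in>(SIGMA c:?Cs. ?Gs W c). p n ^ card (snd y)) = (\<Sum>c\<in>?Cs. \<Sum>G\<in>?Gs W c. p n ^ card G)"
      using finC finG sum.Sigma[of ?Cs "?Gs W" "\<lambda>c G. p n ^ card G"] by (simp add: case_prod_beta)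
  qed
  also have "\<dots> = (\<Sum>W\<in>?Ws. \<Sum>c\<in>?Cs. real (card (?Gs W c)) * p n ^ c)"
    by (intro sum.cong refl) simp
  also have "\<dots> \<le> (\<Sum>W\<in>?Ws. \<Sum>c\<in>?Cs. real ((2 * v) ^ r choose c) * p n ^ c)"
    using cG assms by (intro sum_mono mult_right_mono) auto
  also have "\<dots> = real (n choose v) * (\<Sum>c\<in>?Cs. real ((2 * v) ^ r choose c) * p n ^ c)"
    by (simp add: n_subsets)
  finally show ?thesis .
qed

text \<open>Cubing makes all exponents integers: a balanced set of \<open>c\<close> clauses on \<open>v\<close> variables has
  \<open>3 * (r - 1) * c \<ge> 4 * v\<close>.\<close>

lemma clause_count_term_le:
  fixes v c n :: nat
  assumes v: "1 \<le> v" "v \<le> n" and c: "c \<le> 2 * v" "2 * v \<le> r * c"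
    and p: "0 \<le> p n" "p n * real n ^ (r - 1) \<le> a"
    and B: "B = 1 + exp 1 * r * 2 ^ (r - 1) * a"
  shows "(real (n choose v) * (real ((2 * v) ^ r choose c) * p n ^ c)) ^ 3
    \<le> ((exp 1 * B\<^sup>2) ^ 3 * (real v / real n)) ^ v"
proof -
  define z where "z = real v / real n"
  have z: "0 < z" "z \<le> 1" using v by (auto simp: z_def)
  have c1: "c \<ge> 1" using c v by (cases c) auto
  have B1: "B \<ge> 1" using a by (simp add: B)
  have rr: "real (2 * v) ^ r = real (2 * v) ^ (r - 1) * real (2 * v)" using r by (cases r) auto
  have n0: "real n ^ (r - 1) > 0" using v by simp
  have "real ((2 * v) ^ r choose c) * p n ^ c \<le> (exp 1 * (real ((2 * v) ^ r) / real c)) ^ c * p n ^ c"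
    using p by (intro mult_right_mono real_binomial_le_exp c1) simp
  also have "\<dots> = (exp 1 * (real ((2 * v) ^ r) / real c) * p n) ^ c"
    by (simp only: power_mult_distrib)
  also have "\<dots> \<le> (B * z ^ (r - 1)) ^ c"
  proof (intro power_mono)
    \<comment> \<open>Since \<open>c\<close> is at least \<open>2 * v / r\<close>, dividing by
      \<open>c\<close> removes one power of \<open>2 * v\<close>; the remaining power
      \<open>r - 1\<close> matches the denominator of \<open>p n\<close>.\<close>
    have "real ((2 * v) ^ r) / real c = real (2 * v) ^ (r - 1) * (real (2 * v) / real c)"
      using rr by simp
    also have "\<dots> \<le> real (2 * v) ^ (r - 1) * real r"
    proof (intro mult_left_mono)
      have "real (2 * v) \<le> real r * real c" using c(2) by (simp only: of_nat_mult[symmetric] of_nat_le_iff)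
      then show "real (2 * v) / real c \<le> real r" using c1 by (simp add: field_simps)
    qed simp
    finally have 1: "real ((2 * v) ^ r) / real c \<le> real (2 * v) ^ (r - 1) * real r" .
    have 2: "p n \<le> a / real n ^ (r - 1)" using p(2) n0 by (simp add: field_simps)
    have "exp 1 * (real ((2 * v) ^ r) / real c) * p n
        \<le> exp 1 * (real (2 * v) ^ (r - 1) * real r) * (a / real n ^ (r - 1))"
      using 1 2 p(1) by (intro mult_mono mult_left_mono) auto
    also have "\<dots> = (exp 1 * r * 2 ^ (r - 1) * a) * z ^ (r - 1)"
      by (simp add: z_def power_mult_distrib power_divide)
    also have "\<dots> \<le> B * z ^ (r - 1)" using z by (intro mult_right_mono) (auto simp: B)
    finally show "exp 1 * (real ((2 * v) ^ r) / real c) * p n \<le> B * z ^ (r - 1)" .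
  qed (use p in auto)
  also have "\<dots> = B ^ c * z ^ ((r - 1) * c)" by (simp add: power_mult_distrib power_mult)
  \<comment> \<open>The summand \<open>1\<close> in \<open>B\<close> gives \<open>B \<ge> 1\<close>;
    together with \<open>c \<le> 2 * v\<close> this makes the constant exponential in
    \<open>v\<close> alone.\<close>
  also have "\<dots> \<le> B ^ (2 * v) * z ^ ((r - 1) * c)"
    using B1 c z by (intro mult_right_mono power_increasing) auto
  finally have 1: "real ((2 * v) ^ r choose c) * p n ^ c \<le> B ^ (2 * v) * z ^ ((r - 1) * c)" .
  have 2: "real (n choose v) \<le> (exp 1 / z) ^ v"
    using real_binomial_le_exp[of v n] v by (simp add: z_def)
  have "real (n choose v) * (real ((2 * v) ^ r choose c) * p n ^ c)
      \<le> (exp 1 / z) ^ v * (B ^ (2 * v) * z ^ ((r - 1) * c))"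
    by (rule mult_mono[OF 2 1]) (use z p in auto)
  also have "\<dots> = (exp 1 * B\<^sup>2) ^ v * (z ^ ((r - 1) * c) / z ^ v)"
    by (simp add: power_mult power_mult_distrib power_divide)
  finally have "(real (n choose v) * (real ((2 * v) ^ r choose c) * p n ^ c)) ^ 3
      \<le> ((exp 1 * B\<^sup>2) ^ v * (z ^ ((r - 1) * c) / z ^ v)) ^ 3"
    using p by (intro power_mono) auto
  also have "\<dots> = ((exp 1 * B\<^sup>2) ^ 3) ^ v * (z ^ (3 * ((r - 1) * c)) / z ^ (3 * v))"
  proof -
    have "(X ^ v) ^ 3 = (X ^ 3) ^ v" "(X ^ k) ^ 3 = X ^ (3 * k)" for X :: real and k
      by (simp_all only: power_mult[symmetric] mult.commute)
    then show ?thesis by (simp only: power_mult_distrib power_divide)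
  qed
  \<comment> \<open>As \<open>z \<le> 1\<close>, the exponent may be lowered to
    \<open>4 * v\<close>; against \<open>3 * v\<close> from the cubed binomial a factor
    \<open>z ^ v\<close> survives.\<close>
  also have "\<dots> \<le> ((exp 1 * B\<^sup>2) ^ 3) ^ v * (z ^ (4 * v) / z ^ (3 * v))"
    using three_times_clauses[OF r c(2)] z by (intro mult_left_mono divide_right_mono power_decreasing) auto
  also have "z ^ (4 * v) / z ^ (3 * v) = z ^ v"
  proof -
    have "z ^ (4 * v) = z ^ v * z ^ (3 * v)" by (simp add: power_add[symmetric])
    then show ?thesis using z by simp
  qed
  finally show ?thesis by (simp only: power_mult_distrib z_def)
qed

lemma Pr_small_balanced:
  obtains \<epsilon> where "\<epsilon> > 0" and
    "\<And>s. s \<ge> 1 \<Longrightarrow> (\<lambda>n. Pr n (\<lambda>S. \<exists>G\<subseteq>S. balanced G \<and> 3 * s \<le> card (clause_vars G)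
        \<and> real (card (clause_vars G)) \<le> \<epsilon> * real n)) \<in> O(\<lambda>n. 1 / real n ^ s)"
proof -
  define B where "B = 1 + exp 1 * r * 2 ^ (r - 1) * a"
  define D where "D = (3 * (exp 1 * B\<^sup>2)) ^ 3"
  have B: "B > 0" using a by (simp add: B_def add_pos_nonneg)
  then have D: "D > 0" by (simp add: D_def)
  show thesis
  proof
    \<comment> \<open>With \<open>u ^ 3 = D * (v / n)\<close> below,
      \<open>v \<le> n / (8 * D)\<close> means \<open>u \<le> 1 / 2\<close>. This choice serves all
      \<open>s\<close> at once.\<close>
    show "1 / (8 * D) > 0" using D by simp
    fix s :: nat assume s: "s \<ge> 1"
    let ?\<epsilon> = "1 / (8 * D)"
    let ?ev = "\<lambda>n S. \<exists>G\<subseteq>S. balanced G \<and> 3 * s \<le> card (clause_vars G)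
        \<and> real (card (clause_vars G)) \<le> ?\<epsilon> * real n"
    let ?K = "(8 * D) ^ s * (fact s * 4 ^ s * (32 / 11))"
    have "(\<lambda>n. ?K * (1 / real n ^ s)) \<in> O(\<lambda>n. 1 / real n ^ s)"
      by (rule bigoI[of _ ?K]) (use D in \<open>simp add: abs_mult\<close>)
    moreover have "eventually (\<lambda>n. 0 \<le> Pr n (?ev n) \<and> Pr n (?ev n) \<le> ?K * (1 / real n ^ s)) sequentially"
      using p_eventually
    proof eventually_elim
      case (elim n)
      then have p: "0 \<le> p n" "p n \<le> 1" and n: "n \<ge> 1" by auto
      let ?vs = "{v. 3 * s \<le> v \<and> v \<le> n \<and> real v \<le> ?\<epsilon> * real n}"
      have finv: "finite ?vs" by (rule finite_subset[of _ "{..n}"]) auto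
      have "Pr n (?ev n) \<le> (\<Sum>v\<in>?vs. Pr n (\<lambda>S. \<exists>G\<subseteq>S. balanced G \<and> card (clause_vars G) = v))"
        unfolding Pr_def E_def
      proof (rule expect_union_bound[OF p finv])
        fix S assume S: "S \<subseteq> all_clauses r {..<n}" "?ev n S"
        then obtain G where G: "G \<subseteq> S" "balanced G" "3 * s \<le> card (clause_vars G)"
          "real (card (clause_vars G)) \<le> ?\<epsilon> * real n" by blast
        have "clause_vars G \<subseteq> {..<n}" using G(1) S(1) by (intro clause_vars_subset) auto
        then have "card (clause_vars G) \<le> n" using card_mono[of "{..<n}" "clause_vars G"] by simp
        then have "card (clause_vars G) \<in> ?vs" using G by simp
        then show "\<exists>v\<in>?vs. \<exists>G\<subseteq>S. balanced G \<and> card (clause_vars G) = v" using G by blast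
      qed
      also have "\<dots> \<le> (\<Sum>v\<in>?vs. (8 * D / real n) ^ s * (real v ^ s * (1 / 2) ^ v))"
      proof (rule sum_mono)
        fix v assume "v \<in> ?vs"
        then have v: "3 * s \<le> v" "v \<le> n" "real v \<le> ?\<epsilon> * real n" "1 \<le> v" using s by auto
        let ?Cs = "{c. c \<le> 2 * v \<and> 2 * v \<le> r * c}"
        \<comment> \<open>Each summand is at most \<open>w ^ v\<close>, and the factor
          \<open>3\<close> in \<open>u\<close> absorbs the number of summands, as
          \<open>1 + 2 * v \<le> 3 ^ v\<close>.\<close>
        define w where "w = root 3 ((exp 1 * B\<^sup>2) ^ 3 * (real v / real n))"
        define u where "u = 3 * w"
        have w0: "w \<ge> 0" unfolding w_def using B by simp
        have w3: "w ^ 3 = (exp 1 * B\<^sup>2) ^ 3 * (real v / real n)" unfolding w_def using B by (intro real_root_pow_pos2) auto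
        have u3: "u ^ 3 = D * (real v / real n)"
          unfolding u_def D_def power_mult_distrib[of 3] w3 by simp
        have u0: "u \<ge> 0" using w0 by (simp add: u_def)
        have uhalf: "u \<le> 1 / 2"
        proof (rule power_le_imp_le_base[where n=2])
          have "D * (real v / real n) \<le> D * ?\<epsilon>"
            using v(3) n D by (intro mult_left_mono) (auto simp: field_simps)
          also have "\<dots> = (1 / 2) ^ 3" using D by (simp add: power3_eq_cube)
          finally have "u ^ 3 \<le> (1 / 2) ^ 3" unfolding u3 .
          moreover have "Suc 2 = 3" by simp
          ultimately show "u ^ Suc 2 \<le> (1 / 2) ^ Suc 2" by metis
        qed simp
        have term_le: "real (n choose v) * (real ((2 * v) ^ r choose c) * p n ^ c) \<le> w ^ v" if "c \<in> ?Cs" for c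
        proof (rule power_le_imp_le_base[where n=2])
          have "(real (n choose v) * (real ((2 * v) ^ r choose c) * p n ^ c)) ^ 3 \<le> (w ^ 3) ^ v"
            unfolding w3 by (rule clause_count_term_le) (use v that p elim in \<open>auto simp: B_def\<close>)
          also have "\<dots> = (w ^ v) ^ 3" by (simp only: power_mult[symmetric] mult.commute)
          finally show "(real (n choose v) * (real ((2 * v) ^ r choose c) * p n ^ c)) ^ Suc 2 \<le> (w ^ v) ^ Suc 2"
            by (simp only: numeral_3_eq_3 numeral_2_eq_2)
        qed (use w0 in simp)
        have "card ?Cs \<le> card {..2 * v}" by (intro card_mono) auto
        then have cC: "real (card ?Cs) \<le> 1 + 2 * real v" by simp
        have "Pr n (\<lambda>S. \<exists>G\<subseteq>S. balanced G \<and> card (clause_vars G) = v)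
            \<le> (\<Sum>c\<in>?Cs. real (n choose v) * (real ((2 * v) ^ r choose c) * p n ^ c))"
          using Pr_balanced_size_le[OF p, of v] by (simp add: sum_distrib_left)
        also have "\<dots> \<le> real (card ?Cs) * w ^ v"
          using sum_bounded_above[of ?Cs, OF term_le] by simp
        also have "\<dots> \<le> (1 + 2) ^ v * w ^ v"
        proof (intro mult_right_mono)
          have "1 + real v * 2 \<le> (1 + 2) ^ v" by (rule Bernoulli_inequality) simp
          then show "real (card ?Cs) \<le> (1 + 2) ^ v" using cC by linarith
        qed (use w0 in simp)
        also have "\<dots> = u ^ v" by (simp add: u_def power_mult_distrib)
        \<comment> \<open>Three factors \<open>u\<close> are worth one factor
          \<open>D * v / n\<close>: the first \<open>3 * s\<close> of them give the decay
          \<open>1 / n ^ s\<close>, and the rest, each at most \<open>1 / 2\<close>, make the sum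
          over \<open>v\<close> converge.\<close>
        also have "\<dots> = (u ^ 3) ^ s * u ^ (v - 3 * s)"
          using v(1) by (simp only: power_mult[symmetric] power_add[symmetric]) simp
        also have "\<dots> \<le> (u ^ 3) ^ s * (1 / 2) ^ (v - 3 * s)"
          using u0 uhalf by (intro mult_left_mono power_mono) auto
        also have "(1 / 2 :: real) ^ (v - 3 * s) = 8 ^ s * (1 / 2) ^ v"
        proof -
          have "(1 / 2 :: real) ^ v = (1 / 2) ^ (v - 3 * s) * (1 / 2) ^ (3 * s)"
            using v(1) by (simp only: power_add[symmetric]) simp
          also have "(1 / 2 :: real) ^ (3 * s) = (1 / 8) ^ s" by (simp add: power_mult power3_eq_cube)
          finally show ?thesis by (simp add: power_divide)
        qed
        also have "(u ^ 3) ^ s * (8 ^ s * (1 / 2) ^ v) = (8 * D / real n) ^ s * (real v ^ s * (1 / 2) ^ v)"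
          unfolding u3 by (simp add: power_mult_distrib power_divide)
        finally show "Pr n (\<lambda>S. \<exists>G\<subseteq>S. balanced G \<and> card (clause_vars G) = v)
          \<le> (8 * D / real n) ^ s * (real v ^ s * (1 / 2) ^ v)" .
      qed
      also have "\<dots> = (8 * D / real n) ^ s * (\<Sum>v\<in>?vs. real v ^ s * (1 / 2) ^ v)"
        by (simp only: sum_distrib_left)
      also have "\<dots> \<le> (8 * D / real n) ^ s * (fact s * 4 ^ s * (32 / 11))"
        using D by (intro mult_left_mono sum_power_geometric_le finv) auto
      also have "\<dots> = ?K * (1 / real n ^ s)" by (simp add: power_divide)
      finally show ?case using Pr_nonneg[OF p] by auto
    qed
    ultimately show "(\<lambda>n. Pr n (?ev n)) \<in> O(\<lambda>n. 1 / real n ^ s)" by (rule bigo_mono)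
  qed
qed

lemma Pr_balanced:
  assumes "s \<ge> 1"
  shows "(\<lambda>n. Pr n (\<lambda>S. \<exists>G\<subseteq>S. balanced G \<and> 3 * s \<le> card (clause_vars G))) \<in> O(\<lambda>n. 1 / real n ^ s)"
proof -
  obtain \<epsilon> where \<epsilon>: "\<epsilon> > 0" and small: "(\<lambda>n. Pr n (\<lambda>S. \<exists>G\<subseteq>S. balanced G \<and> 3 * s \<le> card (clause_vars G)
        \<and> real (card (clause_vars G)) \<le> \<epsilon> * real n)) \<in> O(\<lambda>n. 1 / real n ^ s)" (is "?f \<in> _")
    by (rule Pr_small_balanced) (use assms in blast)
  let ?g = "\<lambda>n. Pr n (\<lambda>S. \<exists>G\<subseteq>S. balanced G \<and> real (card (clause_vars G)) \<ge> \<epsilon> * real n)"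
  let ?h = "\<lambda>n. Pr n (\<lambda>S. \<exists>G\<subseteq>S. balanced G \<and> 3 * s \<le> card (clause_vars G))"
  have "(\<lambda>n. ?f n + ?g n) \<in> O(\<lambda>n. 1 / real n ^ s)"
    by (intro sum_in_bigo small Pr_large_balanced \<epsilon>)
  moreover have "eventually (\<lambda>n. 0 \<le> ?h n \<and> ?h n \<le> ?f n + ?g n) sequentially"
    using p_eventually
  proof eventually_elim
    case (elim n)
    then have p: "0 \<le> p n" "p n \<le> 1" by auto
    have "?h n \<le> ?f n + ?g n"
      unfolding Pr_def E_def expect_add[symmetric]
    proof (rule expect_mono[OF p])
      fix S :: "nat clause set"
      let ?A = "\<exists>G\<subseteq>S. balanced G \<and> 3 * s \<le> card (clause_vars G)"
      let ?B = "\<exists>G\<subseteq>S. balanced G \<and> 3 * s \<le> card (clause_vars G) \<and> real (card (clause_vars G)) \<le> \<epsilon> * real n"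
      let ?C = "\<exists>G\<subseteq>S. balanced G \<and> real (card (clause_vars G)) \<ge> \<epsilon> * real n"
      show "of_bool ?A \<le> (of_bool ?B + of_bool ?C :: real)"
      proof (rule of_bool_le_add)
        assume ?A
        then obtain G where G: "G \<subseteq> S" "balanced G" "3 * s \<le> card (clause_vars G)" by blast
        show "?B \<or> ?C"
        proof (cases "real (card (clause_vars G)) \<le> \<epsilon> * real n")
          case True
          with G show ?thesis by blast
        next
          case False
          then have "\<epsilon> * real n \<le> real (card (clause_vars G))" by simp
          with G show ?thesis by blast
        qed
      qed
    qed
    then show ?case using Pr_nonneg[OF p] by simp
  qed
  ultimately show ?thesis by (rule bigo_mono)
qed

end

section \<open>Moebius inversion over balanced subformulae\<close>

definition rename_clauses :: "('v \<Rightarrow> 'w) \<Rightarrow> 'v clause set \<Rightarrow> 'w clause set" where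
  "rename_clauses \<pi> S = (\<lambda>C. map_prod \<pi> id ` C) ` S"

lemma Union_rename_clauses: "\<Union>(rename_clauses \<pi> S) = map_prod \<pi> id ` \<Union>S"
  by (auto simp: rename_clauses_def)

lemma clause_vars_rename: "clause_vars (rename_clauses \<pi> S) = \<pi> ` clause_vars S"
  unfolding clause_vars_def Union_rename_clauses by (simp add: image_image)

lemma rename_clauses_comp: "rename_clauses \<rho> (rename_clauses \<pi> S) = rename_clauses (\<rho> \<circ> \<pi>) S"
  by (simp add: rename_clauses_def image_image map_prod_def case_prod_unfold)

lemma rename_clauses_ident:
  assumes "\<And>v. v \<in> clause_vars S \<Longrightarrow> \<pi> v = v"
  shows "rename_clauses \<pi> S = S"
proof -
  have "map_prod \<pi> id ` C = C" if "C \<in> S" for C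
  proof -
    have "map_prod \<pi> id l = l" if "l \<in> C" for l
    proof -
      have "fst l \<in> clause_vars S" unfolding clause_vars_def using that \<open>C \<in> S\<close> by blast
      then show ?thesis using assms[of "fst l"] by (cases l) simp
    qed
    then show ?thesis by simp
  qed
  then show ?thesis by (simp add: rename_clauses_def)
qed

lemma rename_clauses_inverse:
  assumes "S \<subseteq> all_clauses r V" "inj_on \<pi> V"
  shows "rename_clauses (inv_into V \<pi>) (rename_clauses \<pi> S) = S"
  unfolding rename_clauses_comp
  using clause_vars_subset[OF assms(1)] assms(2) by (intro rename_clauses_ident) auto

lemma rename_all_clauses:
  assumes "S \<subseteq> all_clauses r V" "inj_on \<pi> V"
  shows "rename_clauses \<pi> S \<subseteq> all_clauses r (\<pi> ` V)"
proof
  fix D assume "D \<in> rename_clauses \<pi> S"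
  then obtain C where D: "D = map_prod \<pi> id ` C" and C: "C \<in> all_clauses r V"
    using assms(1) by (auto simp: rename_clauses_def)
  have CV: "C \<subseteq> V \<times> UNIV" and inj: "inj_on fst C" and card: "card C = r"
    using C by (auto simp: all_clauses_def)
  have "fst ` C \<subseteq> V" using CV by auto
  then have "inj_on (\<pi> \<circ> fst) C"
    using inj inj_on_subset[OF assms(2)] by (intro comp_inj_on)
  moreover have "fst \<circ> map_prod \<pi> id = \<pi> \<circ> (fst :: 'a \<times> bool \<Rightarrow> 'a)" by auto
  ultimately have "inj_on (fst \<circ> map_prod \<pi> (id :: bool \<Rightarrow> bool)) C" by metis
  then have "inj_on fst D" "inj_on (map_prod \<pi> (id :: bool \<Rightarrow> bool)) C"
    unfolding D by (rule inj_on_imageI, rule inj_on_imageI2)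
  moreover have "D \<subseteq> \<pi> ` V \<times> UNIV" using CV by (auto simp: D)
  ultimately show "D \<in> all_clauses r (\<pi> ` V)"
    using card by (simp add: all_clauses_def D card_image)
qed

lemma inj_on_rename_clauses:
  assumes "inj_on \<pi> V"
  shows "inj_on (rename_clauses \<pi>) (Pow (all_clauses r V))"
  by (rule inj_on_inverseI[where g="rename_clauses (inv_into V \<pi>)"])
    (use rename_clauses_inverse[OF _ assms, of _ r] in blast)

lemma card_rename_clauses:
  assumes "S \<subseteq> all_clauses r V" "inj_on \<pi> V" "finite V"
  shows "card (rename_clauses \<pi> S) = card S"
proof (rule antisym)
  have fin: "finite S" using assms finite_all_clauses finite_subset by metis
  then show "card (rename_clauses \<pi> S) \<le> card S" unfolding rename_clauses_def by (rule card_image_le)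
  have "card (rename_clauses (inv_into V \<pi>) (rename_clauses \<pi> S)) \<le> card (rename_clauses \<pi> S)"
    using fin unfolding rename_clauses_def by (intro card_image_le) simp
  then show "card S \<le> card (rename_clauses \<pi> S)" unfolding rename_clauses_inverse[OF assms(1,2)] .
qed

lemma rename_clauses_mono: "S \<subseteq> T \<Longrightarrow> rename_clauses \<pi> S \<subseteq> rename_clauses \<pi> T"
  by (auto simp: rename_clauses_def)

lemma balanced_rename: "balanced S \<Longrightarrow> balanced (rename_clauses \<pi> S)"
proof -
  assume S: "balanced S"
  have "neg (map_prod \<pi> id l) = map_prod \<pi> id (neg l)" for l :: "'a \<times> bool"
    by (cases l) (simp add: neg_def)
  then have "neg ` \<Union>(rename_clauses \<pi> S) = map_prod \<pi> id ` (neg ` \<Union>S)"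
    unfolding Union_rename_clauses by (simp add: image_image)
  also have "\<dots> \<subseteq> \<Union>(rename_clauses \<pi> S)"
    unfolding Union_rename_clauses using S by (intro image_mono) (simp add: balanced_def)
  finally show ?thesis by (simp add: balanced_def)
qed

section \<open>Events determined by the largest balanced subset\<close>

text \<open>The common interface of the three events. \<open>Q_pure\<close> lets clauses with a pure
  literal be dropped one by one. Renaming is assumed in one direction only, the converse being the
  same statement for the inverse renaming.\<close>

locale core_event =
  fixes r :: nat and Q :: "nat clause set \<Rightarrow> bool"
  assumes r: "r \<ge> 3" and Q_empty: "\<not> Q {}"
    and Q_pure: "\<And>S V C l. finite V \<Longrightarrow> S \<subseteq> all_clauses r V \<Longrightarrow> C \<in> S \<Longrightarrow> l \<in> C \<Longrightarrow> neg l \<notin> \<Union>S \<Longrightarrow> Q S = Q (S - {C})"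
    and Q_rename_imp: "\<And>S V \<pi>. finite V \<Longrightarrow> S \<subseteq> all_clauses r V \<Longrightarrow> inj_on \<pi> V \<Longrightarrow> Q S \<Longrightarrow> Q (rename_clauses \<pi> S)"
begin

lemma Q_rename:
  assumes "finite V" "S \<subseteq> all_clauses r V" "inj_on \<pi> V"
  shows "Q (rename_clauses \<pi> S) = Q S"
proof
  assume "Q (rename_clauses \<pi> S)"
  from Q_rename_imp[OF finite_imageI[OF assms(1)] rename_all_clauses[OF assms(2,3)] inj_on_inv_into[OF order_refl] this]
  have "Q (rename_clauses (inv_into V \<pi>) (rename_clauses \<pi> S))" .
  then show "Q S" unfolding rename_clauses_inverse[OF assms(2,3)] .
qed (rule Q_rename_imp[OF assms])

text \<open>The two signs multiply to the Moebius function of the subset lattice; keeping them apart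
  fits \<open>inclusion_exclusion_symmetric\<close>.\<close>

definition weight :: "nat clause set \<Rightarrow> int" where
  "weight S = (-1) ^ card S * (\<Sum>T\<in>Pow S. (-1) ^ card T * of_bool (Q T))"

lemma sum_weight: "finite S \<Longrightarrow> (\<Sum>G\<in>Pow S. weight G) = of_bool (Q S)"
  unfolding weight_def
  by (rule inclusion_exclusion_symmetric[symmetric, where f="\<lambda>T. of_bool (Q T)"]) auto

lemma weight_empty [simp]: "weight {} = 0"
  by (simp add: weight_def Q_empty)

text \<open>If \<open>C\<close> contains a pure literal of \<open>S\<close>, then subsets of \<open>S\<close> that differ only by \<open>C\<close> cancel.\<close>

lemma weight_unbalanced:
  assumes "finite V" "S \<subseteq> all_clauses r V" "\<not> balanced S"
  shows "weight S = 0"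
proof -
  obtain l C where C: "C \<in> S" "l \<in> C" "neg l \<notin> \<Union>S"
    using assms(3) unfolding balanced_def by blast
  have fin: "finite S" using assms finite_all_clauses finite_subset by metis
  define R where "R = S - {C}"
  have S: "S = insert C R" and CR: "C \<notin> R" and finR: "finite R" using C fin by (auto simp: R_def)
  have inj: "inj_on (insert C) (Pow R)" using CR by (auto simp: inj_on_def)
  have "(\<Sum>T\<in>Pow S. (-1) ^ card T * of_bool (Q T) :: int)
      = (\<Sum>T\<in>Pow R. (-1) ^ card T * of_bool (Q T)) + (\<Sum>T\<in>insert C ` Pow R. (-1) ^ card T * of_bool (Q T))"
    unfolding S Pow_insert using CR finR by (intro sum.union_disjoint) auto
  also have "(\<Sum>T\<in>insert C ` Pow R. (-1) ^ card T * of_bool (Q T) :: int)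
      = (\<Sum>T\<in>Pow R. (-1) ^ card (insert C T) * of_bool (Q (insert C T)))"
    by (simp add: sum.reindex[OF inj])
  also have "\<dots> = (\<Sum>T\<in>Pow R. - ((-1) ^ card T * of_bool (Q T)))"
  proof (rule sum.cong[OF refl])
    fix T assume T: "T \<in> Pow R"
    then have "card (insert C T) = Suc (card T)" using CR finR finite_subset by (subst card_insert_disjoint) auto
    \<comment> \<open>The literal \<open>l\<close> is pure in all of \<open>S\<close>, hence also in
      every subset that contains \<open>C\<close>.\<close>
    moreover have "Q (insert C T) = Q (insert C T - {C})"
      using T C assms S by (intro Q_pure[of V _ C l]) auto
    moreover have "insert C T - {C} = T" using T CR by auto
    ultimately show "(-1) ^ card (insert C T) * of_bool (Q (insert C T)) = (- ((-1) ^ card T * of_bool (Q T)) :: int)"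
      by simp
  qed
  finally show ?thesis by (simp add: weight_def sum_negf)
qed

lemma weight_rename:
  assumes "finite V" "S \<subseteq> all_clauses r V" "inj_on \<pi> V"
  shows "weight (rename_clauses \<pi> S) = weight S"
proof -
  have sub: "T \<subseteq> all_clauses r V" if "T \<in> Pow S" for T using that assms(2) by auto
  have Pow: "Pow (rename_clauses \<pi> S) = rename_clauses \<pi> ` Pow S"
    unfolding rename_clauses_def by (rule image_Pow_surj[symmetric, OF refl])
  have inj: "inj_on (rename_clauses \<pi>) (Pow S)"
    using inj_on_rename_clauses[OF assms(3), of r] by (rule inj_on_subset) (use assms(2) in auto)
  have "(\<Sum>T\<in>Pow (rename_clauses \<pi> S). (-1) ^ card T * of_bool (Q T) :: int)
      = (\<Sum>T\<in>Pow S. (-1) ^ card (rename_clauses \<pi> T) * of_bool (Q (rename_clauses \<pi> T)))"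
    unfolding Pow by (simp add: sum.reindex[OF inj])
  also have "\<dots> = (\<Sum>T\<in>Pow S. (-1) ^ card T * of_bool (Q T))"
    using card_rename_clauses[OF sub assms(3,1)] Q_rename[OF assms(1) sub assms(3)]
    by (intro sum.cong refl) simp
  finally show ?thesis unfolding weight_def card_rename_clauses[OF assms(2,3,1)] by simp
qed

lemma abs_weight_le: "finite S \<Longrightarrow> \<bar>weight S\<bar> \<le> 2 ^ card S"
proof -
  assume S: "finite S"
  have "\<bar>weight S\<bar> = \<bar>\<Sum>T\<in>Pow S. (-1) ^ card T * of_bool (Q T)\<bar>"
    by (simp add: weight_def abs_mult power_abs)
  also have "\<dots> \<le> (\<Sum>T\<in>Pow S. \<bar>(-1) ^ card T * of_bool (Q T)\<bar>)"
    by (rule sum_abs)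
  also have "\<dots> \<le> (\<Sum>T\<in>Pow S. 1)" by (intro sum_mono) (simp add: abs_mult power_abs)
  finally show ?thesis using S by (simp add: card_Pow)
qed

section \<open>The truncated Moebius sum and its error\<close>

definition small_full :: "nat \<Rightarrow> nat \<Rightarrow> nat clause set set" where
  "small_full n M = {G. G \<subseteq> all_clauses r {..<n} \<and> balanced G \<and> G \<noteq> {} \<and> card (clause_vars G) < M}"

definition large_core :: "nat \<Rightarrow> nat clause set \<Rightarrow> bool" where
  "large_core k S \<longleftrightarrow> (\<exists>G\<subseteq>S. balanced G \<and> k \<le> card (clause_vars G))"

definition approx :: "nat \<Rightarrow> nat \<Rightarrow> nat clause set \<Rightarrow> real" where
  "approx n M S = (\<Sum>G\<in>small_full n M. of_int (weight G) * of_bool (G \<subseteq> S))"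

lemma finite_small_full: "finite (small_full n M)"
  by (rule finite_subset[of _ "Pow (all_clauses r {..<n})"]) (auto simp: small_full_def finite_all_clauses)

lemma approx_eq: "approx n M S = (\<Sum>G\<in>{G \<in> small_full n M. G \<subseteq> S}. of_int (weight G))"
  unfolding approx_def using finite_small_full
  by (simp add: sum.inter_filter[symmetric] of_bool_def if_distrib cong: if_cong)

lemma subset_all_clauses_vars:
  assumes "G \<subseteq> all_clauses r V"
  shows "G \<subseteq> all_clauses r (clause_vars G)"
proof
  fix C assume C: "C \<in> G"
  have "C \<subseteq> clause_vars G \<times> UNIV"
  proof
    fix l assume "l \<in> C"
    then have "fst l \<in> clause_vars G" unfolding clause_vars_def using C by blast
    then show "l \<in> clause_vars G \<times> UNIV" by (simp add: mem_Times_iff)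
  qed
  with C assms show "C \<in> all_clauses r (clause_vars G)" by (auto simp: all_clauses_def)
qed

lemma card_le_clause_vars:
  assumes "G \<subseteq> all_clauses r V" "finite V"
  shows "card G \<le> (2 * card (clause_vars G)) ^ r"
proof -
  have fin: "finite (clause_vars G)" using clause_vars_subset[OF assms(1)] assms(2) by (rule finite_subset)
  have "card G \<le> card (all_clauses r (clause_vars G))"
    using subset_all_clauses_vars[OF assms(1)] finite_all_clauses[OF fin] by (rule card_mono[rotated])
  also have "\<dots> \<le> (2 * card (clause_vars G)) ^ r" by (rule card_all_clauses[OF fin])
  finally show ?thesis .
qed

text \<open>The full Moebius sum over \<open>Pow S\<close> has nonzero terms only at nonempty
  balanced sets, and without a large core the truncation keeps all of those.\<close>

lemma approx_exact:
  assumes "S \<subseteq> all_clauses r {..<n}" "\<not> large_core M S"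
  shows "approx n M S = of_bool (Q S)"
proof -
  have fin: "finite S" using assms finite_all_clauses finite_subset by (metis finite_lessThan)
  have "(\<Sum>G\<in>{G \<in> small_full n M. G \<subseteq> S}. weight G) = (\<Sum>G\<in>Pow S. weight G)"
  proof (rule sum.mono_neutral_left)
    show "\<forall>G\<in>Pow S - {G \<in> small_full n M. G \<subseteq> S}. weight G = 0"
    proof
      fix G assume G: "G \<in> Pow S - {G \<in> small_full n M. G \<subseteq> S}"
      then have GI: "G \<subseteq> all_clauses r {..<n}" using assms(1) by auto
      show "weight G = 0"
      proof (cases "balanced G")
        case True
        then have "card (clause_vars G) < M" using assms(2) G by (auto simp: large_core_def not_le)
        then have "G = {}" using G True GI by (auto simp: small_full_def)
        then show ?thesis by simp
      qed (rule weight_unbalanced[OF _ GI], auto)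
    qed
  qed (use fin in auto)
  also have "\<dots> = of_bool (Q S)" by (rule sum_weight[OF fin])
  finally show ?thesis unfolding approx_eq of_int_sum[symmetric] by simp
qed

lemma approx_error:
  fixes K :: nat
  assumes S: "S \<subseteq> all_clauses r {..<n}"
    and K: "card {G \<in> small_full n M. G \<subseteq> S} \<le> K"
  shows "\<bar>of_bool (Q S) - approx n M S\<bar> \<le> 1 + real K * 2 ^ ((2 * M) ^ r)"
proof -
  have "\<bar>approx n M S\<bar> \<le> (\<Sum>G\<in>{G \<in> small_full n M. G \<subseteq> S}. \<bar>of_int (weight G)\<bar>)"
    unfolding approx_eq by (rule sum_abs)
  also have "\<dots> \<le> (\<Sum>G\<in>{G \<in> small_full n M. G \<subseteq> S}. 2 ^ ((2 * M) ^ r))"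
  proof (rule sum_mono)
    fix G assume "G \<in> {G \<in> small_full n M. G \<subseteq> S}"
    then have G: "G \<subseteq> all_clauses r {..<n}" "card (clause_vars G) < M" by (auto simp: small_full_def)
    have fin: "finite G" using G finite_all_clauses finite_subset by (metis finite_lessThan)
    have "card G \<le> (2 * card (clause_vars G)) ^ r" using G by (intro card_le_clause_vars) auto
    also have "\<dots> \<le> (2 * M) ^ r" using G by (intro power_mono) auto
    finally have "(2 :: int) ^ card G \<le> 2 ^ ((2 * M) ^ r)" by (intro power_increasing) auto
    then have "\<bar>weight G\<bar> \<le> 2 ^ ((2 * M) ^ r)" using abs_weight_le[OF fin] by linarith
    then have "real_of_int \<bar>weight G\<bar> \<le> real_of_int (2 ^ ((2 * M) ^ r))" by (simp only: of_int_le_iff)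
    then show "\<bar>real_of_int (weight G)\<bar> \<le> 2 ^ ((2 * M) ^ r)" by simp
  qed
  also have "\<dots> \<le> real K * 2 ^ ((2 * M) ^ r)" using K by simp
  finally have "\<bar>approx n M S\<bar> \<le> real K * 2 ^ ((2 * M) ^ r)" .
  moreover have "\<bar>of_bool (Q S) :: real\<bar> \<le> 1" by simp
  ultimately show ?thesis by linarith
qed

text \<open>All balanced subsets of \<open>S\<close> lie in the largest one, \<open>H\<close>. It
  has fewer than \<open>L\<close> variables, hence a bounded number of clauses and of
  subsets.\<close>

lemma card_small_full_subsets:
  assumes S: "S \<subseteq> all_clauses r {..<n}" and "\<not> large_core L S"
  shows "card {G \<in> small_full n M. G \<subseteq> S} \<le> 2 ^ ((2 * L) ^ r)"
proof -
  define H where "H = \<Union>{G. G \<subseteq> S \<and> balanced G}"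
  have H: "H \<subseteq> S" "balanced H" unfolding H_def by (auto intro: balanced_Union)
  then have HI: "H \<subseteq> all_clauses r {..<n}" using S by auto
  have finH: "finite H" using HI finite_all_clauses finite_subset by (metis finite_lessThan)
  have "card (clause_vars H) < L" using assms(2) H by (auto simp: large_core_def not_le)
  then have "(2 * card (clause_vars H)) ^ r \<le> (2 * L) ^ r" by (intro power_mono) auto
  with card_le_clause_vars[OF HI finite_lessThan] have "card H \<le> (2 * L) ^ r" by (rule order_trans)
  then have le: "2 ^ card H \<le> (2 :: nat) ^ ((2 * L) ^ r)" by (intro power_increasing) auto
  have "card {G \<in> small_full n M. G \<subseteq> S} \<le> card (Pow H)"
    using finH by (intro card_mono) (auto simp: H_def small_full_def)
  also have "\<dots> = 2 ^ card H" using finH by (simp add: card_Pow)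
  also note le
  finally show ?thesis .
qed

lemma card_small_full:
  assumes "n \<ge> 1"
  shows "card (small_full n M) \<le> M * n ^ M * 2 ^ ((2 * M) ^ r)"
proof -
  let ?W = "\<lambda>v. {W. W \<subseteq> {..<n} \<and> card W = v}"
  have finW: "finite W" if "W \<in> ?W v" for W v using that finite_subset[of W "{..<n}"] by auto
  have sub: "small_full n M \<subseteq> (\<Union>v\<in>{..<M}. \<Union>W\<in>?W v. Pow (all_clauses r W))"
  proof
    fix G assume "G \<in> small_full n M"
    then have G: "G \<subseteq> all_clauses r {..<n}" "card (clause_vars G) < M" by (auto simp: small_full_def)
    then have "clause_vars G \<in> ?W (card (clause_vars G))" "G \<in> Pow (all_clauses r (clause_vars G))"
      using clause_vars_subset[OF G(1)] subset_all_clauses_vars[OF G(1)] by simp_all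
    then have "G \<in> (\<Union>W\<in>?W (card (clause_vars G)). Pow (all_clauses r W))" by (rule UN_I)
    with G(2) show "G \<in> (\<Union>v\<in>{..<M}. \<Union>W\<in>?W v. Pow (all_clauses r W))" by (intro UN_I[of "card (clause_vars G)"]) simp_all
  qed
  have "card (small_full n M) \<le> card (\<Union>v\<in>{..<M}. \<Union>W\<in>?W v. Pow (all_clauses r W))"
  proof (rule card_mono[OF _ sub])
    have "finite (Pow (all_clauses r W))" if "W \<in> ?W v" for W v
      using finite_all_clauses[OF finW[OF that], of r] by simp
    then show "finite (\<Union>v\<in>{..<M}. \<Union>W\<in>?W v. Pow (all_clauses r W))" by (intro finite_UN_I) simp_all
  qed
  also have "\<dots> \<le> (\<Sum>v\<in>{..<M}. card (\<Union>W\<in>?W v. Pow (all_clauses r W)))" by (rule card_UN_le) simp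
  also have "\<dots> \<le> (\<Sum>v\<in>{..<M}. n ^ M * 2 ^ ((2 * M) ^ r))"
  proof (rule sum_mono)
    fix v assume v: "v \<in> {..<M}"
    have "card (\<Union>W\<in>?W v. Pow (all_clauses r W)) \<le> (\<Sum>W\<in>?W v. card (Pow (all_clauses r W)))"
      by (rule card_UN_le) simp
    also have "\<dots> \<le> (\<Sum>W\<in>?W v. 2 ^ ((2 * M) ^ r))"
    proof (rule sum_mono)
      fix W assume W: "W \<in> ?W v"
      have "card (all_clauses r W) \<le> (2 * v) ^ r" using card_all_clauses[OF finW[OF W], of r] W by simp
      also have "\<dots> \<le> (2 * M) ^ r" using v by (intro power_mono) auto
      finally show "card (Pow (all_clauses r W)) \<le> 2 ^ ((2 * M) ^ r)"
        using finite_all_clauses[OF finW[OF W]] by (simp add: card_Pow)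
    qed
    also have "\<dots> = (n choose v) * 2 ^ ((2 * M) ^ r)" by (simp add: n_subsets)
    also have "\<dots> \<le> n ^ M * 2 ^ ((2 * M) ^ r)"
    proof (rule mult_right_mono)
      have "(n choose v) * 1 \<le> (n choose v) * fact v" by (rule mult_left_mono) (auto simp: fact_ge_1)
      also have "\<dots> \<le> n ^ v" by (rule binomial_fact_pow)
      also have "\<dots> \<le> n ^ M" using v assms by (intro power_increasing) auto
      finally show "n choose v \<le> n ^ M" by simp
    qed simp
    finally show "card (\<Union>W\<in>?W v. Pow (all_clauses r W)) \<le> n ^ M * 2 ^ ((2 * M) ^ r)" .
  qed
  also have "\<dots> = M * n ^ M * 2 ^ ((2 * M) ^ r)" by simp
  finally show ?thesis .
qed

text \<open>Three regimes: exactness below \<open>M\<close>; a bounded error while the core stays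
  below \<open>L\<close>; and the crude bound of order \<open>n ^ M\<close> beyond, to be outweighed
  by a large choice of \<open>L\<close>.\<close>

lemma approx_error_split:
  assumes S: "S \<subseteq> all_clauses r {..<n}" and n: "n \<ge> 1"
  shows "\<bar>of_bool (Q S) - approx n M S\<bar>
    \<le> (1 + 2 ^ ((2 * L) ^ r) * 2 ^ ((2 * M) ^ r)) * of_bool (large_core M S)
     + (1 + M * 2 ^ ((2 * M) ^ r) * 2 ^ ((2 * M) ^ r)) * real n ^ M * of_bool (large_core L S)"
    (is "_ \<le> ?A * _ + ?B * _ * _")
proof -
  have pos: "?A \<ge> 0" "?B * real n ^ M \<ge> 0" by auto
  consider "\<not> large_core M S" | "large_core M S" "\<not> large_core L S" | "large_core L S" by blast
  then show ?thesis
  proof cases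
    case 1
    then show ?thesis using approx_exact[OF S 1] pos by simp
  next
    case 2
    then show ?thesis using approx_error[OF S card_small_full_subsets[OF S 2(2)], of M] by simp
  next
    case 3
    have "card {G \<in> small_full n M. G \<subseteq> S} \<le> card (small_full n M)"
      by (intro card_mono finite_small_full) auto
    also have "\<dots> \<le> M * n ^ M * 2 ^ ((2 * M) ^ r)" by (rule card_small_full[OF n])
    finally have "\<bar>of_bool (Q S) - approx n M S\<bar> \<le> 1 + real (M * n ^ M * 2 ^ ((2 * M) ^ r)) * 2 ^ ((2 * M) ^ r)"
      by (rule approx_error[OF S])
    also have "\<dots> = 1 + (M * 2 ^ ((2 * M) ^ r) * 2 ^ ((2 * M) ^ r)) * real n ^ M" by simp
    also have "\<dots> \<le> ?B * real n ^ M"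
      using n by (simp add: distrib_right)
    finally have "\<bar>of_bool (Q S) - approx n M S\<bar> \<le> ?B * real n ^ M" .
    moreover have "0 \<le> ?A * of_bool (large_core M S)" using pos by simp
    moreover have "?B * real n ^ M * of_bool (large_core L S) = ?B * real n ^ M" using 3 by simp
    ultimately show ?thesis by linarith
  qed
qed

section \<open>The expectation of the truncated sum\<close>

text \<open>Because weights are invariant under renaming, this is also the total for any other
  variable set of size \<open>v\<close>.\<close>

definition shape_weight :: "nat \<Rightarrow> nat \<Rightarrow> int" where
  "shape_weight v c = (\<Sum>G\<in>{G. G \<subseteq> all_clauses r {..<v} \<and> balanced G \<and> clause_vars G = {..<v} \<and> card G = c}. weight G)"

text \<open>Some balanced \<open>G\<close> of this shape exists, and its \<open>c\<close> clauses
  with \<open>r\<close> literals each must cover all \<open>2 * v\<close> literals.\<close>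

lemma shape_weight_nonzero:
  assumes "shape_weight v c \<noteq> 0"
  shows "2 * v \<le> r * c" "c \<le> (2 * v) ^ r"
proof -
  have "{G. G \<subseteq> all_clauses r {..<v} \<and> balanced G \<and> clause_vars G = {..<v} \<and> card G = c} \<noteq> {}"
    using assms unfolding shape_weight_def by (metis sum.empty)
  then obtain G where G: "G \<subseteq> all_clauses r {..<v}" "balanced G" "clause_vars G = {..<v}" "card G = c"
    by blast
  have fin: "finite G" using G finite_all_clauses finite_subset by (metis finite_lessThan)
  have C: "finite C \<and> card C = r" if "C \<in> G" for C
    using that G(1) finite_clause[of C r "{..<v}"] card_clause[of C r "{..<v}"] by auto
  have "2 * v = card (\<Union>G)" using card_Union_balanced[OF G(2)] fin C G(3) by simp
  also have "\<dots> \<le> (\<Sum>C\<in>G. card C)" using card_UN_le[OF fin, of id] by simp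
  also have "\<dots> = r * c" using C G(4) by simp
  finally show "2 * v \<le> r * c" .
  show "c \<le> (2 * v) ^ r" using card_le_clause_vars[OF G(1)] G(3,4) by simp
qed

lemma sum_weight_relabel:
  fixes p :: real
  assumes W: "finite W" "card W = v"
  shows "(\<Sum>G\<in>{G. G \<subseteq> all_clauses r W \<and> balanced G \<and> clause_vars G = W}. of_int (weight G) * p ^ card G)
    = (\<Sum>G\<in>{G. G \<subseteq> all_clauses r {..<v} \<and> balanced G \<and> clause_vars G = {..<v}}. of_int (weight G) * p ^ card G)"
proof -
  obtain \<pi> where \<pi>: "bij_betw \<pi> {..<v} W"
    using ex_bij_betw_nat_finite[OF W(1)] W(2) by (auto simp: atLeast0LessThan)
  define \<rho> where "\<rho> = inv_into {..<v} \<pi>"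
  have \<rho>: "bij_betw \<rho> W {..<v}" unfolding \<rho>_def by (rule bij_betw_inv_into[OF \<pi>])
  have im: "\<pi> ` {..<v} = W" "\<rho> ` W = {..<v}" and inj: "inj_on \<pi> {..<v}" "inj_on \<rho> W"
    using \<pi> \<rho> by (auto simp: bij_betw_def)
  show ?thesis
  proof (rule sum.reindex_bij_witness[where i="rename_clauses \<pi>" and j="rename_clauses \<rho>"])
    fix G assume "G \<in> {G. G \<subseteq> all_clauses r W \<and> balanced G \<and> clause_vars G = W}"
    then have G: "G \<subseteq> all_clauses r W" "balanced G" "clause_vars G = W" by auto
    have "rename_clauses \<pi> (rename_clauses \<rho> G) = rename_clauses (\<pi> \<circ> \<rho>) G" by (rule rename_clauses_comp)
    also have "\<dots> = G"
    proof (rule rename_clauses_ident)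
      fix w assume "w \<in> clause_vars G"
      then have "w \<in> \<pi> ` {..<v}" using G(3) im by simp
      then show "(\<pi> \<circ> \<rho>) w = w" unfolding \<rho>_def by (simp add: f_inv_into_f)
    qed
    finally show "rename_clauses \<pi> (rename_clauses \<rho> G) = G" .
    show "rename_clauses \<rho> G \<in> {G. G \<subseteq> all_clauses r {..<v} \<and> balanced G \<and> clause_vars G = {..<v}}"
      using rename_all_clauses[OF G(1) inj(2)] balanced_rename[OF G(2)] im G(3) by (simp add: clause_vars_rename)
    show "of_int (weight (rename_clauses \<rho> G)) * p ^ card (rename_clauses \<rho> G) = of_int (weight G) * p ^ card G"
      using weight_rename[OF W(1) G(1) inj(2)] card_rename_clauses[OF G(1) inj(2) W(1)] by simp
  next
    fix G assume "G \<in> {G. G \<subseteq> all_clauses r {..<v} \<and> balanced G \<and> clause_vars G = {..<v}}"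
    then have G: "G \<subseteq> all_clauses r {..<v}" "balanced G" "clause_vars G = {..<v}" by auto
    show "rename_clauses \<rho> (rename_clauses \<pi> G) = G"
      unfolding \<rho>_def by (rule rename_clauses_inverse[OF G(1) inj(1)])
    show "rename_clauses \<pi> G \<in> {G. G \<subseteq> all_clauses r W \<and> balanced G \<and> clause_vars G = W}"
      using rename_all_clauses[OF G(1) inj(1)] balanced_rename[OF G(2)] im G(3) by (simp add: clause_vars_rename)
  qed
qed

text \<open>Balanced sets are grouped by variable set and then by number of clauses.
  \<open>N\<close> may be any bound on the latter, so that it can later be enlarged to contain the
  ranges of the expansion polynomials.\<close>

lemma sum_weight_small_full:
  fixes p :: real
  assumes N: "(2 * M) ^ r \<le> N"
  shows "(\<Sum>G\<in>small_full n M. of_int (weight G) * p ^ card G)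
    = (\<Sum>v\<in>{1..<M}. \<Sum>c\<le>N. real (n choose v) * of_int (shape_weight v c) * p ^ c)"
proof -
  let ?W = "\<lambda>v. {W. W \<subseteq> {..<n} \<and> card W = v}"
  let ?B = "\<lambda>W. {G. G \<subseteq> all_clauses r W \<and> balanced G \<and> clause_vars G = W}"
  let ?f = "\<lambda>G. of_int (weight G) * p ^ card G"
  have finW: "finite W" if "W \<in> ?W v" for W v using that finite_subset[of W "{..<n}"] by auto
  have finB: "finite (?B W)" if "finite W" for W
    by (rule finite_subset[of _ "Pow (all_clauses r W)"]) (auto simp: finite_all_clauses that)
  have C: "finite C \<and> C \<noteq> {}" if "C \<in> all_clauses r {..<n}" for C
    using that r finite_clause[of C r "{..<n}"] by (auto simp: all_clauses_def)
  have un: "small_full n M = (\<Union>v\<in>{1..<M}. \<Union>W\<in>?W v. ?B W)"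
  proof (intro equalityI subsetI)
    fix G assume "G \<in> small_full n M"
    then have G: "G \<subseteq> all_clauses r {..<n}" "balanced G" "G \<noteq> {}" "card (clause_vars G) < M"
      by (auto simp: small_full_def)
    obtain D where "D \<in> G" using G(3) by auto
    then have "D \<noteq> {}" using C G(1) by auto
    then have "clause_vars G \<noteq> {}" using \<open>D \<in> G\<close> by (auto simp: clause_vars_def)
    moreover have sub: "clause_vars G \<subseteq> {..<n}" using G(1) by (rule clause_vars_subset)
    ultimately have "card (clause_vars G) \<ge> 1" using finite_subset by (simp add: Suc_le_eq card_gt_0_iff) blast
    moreover have "G \<in> ?B (clause_vars G)" using G(2) subset_all_clauses_vars[OF G(1)] by simp
    ultimately show "G \<in> (\<Union>v\<in>{1..<M}. \<Union>W\<in>?W v. ?B W)" using sub G(4) by auto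
  next
    fix G assume "G \<in> (\<Union>v\<in>{1..<M}. \<Union>W\<in>?W v. ?B W)"
    then obtain v W where *: "v \<in> {1..<M}" "W \<subseteq> {..<n}" "card W = v" "G \<in> ?B W" by blast
    then have "G \<noteq> {}" by (auto simp: clause_vars_def)
    moreover have "G \<subseteq> all_clauses r {..<n}" using *(2,4) all_clauses_mono[of W "{..<n}" r] by auto
    ultimately show "G \<in> small_full n M" using * by (auto simp: small_full_def)
  qed
  have "(\<Sum>G\<in>small_full n M. ?f G) = (\<Sum>v\<in>{1..<M}. \<Sum>G\<in>(\<Union>W\<in>?W v. ?B W). ?f G)"
    unfolding un using finW finB by (intro sum.UNION_disjoint) auto
  also have "\<dots> = (\<Sum>v\<in>{1..<M}. \<Sum>W\<in>?W v. \<Sum>G\<in>?B W. ?f G)"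
    using finW finB by (intro sum.cong[OF refl] sum.UNION_disjoint) auto
  also have "\<dots> = (\<Sum>v\<in>{1..<M}. real (n choose v) * (\<Sum>G\<in>?B {..<v}. ?f G))"
  proof (rule sum.cong[OF refl])
    fix v
    have "(\<Sum>W\<in>?W v. \<Sum>G\<in>?B W. ?f G) = (\<Sum>W\<in>?W v. \<Sum>G\<in>?B {..<v}. ?f G)"
      using finW by (intro sum.cong[OF refl] sum_weight_relabel) auto
    then show "(\<Sum>W\<in>?W v. \<Sum>G\<in>?B W. ?f G) = real (n choose v) * (\<Sum>G\<in>?B {..<v}. ?f G)"
      by (simp add: n_subsets)
  qed
  also have "\<dots> = (\<Sum>v\<in>{1..<M}. \<Sum>c\<le>N. real (n choose v) * of_int (shape_weight v c) * p ^ c)"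
  proof (rule sum.cong[OF refl])
    fix v assume v: "v \<in> {1..<M}"
    have cardN: "card G \<le> N" if "G \<in> ?B {..<v}" for G
    proof -
      have "card G \<le> (2 * card (clause_vars G)) ^ r" using that by (intro card_le_clause_vars[of _ "{..<v}"]) auto
      also have "\<dots> \<le> (2 * M) ^ r" using that v by (intro power_mono) auto
      finally show ?thesis using N by simp
    qed
    have "(\<Sum>G\<in>?B {..<v}. ?f G) = (\<Sum>c\<le>N. \<Sum>G\<in>{G \<in> ?B {..<v}. card G = c}. ?f G)"
      using finB cardN by (intro sum.group[symmetric]) auto
    also have "\<dots> = (\<Sum>c\<le>N. of_int (shape_weight v c) * p ^ c)"
    proof (rule sum.cong[OF refl])
      fix c
      have "{G \<in> ?B {..<v}. card G = c}
          = {G. G \<subseteq> all_clauses r {..<v} \<and> balanced G \<and> clause_vars G = {..<v} \<and> card G = c}" by auto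
      then show "(\<Sum>G\<in>{G \<in> ?B {..<v}. card G = c}. ?f G) = of_int (shape_weight v c) * p ^ c"
        by (simp add: shape_weight_def sum_distrib_right)
    qed
    finally show "real (n choose v) * (\<Sum>G\<in>?B {..<v}. ?f G)
        = (\<Sum>c\<le>N. real (n choose v) * of_int (shape_weight v c) * p ^ c)"
      by (simp add: sum_distrib_left mult.assoc)
  qed
  finally show ?thesis .
qed

lemma expect_approx:
  assumes "(2 * M) ^ r \<le> N"
  shows "expect (all_clauses r {..<n}) p (approx n M)
    = (\<Sum>v\<in>{1..<M}. \<Sum>c\<le>N. real (n choose v) * of_int (shape_weight v c) * p ^ c)"
proof -
  have "expect (all_clauses r {..<n}) p (approx n M) = (\<Sum>G\<in>small_full n M. of_int (weight G) * p ^ card G)"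
    unfolding approx_def expect_sum expect_cmult
    by (intro sum.cong refl) (simp add: expect_superset finite_all_clauses small_full_def)
  then show ?thesis using sum_weight_small_full[OF assms] by simp
qed

end

section \<open>Asymptotic expansion\<close>

text \<open>The coefficient of \<open>n ^ j\<close> in \<open>n choose v\<close> as a polynomial in
  \<open>n\<close>, taken over \<open>rat\<close> so that the expansion polynomials are rational by
  construction.\<close>

definition binomial_coeff :: "nat \<Rightarrow> nat \<Rightarrow> rat" where
  "binomial_coeff v j = coeff (smult (1 / fact v) (\<Prod>i<v. [:- of_nat i, 1:])) j"

lemma degree_binomial_poly: "degree (smult (1 / fact v) (\<Prod>i<v. [:- of_nat i, 1:] :: rat poly)) \<le> v"
proof -
  have "degree (\<Prod>i<v. [:- of_nat i, 1:] :: rat poly) \<le> (\<Sum>i<v. degree [:- of_nat i, 1 :: rat:])"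
    using degree_prod_sum_le[of "{..<v}" "\<lambda>i. [:- of_nat i, 1 :: rat:]"] by (simp add: o_def)
  then show ?thesis using degree_smult_le[of "1 / fact v" "\<Prod>i<v. [:- of_nat i, 1:] :: rat poly"] by simp
qed

lemma binomial_coeff_eq_0: "j > v \<Longrightarrow> binomial_coeff v j = 0"
  unfolding binomial_coeff_def using degree_binomial_poly[of v] by (intro coeff_eq_0) simp

lemma real_binomial_eq_poly:
  assumes "v \<le> m"
  shows "real (n choose v) = (\<Sum>j\<le>m. of_rat (binomial_coeff v j) * real n ^ j)"
proof -
  let ?P = "smult (1 / fact v) (\<Prod>i<v. [:- of_nat i, 1:]) :: rat poly"
  have "(of_nat (n choose v) :: rat) = (\<Prod>i<v. of_nat n - of_nat i) / fact v"
    by (simp add: binomial_gbinomial gbinomial_prod_rev atLeast0LessThan)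
  also have "\<dots> = poly ?P (of_nat n)" by (simp add: poly_prod)
  also have "\<dots> = (\<Sum>j\<le>degree ?P. coeff ?P j * of_nat n ^ j)" by (rule poly_altdef)
  also have "\<dots> = (\<Sum>j\<le>m. coeff ?P j * of_nat n ^ j)"
  proof (rule sum.mono_neutral_left)
    show "{..degree ?P} \<subseteq> {..m}" using degree_binomial_poly[of v] assms by auto
    show "\<forall>j\<in>{..m} - {..degree ?P}. coeff ?P j * of_nat n ^ j = 0"
      by (metis DiffD2 atMost_iff coeff_eq_0 mult_zero_left not_le)
  qed simp
  finally have "(of_nat (n choose v) :: rat) = (\<Sum>j\<le>m. binomial_coeff v j * of_nat n ^ j)"
    by (simp only: binomial_coeff_def)
  then have "(of_rat (of_nat (n choose v)) :: real) = of_rat (\<Sum>j\<le>m. binomial_coeff v j * of_nat n ^ j)"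
    by (rule arg_cong)
  then show ?thesis by (simp add: of_rat_sum of_rat_mult of_rat_power)
qed

lemma rat_poly_eval_add: "rat_poly_eval (f + g) y = rat_poly_eval f y + rat_poly_eval g y"
proof -
  have "map_poly of_rat (f + g) = map_poly of_rat f + (map_poly of_rat g :: real poly)"
    by (rule poly_eqI) (simp add: coeff_map_poly of_rat_add)
  then show ?thesis by simp
qed

lemma rat_poly_eval_sum: "rat_poly_eval (\<Sum>i\<in>A. f i) y = (\<Sum>i\<in>A. rat_poly_eval (f i) y)"
  by (induction A rule: infinite_finite_induct) (simp_all add: rat_poly_eval_add)

lemma rat_poly_eval_monom: "rat_poly_eval (monom b c) y = of_rat b * y ^ c"
  by (simp add: map_poly_monom poly_monom)

section \<open>The polynomials of the expansion\<close>

context core_event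
begin

definition monomial_coeff :: "nat \<times> nat \<times> nat \<Rightarrow> real" where
  "monomial_coeff = (\<lambda>(v, c, j). of_rat (binomial_coeff v j) * of_int (shape_weight v c))"

text \<open>The truncated subtraction is exact wherever the coefficient is nonzero, since then
  \<open>j < (r - 1) * c\<close>.\<close>

definition inverse_exponent :: "nat \<times> nat \<times> nat \<Rightarrow> nat" where
  "inverse_exponent = (\<lambda>(v, c, j). (r - 1) * c - j)"

text \<open>The monomial \<open>\<alpha> ^ c * n ^ j / n ^ ((r - 1) * c)\<close> comes from full formulae with \<open>v\<close> variables
  and \<open>c\<close> clauses. As \<open>2 * v \<le> r * c\<close>, only finitely many \<open>v\<close> and \<open>c\<close> contribute to \<open>1 / n ^ s\<close>.\<close>

definition expansion_poly :: "nat \<Rightarrow> rat poly" where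
  "expansion_poly s = (\<Sum>(v, c, j)\<in>{1..3 * s} \<times> {..4 * s} \<times> {..3 * s}.
     if inverse_exponent (v, c, j) = s then monom (binomial_coeff v j * of_int (shape_weight v c)) c else 0)"

lemma rat_poly_eval_expansion_poly:
  "rat_poly_eval (expansion_poly s) y = (\<Sum>(v, c, j)\<in>{1..3 * s} \<times> {..4 * s} \<times> {..3 * s}.
     if inverse_exponent (v, c, j) = s then monomial_coeff (v, c, j) * y ^ c else 0)"
  unfolding expansion_poly_def rat_poly_eval_sum
  by (intro sum.cong refl) (auto simp: rat_poly_eval_monom monomial_coeff_def of_rat_mult)

text \<open>Let \<open>e\<close> be the exponent. From \<open>j \<le> v\<close> and
  \<open>(r - 1) * c \<ge> 4 * v / 3\<close> follows \<open>e \<ge> v / 3\<close>; then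
  \<open>c \<le> (r - 1) * c = e + j \<le> e + v \<le> 4 * e\<close>. These are the ranges in
  \<open>expansion_poly\<close>.\<close>

lemma monomial_coeff_nonzero:
  assumes "monomial_coeff (v, c, j) \<noteq> 0" "v \<ge> 1"
  shows "j < (r - 1) * c" "j \<le> v" "v \<le> 3 * inverse_exponent (v, c, j)" "c \<le> 4 * inverse_exponent (v, c, j)"
    "1 \<le> inverse_exponent (v, c, j)"
proof -
  have nz: "binomial_coeff v j \<noteq> 0" "shape_weight v c \<noteq> 0" using assms by (auto simp: monomial_coeff_def)
  show j: "j \<le> v" using nz(1) binomial_coeff_eq_0[of v j] by (meson not_le)
  have c: "4 * v \<le> 3 * ((r - 1) * c)"
    by (rule three_times_clauses[OF r shape_weight_nonzero(1)[OF nz(2)]])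
  then show jc: "j < (r - 1) * c" using j assms(2) by linarith
  have e: "inverse_exponent (v, c, j) = (r - 1) * c - j" by (simp add: inverse_exponent_def)
  show v3: "v \<le> 3 * inverse_exponent (v, c, j)" unfolding e using c j jc by linarith
  show "1 \<le> inverse_exponent (v, c, j)" unfolding e using jc by linarith
  have "1 * c \<le> (r - 1) * c" using r by (intro mult_right_mono) auto
  then show "c \<le> 4 * inverse_exponent (v, c, j)" using v3 j jc unfolding e by linarith
qed

text \<open>Expanding the binomials gives a sum over \<open>T\<close> of multiples of powers of
  \<open>1 / n\<close>. For \<open>k \<le> s\<close> the range of \<open>expansion_poly k\<close>
  lies in \<open>T\<close>, since \<open>3 * k < M\<close> and \<open>4 * k \<le> N\<close>, and it
  contains every contribution to \<open>1 / n ^ k\<close>. So exactly the terms with exponent above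
  \<open>s\<close> remain, each bounded uniformly in \<alpha>.\<close>

lemma expansion_remainder:
  fixes n s :: nat and \<alpha> a :: real
  defines "M \<equiv> 3 * (s + 1)"
  defines "N \<equiv> (2 * M) ^ r + 4 * s"
  defines "T \<equiv> {1..<M} \<times> {..N} \<times> {..M}"
  assumes n: "n \<ge> 1" and \<alpha>: "0 \<le> \<alpha>" "\<alpha> \<le> a"
  shows "\<bar>expect (all_clauses r {..<n}) (\<alpha> / real n ^ (r - 1)) (approx n M)
      - (\<Sum>k=1..s. rat_poly_eval (expansion_poly k) \<alpha> / real n ^ k)\<bar>
    \<le> (\<Sum>x\<in>T. \<bar>monomial_coeff x\<bar> * a ^ fst (snd x)) * (1 / real n ^ (s + 1))"
proof -
  define t where "t x = monomial_coeff x * \<alpha> ^ fst (snd x)" for x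
  let ?e = inverse_exponent
  have finT: "finite T" by (simp add: T_def)
  have n0: "real n > 0" using n by simp
  have t0: "t x = 0 \<or> (1 \<le> ?e x \<and> snd (snd x) < (r - 1) * fst (snd x) \<and> fst x \<le> 3 * ?e x
      \<and> fst (snd x) \<le> 4 * ?e x \<and> snd (snd x) \<le> fst x)" if "x \<in> T" for x
  proof -
    obtain v c j where x: "x = (v, c, j)" by (cases x)
    then have "v \<ge> 1" using that by (simp add: T_def)
    then show ?thesis using monomial_coeff_nonzero[of v c j] unfolding x t_def by auto
  qed
  have "expect (all_clauses r {..<n}) (\<alpha> / real n ^ (r - 1)) (approx n M)
      = (\<Sum>v\<in>{1..<M}. \<Sum>c\<le>N. real (n choose v) * of_int (shape_weight v c) * (\<alpha> / real n ^ (r - 1)) ^ c)"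
    by (rule expect_approx) (simp add: N_def)
  also have "\<dots> = (\<Sum>v\<in>{1..<M}. \<Sum>c\<le>N. \<Sum>j\<le>M. t (v, c, j) / real n ^ ?e (v, c, j))"
  proof (intro sum.cong refl)
    fix v c assume v: "v \<in> {1..<M}" and c: "c \<in> {..N}"
    have "real (n choose v) * of_int (shape_weight v c) * (\<alpha> / real n ^ (r - 1)) ^ c
        = (\<Sum>j\<le>M. t (v, c, j) * real n ^ j / real n ^ ((r - 1) * c))"
      using real_binomial_eq_poly[of v M n] v unfolding power_mult
      by (simp add: t_def monomial_coeff_def sum_distrib_right sum_distrib_left power_divide sum_divide_distrib mult_ac)
    also have "\<dots> = (\<Sum>j\<le>M. t (v, c, j) / real n ^ ?e (v, c, j))"
    proof (rule sum.cong[OF refl])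
      fix j assume "j \<in> {..M}"
      with v c have "(v, c, j) \<in> T" by (simp add: T_def)
      from t0[OF this] show "t (v, c, j) * real n ^ j / real n ^ ((r - 1) * c) = t (v, c, j) / real n ^ ?e (v, c, j)"
      proof
        assume *: "1 \<le> ?e (v, c, j) \<and> snd (snd (v, c, j)) < (r - 1) * fst (snd (v, c, j)) \<and> fst (v, c, j) \<le> 3 * ?e (v, c, j)
          \<and> fst (snd (v, c, j)) \<le> 4 * ?e (v, c, j) \<and> snd (snd (v, c, j)) \<le> fst (v, c, j)"
        then have "(r - 1) * c = ?e (v, c, j) + j" by (simp add: inverse_exponent_def)
        then have "real n ^ ((r - 1) * c) = real n ^ ?e (v, c, j) * real n ^ j" by (simp add: power_add)
        then show ?thesis using n0 by simp
      qed simp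
    qed
    finally show "real (n choose v) * of_int (shape_weight v c) * (\<alpha> / real n ^ (r - 1)) ^ c
        = (\<Sum>j\<le>M. t (v, c, j) / real n ^ ?e (v, c, j))" .
  qed
  also have "\<dots> = (\<Sum>x\<in>T. t x / real n ^ ?e x)"
    unfolding T_def by (simp add: sum.cartesian_product case_prod_unfold)
  finally have main: "expect (all_clauses r {..<n}) (\<alpha> / real n ^ (r - 1)) (approx n M) = (\<Sum>x\<in>T. t x / real n ^ ?e x)" .
  have coeff: "rat_poly_eval (expansion_poly k) \<alpha> = (\<Sum>x\<in>T. if ?e x = k then t x else 0)" if k: "k \<in> {1..s}" for k
  proof -
    let ?B = "{1..3 * k} \<times> {..4 * k} \<times> {..3 * k}"
    have "rat_poly_eval (expansion_poly k) \<alpha> = (\<Sum>x\<in>?B. if ?e x = k then t x else 0)"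
      unfolding rat_poly_eval_expansion_poly by (intro sum.cong refl) (auto simp: t_def)
    also have "\<dots> = (\<Sum>x\<in>T. if ?e x = k then t x else 0)"
    proof (rule sum.mono_neutral_left[OF finT])
      show "?B \<subseteq> T" using k by (auto simp: T_def M_def N_def)
      show "\<forall>x\<in>T - ?B. (if ?e x = k then t x else 0) = 0"
      proof
        fix x assume x: "x \<in> T - ?B"
        obtain v c j where vcj: "x = (v, c, j)" by (cases x)
        have "v \<ge> 1" using x vcj by (simp add: T_def)
        then have "t x = 0 \<or> ?e x \<noteq> k" using t0[of x] x vcj by auto
        then show "(if ?e x = k then t x else 0) = 0" by auto
      qed
    qed
    finally show ?thesis .
  qed
  have "(\<Sum>k=1..s. rat_poly_eval (expansion_poly k) \<alpha> / real n ^ k)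
      = (\<Sum>k=1..s. \<Sum>x\<in>T. if ?e x = k then t x / real n ^ ?e x else 0)"
    using coeff by (intro sum.cong refl) (auto simp: sum_divide_distrib intro!: sum.cong)
  also have "\<dots> = (\<Sum>x\<in>T. \<Sum>k=1..s. if ?e x = k then t x / real n ^ ?e x else 0)" by (rule sum.swap)
  also have "\<dots> = (\<Sum>x\<in>T. if ?e x \<le> s then t x / real n ^ ?e x else 0)"
  proof (rule sum.cong[OF refl])
    fix x assume "x \<in> T"
    from t0[OF this] show "(\<Sum>k=1..s. if ?e x = k then t x / real n ^ ?e x else 0)
        = (if ?e x \<le> s then t x / real n ^ ?e x else 0)"
      by (auto simp: sum.delta)
  qed
  finally have "expect (all_clauses r {..<n}) (\<alpha> / real n ^ (r - 1)) (approx n M)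
      - (\<Sum>k=1..s. rat_poly_eval (expansion_poly k) \<alpha> / real n ^ k)
      = (\<Sum>x\<in>T. if ?e x \<le> s then 0 else t x / real n ^ ?e x)"
    unfolding main by (simp add: sum_subtractf[symmetric]) (intro sum.cong; simp)
  also have "\<bar>\<dots>\<bar> \<le> (\<Sum>x\<in>T. \<bar>if ?e x \<le> s then 0 else t x / real n ^ ?e x\<bar>)" by (rule sum_abs)
  also have "\<dots> \<le> (\<Sum>x\<in>T. \<bar>monomial_coeff x\<bar> * a ^ fst (snd x) * (1 / real n ^ (s + 1)))"
  proof (rule sum_mono)
    fix x assume "x \<in> T"
    have a0: "0 \<le> a" using \<alpha> by simp
    have 1: "\<bar>t x\<bar> \<le> \<bar>monomial_coeff x\<bar> * a ^ fst (snd x)"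
      unfolding t_def abs_mult power_abs using \<alpha> by (intro mult_left_mono power_mono) auto
    show "\<bar>if ?e x \<le> s then 0 else t x / real n ^ ?e x\<bar>
        \<le> \<bar>monomial_coeff x\<bar> * a ^ fst (snd x) * (1 / real n ^ (s + 1))"
    proof (cases "?e x \<le> s")
      case True
      then show ?thesis using a0 by simp
    next
      case False
      have "real n ^ (s + 1) \<le> real n ^ ?e x" using n False by (intro power_increasing) auto
      then have "1 / real n ^ ?e x \<le> 1 / real n ^ (s + 1)" using n0 by (intro divide_left_mono) auto
      then have "\<bar>t x\<bar> * (1 / real n ^ ?e x) \<le> (\<bar>monomial_coeff x\<bar> * a ^ fst (snd x)) * (1 / real n ^ (s + 1))"
        using 1 a0 by (intro mult_mono) auto
      then show ?thesis using False by (simp add: abs_divide)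
    qed
  qed
  also have "\<dots> = (\<Sum>x\<in>T. \<bar>monomial_coeff x\<bar> * a ^ fst (snd x)) * (1 / real n ^ (s + 1))"
    by (simp only: sum_distrib_right)
  finally show ?thesis .
qed

end

section \<open>The expansion of the probability below the threshold\<close>

lemma subcritical_imp_regime:
  assumes r: "r \<ge> 3" and sub: "subcritical r \<alpha>"
  shows "subcritical_regime r \<alpha> (SUP n\<in>{1..}. \<alpha> n)"
proof -
  let ?a = "SUP n\<in>{1..}. \<alpha> n"
  have pos: "eventually (\<lambda>n. 0 < \<alpha> n) sequentially" and th: "\<alpha> \<in> \<Theta>(\<lambda>_. 1)"
    and thr: "?a < pure_literal_threshold r"
    using sub by (auto simp: subcritical_def)
  obtain c where "eventually (\<lambda>n. norm (\<alpha> n) \<le> c * norm (1 :: real)) sequentially"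
    using bigthetaD1[OF th] by (rule landau_o.bigE)
  then obtain n0 where "\<forall>n\<ge>n0. \<bar>\<alpha> n\<bar> \<le> c" by (auto simp: eventually_sequentially)
  then have n0: "\<alpha> n \<le> c" if "n \<ge> n0" for n using that by (auto dest: abs_le_D1)
  \<comment> \<open>\<open>SUP\<close> is meaningful only for a bounded set. The \<Theta> bound
    covers all large \<open>n\<close>, and the remaining finitely many are covered by
    \<open>Max\<close>.\<close>
  have "\<alpha> n \<le> max c (Max (\<alpha> ` {..n0}))" for n
  proof (cases "n \<ge> n0")
    case True
    from n0[OF this] show ?thesis by simp
  next
    case False
    then have "\<alpha> n \<le> Max (\<alpha> ` {..n0})" by (intro Max_ge) auto
    then show ?thesis by simp
  qed
  then have bdd: "bdd_above (\<alpha> ` {1..})" by (intro bdd_aboveI2)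
  have le: "\<alpha> n \<le> ?a" if "n \<ge> 1" for n using that by (intro cSUP_upper bdd) auto
  have ev: "eventually (\<lambda>n. 0 < \<alpha> n \<and> \<alpha> n \<le> ?a) sequentially"
    using pos eventually_ge_at_top[of 1]
  proof eventually_elim
    case (elim n)
    then show ?case using le[of n] by simp
  qed
  obtain n where "0 < \<alpha> n \<and> \<alpha> n \<le> ?a" using eventually_happens'[OF sequentially_bot ev] by blast
  then have a: "?a > 0" by linarith
  show ?thesis
  proof
    show "r \<ge> 3" by (rule r)
    show "?a > 0" by (rule a)
    show "eventually (\<lambda>n. 0 < \<alpha> n \<and> \<alpha> n \<le> ?a) sequentially" by (rule ev)
    fix y :: real assume y: "y > 0"
    let ?f = "\<lambda>y::real. fact (r - 1) * y / (2 ^ (r - 1) * (1 - exp (- y)) ^ (r - 1))"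
    have den: "(1 - exp (- y)) ^ (r - 1) > 0" using y by simp
    have "bdd_below (?f ` {0<..})" by (intro bdd_belowI2[of _ 0]) auto
    then have "pure_literal_threshold r \<le> ?f y"
      unfolding pure_literal_threshold_def by (rule cINF_lower) (use y in simp)
    then have "?a < ?f y" using thr by linarith
    then have "?a * (2 ^ (r - 1) * (1 - exp (- y)) ^ (r - 1)) < fact (r - 1) * y"
      using den by (subst (asm) pos_less_divide_eq) auto
    then have "?a * (2 ^ (r - 1) * (1 - exp (- y)) ^ (r - 1)) / fact (r - 1) < y"
      by (subst pos_divide_less_eq) (simp_all only: fact_gt_zero mult.commute)
    also have "?a * (2 ^ (r - 1) * (1 - exp (- y)) ^ (r - 1)) / fact (r - 1)
        = 2 ^ (r - 1) * ?a / fact (r - 1) * (1 - exp (- y)) ^ (r - 1)"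
      by (simp only: times_divide_eq_left times_divide_eq_right mult_ac)
    finally show "2 ^ (r - 1) * ?a / fact (r - 1) * (1 - exp (- y)) ^ (r - 1) < y" .
  qed
qed

context core_event
begin

lemma probability_expansion:
  assumes sub: "subcritical r \<alpha>"
  shows "(\<lambda>n. expect (all_clauses r {..<n}) (\<alpha> n / real n ^ (r - 1)) (\<lambda>S. of_bool (Q S))
      - (\<Sum>k=1..s. rat_poly_eval (expansion_poly k) (\<alpha> n) / real n ^ k)) \<in> O(\<lambda>n. 1 / real n ^ (s + 1))"
proof -
  define a where "a = (SUP n\<in>{1..}. \<alpha> n)"
  interpret R: subcritical_regime r \<alpha> a
    unfolding a_def by (rule subcritical_imp_regime[OF r sub])
  \<comment> \<open>A core with at least \<open>M\<close> variables has probability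
    \<open>O(1 / n ^ (s + 1))\<close>. \<open>L\<close> is chosen to give
    \<open>O(1 / n ^ (M + s + 1))\<close>, which leaves the same order after multiplication by the
    crude bound \<open>n ^ M\<close>.\<close>
  define M where "M = 3 * (s + 1)"
  define L where "L = 3 * (M + s + 1)"
  define A where "A = (1 + 2 ^ ((2 * L) ^ r) * 2 ^ ((2 * M) ^ r) :: real)"
  define B where "B = (1 + real M * 2 ^ ((2 * M) ^ r) * 2 ^ ((2 * M) ^ r) :: real)"
  define K where "K = (\<Sum>x\<in>{1..<M} \<times> {..(2 * M) ^ r + 4 * s} \<times> {..M}. \<bar>monomial_coeff x\<bar> * a ^ fst (snd x))"
  let ?d = "\<lambda>n. expect (all_clauses r {..<n}) (\<alpha> n / real n ^ (r - 1)) (\<lambda>S. of_bool (Q S))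
      - (\<Sum>k=1..s. rat_poly_eval (expansion_poly k) (\<alpha> n) / real n ^ k)"
  let ?g = "\<lambda>n. A * R.Pr n (large_core M) + B * (real n ^ M * R.Pr n (large_core L)) + K * (1 / real n ^ (s + 1))"
  have M': "R.Pr n (large_core M) = R.Pr n (\<lambda>S. \<exists>G\<subseteq>S. balanced G \<and> 3 * (s + 1) \<le> card (clause_vars G))" for n
    by (simp add: large_core_def[abs_def] M_def)
  have L': "R.Pr n (large_core L) = R.Pr n (\<lambda>S. \<exists>G\<subseteq>S. balanced G \<and> 3 * (M + s + 1) \<le> card (clause_vars G))" for n
    by (simp add: large_core_def[abs_def] L_def)
  have "?g \<in> O(\<lambda>n. 1 / real n ^ (s + 1))"
  proof (intro sum_in_bigo)
    have "(\<lambda>n. R.Pr n (large_core M)) \<in> O(\<lambda>n. 1 / real n ^ (s + 1))"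
      unfolding M' by (rule R.Pr_balanced) simp
    then show "(\<lambda>n. A * R.Pr n (large_core M)) \<in> O(\<lambda>n. 1 / real n ^ (s + 1))" by simp
    have "(\<lambda>n. R.Pr n (large_core L)) \<in> O(\<lambda>n. 1 / real n ^ (M + s + 1))"
      unfolding L' by (rule R.Pr_balanced) simp
    then have "(\<lambda>n. real n ^ M * R.Pr n (large_core L)) \<in> O(\<lambda>n. real n ^ M * (1 / real n ^ (M + s + 1)))"
      by (rule landau_o.big.mult[OF landau_o.big_refl])
    also have "O(\<lambda>n. real n ^ M * (1 / real n ^ (M + s + 1))) = O(\<lambda>n. 1 / real n ^ (s + 1))"
    proof (rule landau_o.big.cong)
      show "eventually (\<lambda>n. real n ^ M * (1 / real n ^ (M + s + 1)) = 1 / real n ^ (s + 1)) sequentially"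
        using eventually_gt_at_top[of 0] by eventually_elim (simp add: power_add)
    qed
    finally show "(\<lambda>n. B * (real n ^ M * R.Pr n (large_core L))) \<in> O(\<lambda>n. 1 / real n ^ (s + 1))" by simp
    show "(\<lambda>n. K * (1 / real n ^ (s + 1))) \<in> O(\<lambda>n. 1 / real n ^ (s + 1))"
      by (rule landau_o.bigI[of "\<bar>K\<bar> + 1"]) (auto simp: abs_mult intro!: always_eventually divide_right_mono)
  qed
  moreover have "eventually (\<lambda>n. 0 \<le> \<bar>?d n\<bar> \<and> \<bar>?d n\<bar> \<le> ?g n) sequentially"
    using R.p_eventually R.\<alpha>
  proof eventually_elim
    case (elim n)
    then have p: "0 \<le> R.p n" "R.p n \<le> 1" and n: "n \<ge> 1" by auto
    let ?I = "all_clauses r {..<n}"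
    have "\<bar>R.E n (\<lambda>S. of_bool (Q S)) - R.E n (approx n M)\<bar> \<le> R.E n (\<lambda>S. \<bar>of_bool (Q S) - approx n M S\<bar>)"
      unfolding R.E_def expect_diff[symmetric] by (rule expect_abs[OF p])
    also have "\<dots> \<le> R.E n (\<lambda>S. A * of_bool (large_core M S) + (B * real n ^ M) * of_bool (large_core L S))"
      unfolding R.E_def A_def B_def by (intro expect_mono p approx_error_split n)
    also have "\<dots> = A * R.Pr n (large_core M) + B * (real n ^ M * R.Pr n (large_core L))"
      unfolding R.Pr_def R.E_def expect_add expect_cmult by simp
    finally have 1: "\<bar>R.E n (\<lambda>S. of_bool (Q S)) - R.E n (approx n M)\<bar>
        \<le> A * R.Pr n (large_core M) + B * (real n ^ M * R.Pr n (large_core L))" .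
    have 2: "\<bar>R.E n (approx n M) - (\<Sum>k=1..s. rat_poly_eval (expansion_poly k) (\<alpha> n) / real n ^ k)\<bar>
        \<le> K * (1 / real n ^ (s + 1))"
      unfolding R.E_def R.p_def K_def M_def using elim n by (intro expansion_remainder) auto
    have "?d n = (R.E n (\<lambda>S. of_bool (Q S)) - R.E n (approx n M))
        + (R.E n (approx n M) - (\<Sum>k=1..s. rat_poly_eval (expansion_poly k) (\<alpha> n) / real n ^ k))"
      unfolding R.E_def R.p_def by simp
    then have "\<bar>?d n\<bar> \<le> ?g n" using 1 2 by linarith
    then show ?case by simp
  qed
  ultimately have "(\<lambda>n. \<bar>?d n\<bar>) \<in> O(\<lambda>n. 1 / real n ^ (s + 1))" by (rule bigo_mono)
  then show ?thesis by simp
qed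

lemma formula_probability_expansion:
  fixes P :: "nat formula \<Rightarrow> bool"
  assumes P: "\<And>n S. S \<subseteq> all_clauses r {..<n} \<Longrightarrow> P (Formula {..<n} S) = Q S"
  shows "\<exists>q :: nat \<Rightarrow> rat poly. \<forall>(\<alpha> :: nat \<Rightarrow> real) (smax :: nat).
          subcritical r \<alpha> \<and> smax \<ge> 1 \<longrightarrow>
          (\<lambda>n. measure_pmf.prob (random_sat_formula r n (\<alpha> n / real n ^ (r - 1))) {F. P F}
               - (\<Sum>s=1..smax. rat_poly_eval (q s) (\<alpha> n) / real n ^ s))
            \<in> O(\<lambda>n. 1 / real n ^ (smax + 1))"
proof (intro exI[of _ expansion_poly] allI impI)
  fix \<alpha> and smax :: nat
  assume "subcritical r \<alpha> \<and> smax \<ge> 1"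
  then have sub: "subcritical r \<alpha>" by simp
  interpret R: subcritical_regime r \<alpha> "SUP n\<in>{1..}. \<alpha> n"
    by (rule subcritical_imp_regime[OF r sub])
  let ?f = "\<lambda>n. measure_pmf.prob (random_sat_formula r n (\<alpha> n / real n ^ (r - 1))) {F. P F}
     - (\<Sum>s=1..smax. rat_poly_eval (expansion_poly s) (\<alpha> n) / real n ^ s)"
  let ?g = "\<lambda>n. expect (all_clauses r {..<n}) (\<alpha> n / real n ^ (r - 1)) (\<lambda>S. of_bool (Q S))
     - (\<Sum>s=1..smax. rat_poly_eval (expansion_poly s) (\<alpha> n) / real n ^ s)"
  \<comment> \<open>Equality holds only eventually: for small \<open>n\<close> the intended clause
    probability need not lie between \<open>0\<close> and \<open>1\<close>, and
    \<open>bernoulli_pmf\<close> truncates it.\<close>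
  have "eventually (\<lambda>n. ?f n = ?g n) sequentially"
    using R.p_eventually
  proof eventually_elim
    case (elim n)
    then have p: "0 \<le> \<alpha> n / real n ^ (r - 1)" "\<alpha> n / real n ^ (r - 1) \<le> 1" by (auto simp: R.p_def)
    have "expect (all_clauses r {..<n}) (\<alpha> n / real n ^ (r - 1)) (\<lambda>S. of_bool (P (Formula {..<n} S)))
        = expect (all_clauses r {..<n}) (\<alpha> n / real n ^ (r - 1)) (\<lambda>S. of_bool (Q S))"
      using P by (intro expect_cong) simp
    then show ?case using prob_random_sat_formula[OF p, of r n P] by simp
  qed
  then show "?f \<in> O(\<lambda>n. 1 / real n ^ (smax + 1))"
    using probability_expansion[OF sub, of smax] by (subst landau_o.big.in_cong)
qed

end

section \<open>The three events\<close>

text \<open>A pure literal never occurs in a surviving balanced subset, so no step deletes any of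
  its clauses. Conversely, without nonempty balanced subsets every nonempty remainder has a pure
  literal in one of its clauses, and deleting it lowers the number of clauses.\<close>

lemma pure_literal_rule_fails_iff:
  assumes "finite V" "S \<subseteq> all_clauses r V"
  shows "pure_literal_rule_fails (Formula V S) \<longleftrightarrow> (\<exists>G\<subseteq>S. G \<noteq> {} \<and> balanced G)"
proof
  assume "\<exists>G\<subseteq>S. G \<noteq> {} \<and> balanced G"
  then obtain G where G: "G \<subseteq> S" "G \<noteq> {}" "balanced G" by blast
  have G_subset: "G \<subseteq> clauses F'" if "pure_step\<^sup>*\<^sup>* F F'" "G \<subseteq> clauses F" for F F' :: "'a formula"
    using that
  proof (induction rule: rtranclp_induct)
    case (step F1 F2)
    then obtain l where l: "pure F1 l" "F2 = Formula (vars F1 - {fst l}) {C \<in> clauses F1. l \<notin> C}"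
      by (auto simp: pure_step_def)
    have "l \<notin> C" if "C \<in> G" for C
    proof
      assume "l \<in> C"
      then have "neg l \<in> \<Union>G" using G(3) that unfolding balanced_def by blast
      moreover have "G \<subseteq> clauses F1" using step by blast
      ultimately show False using l(1) unfolding pure_def neg_def by blast
    qed
    moreover have "G \<subseteq> clauses F1" using step by blast
    ultimately show ?case using l(2) by auto
  qed simp
  show "pure_literal_rule_fails (Formula V S)"
    unfolding pure_literal_rule_fails_def
  proof
    assume "\<exists>F'. pure_step\<^sup>*\<^sup>* (Formula V S) F' \<and> clauses F' = {}"
    then obtain F' where F': "pure_step\<^sup>*\<^sup>* (Formula V S) F'" "clauses F' = {}" by blast
    from G_subset[OF F'(1)] G(1,2) F'(2) show False by simp
  qed
next
  assume fails: "pure_literal_rule_fails (Formula V S)"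
  show "\<exists>G\<subseteq>S. G \<noteq> {} \<and> balanced G"
  proof (rule ccontr)
    assume no: "\<not> (\<exists>G\<subseteq>S. G \<noteq> {} \<and> balanced G)"
    have "\<exists>G. pure_step\<^sup>*\<^sup>* (Formula W T) G \<and> clauses G = {}"
      if "T \<subseteq> all_clauses r W" "T \<subseteq> S" "finite T" for W T
      using that(3,1,2)
    proof (induction "card T" arbitrary: W T rule: less_induct)
      case less
      show ?case
      proof (cases "T = {}")
        case True
        then show ?thesis by (intro exI[of _ "Formula W T"]) auto
      next
        case False
        then have "\<not> balanced T" using no less.prems by blast
        then obtain l C where C: "C \<in> T" "l \<in> C" "neg l \<notin> \<Union>T" unfolding balanced_def by blast
        let ?T = "{C \<in> T. l \<notin> C}"
        have "C \<subseteq> W \<times> UNIV" using C(1) less.prems(2) by (auto simp: all_clauses_def)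
        then have "fst l \<in> W" using C(2) by (auto simp: mem_Times_iff)
        then have "pure (Formula W T) l" using C(3) by (auto simp: pure_def neg_def)
        then have step: "pure_step (Formula W T) (Formula (W - {fst l}) ?T)"
          unfolding pure_step_def by (intro exI[of _ l]) simp
        have "?T \<subset> T" using C by auto
        then have "card ?T < card T" using less.prems(1) by (rule psubset_card_mono[rotated])
        \<comment> \<open>The deleted variable is gone from the remaining clauses altogether: those
          with \<open>l\<close> were removed, and \<open>neg l\<close> occurred nowhere.\<close>
        moreover have "?T \<subseteq> all_clauses r (W - {fst l})"
        proof
          fix D assume D: "D \<in> ?T"
          then have DW: "D \<in> all_clauses r W" using less.prems(2) by auto
          have "D \<subseteq> (W - {fst l}) \<times> UNIV"
          proof
            fix m assume m: "m \<in> D"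
            then have "m \<in> W \<times> UNIV" using DW by (auto simp: all_clauses_def)
            moreover have "fst m \<noteq> fst l" using m D C(3) by (auto simp: fst_eq_iff_literal)
            ultimately show "m \<in> (W - {fst l}) \<times> UNIV" by (simp add: mem_Times_iff)
          qed
          then show "D \<in> all_clauses r (W - {fst l})" using DW by (simp add: all_clauses_def)
        qed
        moreover have "finite ?T" "?T \<subseteq> S" using less.prems by auto
        ultimately have "\<exists>G. pure_step\<^sup>*\<^sup>* (Formula (W - {fst l}) ?T) G \<and> clauses G = {}"
          using less.hyps by blast
        then obtain G where G: "pure_step\<^sup>*\<^sup>* (Formula (W - {fst l}) ?T) G" "clauses G = {}" by blast
        from converse_rtranclp_into_rtranclp[of pure_step, OF step G(1)] G(2) show ?thesis by blast
      qed
    qed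
    from this[OF assms(2) order_refl finite_subset[OF assms(2) finite_all_clauses[OF assms(1)]]] fails
    show False unfolding pure_literal_rule_fails_def by (rule notE[rotated])
  qed
qed

definition sat_clauses :: "'v clause set \<Rightarrow> bool" where
  "sat_clauses S \<longleftrightarrow> (\<exists>\<tau>::'v \<Rightarrow> bool. \<forall>C\<in>S. \<exists>l\<in>C. \<tau> (fst l) = snd l)"

lemma satisfiable_iff: "satisfiable F \<longleftrightarrow> sat_clauses (clauses F)"
  unfolding satisfiable_def sat_clauses_def by (simp add: case_prod_unfold)

text \<open>Unlike \<open>contains_copy\<close> this looks at the clauses only. For full
  \<open>H\<close> the two agree, because every variable of a copy occurs in its clauses.\<close>

definition has_copy :: "nat \<Rightarrow> 'v formula \<Rightarrow> 'w clause set \<Rightarrow> bool" where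
  "has_copy r H S \<longleftrightarrow> (\<exists>G. sat_formula r G \<and> clauses G \<subseteq> S \<and> isomorphic H G)"

lemma isomorphic_full:
  assumes "full H" "isomorphic H G" "sat_formula r G"
  shows "balanced (clauses G)" "clauses G \<noteq> {}" "vars G \<subseteq> clause_vars (clauses G)"
proof -
  obtain f \<sigma> where f: "bij_betw f (vars H) (vars G)"
    and G: "clauses G = (\<lambda>C. (\<lambda>(v, b). (f v, b \<noteq> \<sigma> v)) ` C) ` clauses H"
    using assms(2) unfolding isomorphic_def by blast
  show "clauses G \<noteq> {}" using assms(1) G by (simp add: full_def)
  have lit: "(w, b) \<in> \<Union>(clauses G)" if w: "w \<in> vars G" for w b
  proof -
    obtain v where v: "v \<in> vars H" "w = f v" using f w by (auto simp: bij_betw_def)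
    \<comment> \<open>Flipping a sign is an involution, so \<open>(v, b \<noteq> \<sigma> v)\<close>
      is the literal that is mapped to \<open>(w, b)\<close>.\<close>
    then obtain C where C: "C \<in> clauses H" "(v, b \<noteq> \<sigma> v) \<in> C" using assms(1) unfolding full_def by metis
    have "(w, b) = (\<lambda>(v, b). (f v, b \<noteq> \<sigma> v)) (v, b \<noteq> \<sigma> v)" using v(2) by auto
    then have "(w, b) \<in> (\<lambda>(v, b). (f v, b \<noteq> \<sigma> v)) ` C" using C(2) by (rule image_eqI)
    then show ?thesis unfolding G using C(1) by blast
  qed
  show "vars G \<subseteq> clause_vars (clauses G)"
  proof
    fix w assume "w \<in> vars G"
    then have "fst (w, True) \<in> fst ` \<Union>(clauses G)" by (intro imageI lit)
    then show "w \<in> clause_vars (clauses G)" by (simp add: clause_vars_def)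
  qed
  show "balanced (clauses G)"
    unfolding balanced_def
  proof (rule image_subsetI)
    fix l assume "l \<in> \<Union>(clauses G)"
    then have "fst l \<in> vars G" using assms(3) by (force simp: sat_formula_def all_clauses_def)
    then show "neg l \<in> \<Union>(clauses G)" unfolding neg_def by (rule lit)
  qed
qed

lemma contains_copy_iff:
  assumes "full H" "S \<subseteq> all_clauses r V"
  shows "contains_copy r H (Formula V S) \<longleftrightarrow> has_copy r H S"
proof
  assume "has_copy r H S"
  then obtain G where G: "sat_formula r G" "clauses G \<subseteq> S" "isomorphic H G" by (auto simp: has_copy_def)
  have "vars G \<subseteq> clause_vars (clauses G)" by (rule isomorphic_full(3)[OF assms(1) G(3,1)])
  also have "\<dots> \<subseteq> V" using G(2) assms(2) by (intro clause_vars_subset) auto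
  finally show "contains_copy r H (Formula V S)"
    using G unfolding contains_copy_def subformula_def by auto
qed (auto simp: contains_copy_def subformula_def has_copy_def)

lemma has_copy_rename:
  assumes "has_copy r H S" "full H" "S \<subseteq> all_clauses r V" "inj_on \<pi> V"
  shows "has_copy r H (rename_clauses \<pi> S)"
proof -
  obtain G where G: "sat_formula r G" "clauses G \<subseteq> S" "isomorphic H G"
    using assms(1) by (auto simp: has_copy_def)
  obtain f \<sigma> where f: "bij_betw f (vars H) (vars G)"
    and cG: "clauses G = (\<lambda>C. (\<lambda>(v, b). (f v, b \<noteq> \<sigma> v)) ` C) ` clauses H"
    using G(3) unfolding isomorphic_def by blast
  have "vars G \<subseteq> clause_vars (clauses G)" by (rule isomorphic_full(3)[OF assms(2) G(3,1)])
  also have "\<dots> \<subseteq> V" using G(2) assms(3) by (intro clause_vars_subset) auto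
  finally have inj: "inj_on \<pi> (vars G)" by (rule inj_on_subset[OF assms(4)])
  let ?G = "Formula (\<pi> ` vars G) (rename_clauses \<pi> (clauses G))"
  have "sat_formula r ?G"
    using G(1) rename_all_clauses[OF _ inj] by (auto simp: sat_formula_def)
  moreover have "clauses ?G \<subseteq> rename_clauses \<pi> S" using rename_clauses_mono[OF G(2)] by simp
  moreover have "isomorphic H ?G"
    unfolding isomorphic_def
  proof (intro exI conjI)
    show "bij_betw (\<pi> \<circ> f) (vars H) (vars ?G)"
      using f inj by (auto intro: bij_betw_trans inj_on_imp_bij_betw)
    show "clauses ?G = (\<lambda>C. (\<lambda>(v, b). ((\<pi> \<circ> f) v, b \<noteq> \<sigma> v)) ` C) ` clauses H"
      unfolding rename_clauses_def cG by (simp add: image_image case_prod_unfold)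
  qed
  ultimately show ?thesis unfolding has_copy_def by blast
qed

text \<open>Copies of a full formula have balanced clause sets, and these avoid every clause with a
  pure literal.\<close>

lemma core_event_has_copy:
  assumes r: "r \<ge> 3" and H: "full H"
  shows "core_event r (has_copy r H)"
proof
  show "\<not> has_copy r H {}" using isomorphic_full(2)[OF H] by (auto simp: has_copy_def)
next
  fix S :: "nat clause set" and V C l
  assume *: "finite V" "S \<subseteq> all_clauses r V" "C \<in> S" "l \<in> C" "neg l \<notin> \<Union>S"
  have "clauses G \<subseteq> S - {C}" if "clauses G \<subseteq> S" "balanced (clauses G)" for G
  proof -
    have "C \<notin> clauses G" using that *(4,5) unfolding balanced_def by blast
    then show ?thesis using that(1) by blast
  qed
  note sub = this
  show "has_copy r H S = has_copy r H (S - {C})"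
  proof
    assume "has_copy r H S"
    then obtain G where G: "sat_formula r G" "clauses G \<subseteq> S" "isomorphic H G" by (auto simp: has_copy_def)
    from sub[OF G(2) isomorphic_full(1)[OF H G(3,1)]] G(1,3) show "has_copy r H (S - {C})"
      unfolding has_copy_def by (intro exI[of _ G]) simp
  next
    assume "has_copy r H (S - {C})"
    then obtain G where G: "sat_formula r G" "clauses G \<subseteq> S - {C}" "isomorphic H G" by (auto simp: has_copy_def)
    then have "clauses G \<subseteq> S" by auto
    with G(1,3) show "has_copy r H S" unfolding has_copy_def by (intro exI[of _ G]) simp
  qed
next
  fix S :: "nat clause set" and V and \<pi> :: "nat \<Rightarrow> nat"
  assume "finite V" "S \<subseteq> all_clauses r V" "inj_on \<pi> V" "has_copy r H S"
  then show "has_copy r H (rename_clauses \<pi> S)" by (intro has_copy_rename[OF _ H])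
qed (rule r)

lemma core_event_unsat:
  assumes r: "r \<ge> 3"
  shows "core_event r (\<lambda>S. \<not> sat_clauses S)"
proof
  show "\<not> \<not> sat_clauses {}" by (simp add: sat_clauses_def)
next
  fix S :: "nat clause set" and V C l
  assume *: "finite V" "S \<subseteq> all_clauses r V" "C \<in> S" "l \<in> C" "neg l \<notin> \<Union>S"
  have "sat_clauses S" if sat: "sat_clauses (S - {C})"
  proof -
    obtain \<tau> where \<tau>: "\<And>D. D \<in> S - {C} \<Longrightarrow> \<exists>m\<in>D. \<tau> (fst m) = snd m"
      using sat unfolding sat_clauses_def by blast
    \<comment> \<open>Making the pure literal true satisfies \<open>C\<close> and harms no other
      clause, as its complement occurs nowhere.\<close>
    let ?\<tau> = "\<tau>(fst l := snd l)"
    have "\<exists>m\<in>D. ?\<tau> (fst m) = snd m" if D: "D \<in> S" for D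
    proof (cases "D = C")
      case True
      then show ?thesis using *(4) by (intro bexI[of _ l]) auto
    next
      case False
      then obtain m where m: "m \<in> D" "\<tau> (fst m) = snd m" using \<tau> D by blast
      show ?thesis
      proof (cases "fst m = fst l")
        case True
        then have "m = l" using m(1) D *(5) by (auto simp: fst_eq_iff_literal)
        then show ?thesis using m(1) by (intro bexI[of _ m]) auto
      next
        case False
        then show ?thesis using m by (intro bexI[of _ m]) auto
      qed
    qed
    then show ?thesis unfolding sat_clauses_def by blast
  qed
  moreover have "sat_clauses (S - {C})" if "sat_clauses S" using that unfolding sat_clauses_def by blast
  ultimately show "(\<not> sat_clauses S) = (\<not> sat_clauses (S - {C}))" by blast
next
  fix S :: "nat clause set" and V and \<pi> :: "nat \<Rightarrow> nat"
  assume "\<not> sat_clauses S"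
  moreover have "sat_clauses S" if sat: "sat_clauses (rename_clauses \<pi> S)"
  proof -
    obtain \<tau> where \<tau>: "\<And>D. D \<in> rename_clauses \<pi> S \<Longrightarrow> \<exists>m\<in>D. \<tau> (fst m) = snd m"
      using sat unfolding sat_clauses_def by blast
    \<comment> \<open>A satisfying assignment of the renamed clauses is pulled back along
      \<pi>.\<close>
    have "\<exists>m\<in>C. (\<tau> \<circ> \<pi>) (fst m) = snd m" if "C \<in> S" for C
    proof -
      have "map_prod \<pi> id ` C \<in> rename_clauses \<pi> S" using that by (simp add: rename_clauses_def)
      from \<tau>[OF this] show ?thesis by auto
    qed
    then show ?thesis unfolding sat_clauses_def by blast
  qed
  ultimately show "\<not> sat_clauses (rename_clauses \<pi> S)" by blast
qed (rule r)

lemma core_event_balanced: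
  assumes r: "r \<ge> 3"
  shows "core_event r (\<lambda>S. \<exists>G\<subseteq>S. G \<noteq> {} \<and> balanced G)"
proof
  fix S :: "nat clause set" and V C l
  assume *: "finite V" "S \<subseteq> all_clauses r V" "C \<in> S" "l \<in> C" "neg l \<notin> \<Union>S"
  have "G \<subseteq> S - {C}" if "G \<subseteq> S" "balanced G" for G
  proof -
    have "C \<notin> G" using that *(4,5) unfolding balanced_def by blast
    then show ?thesis using that(1) by blast
  qed
  then show "(\<exists>G\<subseteq>S. G \<noteq> {} \<and> balanced G) = (\<exists>G\<subseteq>S - {C}. G \<noteq> {} \<and> balanced G)" by blast
next
  fix S :: "nat clause set" and V and \<pi> :: "nat \<Rightarrow> nat"
  assume "\<exists>G\<subseteq>S. G \<noteq> {} \<and> balanced G"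
  then obtain G where G: "G \<subseteq> S" "G \<noteq> {}" "balanced G" by blast
  have "rename_clauses \<pi> G \<noteq> {}" using G(2) by (simp add: rename_clauses_def)
  with rename_clauses_mono[OF G(1), of \<pi>] balanced_rename[OF G(3), of \<pi>]
  show "\<exists>G\<subseteq>rename_clauses \<pi> S. G \<noteq> {} \<and> balanced G" by blast
qed (use r in auto)

theorem theorem12:
  fixes r :: nat
  assumes "r \<ge> 3"
  shows
    "(\<forall>H :: 'v formula. sat_formula r H \<and> full H \<longrightarrow>
       (\<exists>q :: nat \<Rightarrow> rat poly. \<forall>(\<alpha> :: nat \<Rightarrow> real) (smax :: nat).
          subcritical r \<alpha> \<and> smax \<ge> 1 \<longrightarrow>
          (\<lambda>n. measure_pmf.prob (random_sat_formula r n (\<alpha> n / real n ^ (r - 1)))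
                 {F. contains_copy r H F}
               - (\<Sum>s=1..smax. rat_poly_eval (q s) (\<alpha> n) / real n ^ s))
            \<in> O(\<lambda>n. 1 / real n ^ (smax + 1)))) \<and>
     (\<exists>q :: nat \<Rightarrow> rat poly. \<forall>(\<alpha> :: nat \<Rightarrow> real) (smax :: nat).
        subcritical r \<alpha> \<and> smax \<ge> 1 \<longrightarrow>
        (\<lambda>n. measure_pmf.prob (random_sat_formula r n (\<alpha> n / real n ^ (r - 1)))
               {F. \<not> satisfiable F}
             - (\<Sum>s=1..smax. rat_poly_eval (q s) (\<alpha> n) / real n ^ s))
          \<in> O(\<lambda>n. 1 / real n ^ (smax + 1))) \<and>
     (\<exists>q' :: nat \<Rightarrow> rat poly. \<forall>(\<alpha> :: nat \<Rightarrow> real) (smax :: nat).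
        subcritical r \<alpha> \<and> smax \<ge> 1 \<longrightarrow>
        (\<lambda>n. measure_pmf.prob (random_sat_formula r n (\<alpha> n / real n ^ (r - 1)))
               {F. pure_literal_rule_fails F}
             - (\<Sum>s=1..smax. rat_poly_eval (q' s) (\<alpha> n) / real n ^ s))
          \<in> O(\<lambda>n. 1 / real n ^ (smax + 1)))"
proof (intro conjI allI impI)
  fix H :: "'v formula"
  assume "sat_formula r H \<and> full H"
  then have H: "full H" by simp
  show "\<exists>q :: nat \<Rightarrow> rat poly. \<forall>(\<alpha> :: nat \<Rightarrow> real) (smax :: nat).
          subcritical r \<alpha> \<and> smax \<ge> 1 \<longrightarrow>
          (\<lambda>n. measure_pmf.prob (random_sat_formula r n (\<alpha> n / real n ^ (r - 1)))
                 {F. contains_copy r H F}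
               - (\<Sum>s=1..smax. rat_poly_eval (q s) (\<alpha> n) / real n ^ s))
            \<in> O(\<lambda>n. 1 / real n ^ (smax + 1))"
    by (rule core_event.formula_probability_expansion[OF core_event_has_copy[OF assms H]])
      (rule contains_copy_iff[OF H])
next
  show "\<exists>q :: nat \<Rightarrow> rat poly. \<forall>(\<alpha> :: nat \<Rightarrow> real) (smax :: nat).
        subcritical r \<alpha> \<and> smax \<ge> 1 \<longrightarrow>
        (\<lambda>n. measure_pmf.prob (random_sat_formula r n (\<alpha> n / real n ^ (r - 1)))
               {F. \<not> satisfiable F}
             - (\<Sum>s=1..smax. rat_poly_eval (q s) (\<alpha> n) / real n ^ s))
          \<in> O(\<lambda>n. 1 / real n ^ (smax + 1))"
    by (rule core_event.formula_probability_expansion[OF core_event_unsat[OF assms]])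
      (simp add: satisfiable_iff)
next
  show "\<exists>q' :: nat \<Rightarrow> rat poly. \<forall>(\<alpha> :: nat \<Rightarrow> real) (smax :: nat).
        subcritical r \<alpha> \<and> smax \<ge> 1 \<longrightarrow>
        (\<lambda>n. measure_pmf.prob (random_sat_formula r n (\<alpha> n / real n ^ (r - 1)))
               {F. pure_literal_rule_fails F}
             - (\<Sum>s=1..smax. rat_poly_eval (q' s) (\<alpha> n) / real n ^ s))
          \<in> O(\<lambda>n. 1 / real n ^ (smax + 1))"
    by (rule core_event.formula_probability_expansion[OF core_event_balanced[OF assms]])
      (simp add: pure_literal_rule_fails_iff)
qed

end
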